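(* Let $p\neq 2$ be a prime and let $n$ be a (positive) even integer. Then for any $\varepsilon>0$, the function $\mathrm{nmExt}:\mathbb{F}_p^n\times\mathbb{F}_p^{n/2}\to\mathbb{F}_p$ given by $\mathrm{nmExt}(X,Y)=\langle X, Y\|Y^2\rangle$ is a $(k,\varepsilon)$ quantum-proof non-malleable extractor with $$k=\Big(\frac n2+6\Big)\log p-1+4\log\frac1\varepsilon .$$
   Context: $\log$ is base $2$; $\langle\cdot,\cdot\rangle$ is the standard inner product over $\mathbb{F}_p^n$; $\|$ denotes concatenation. Fix an $\mathbb{F}_p$-linear bijection $\phi:\mathbb{F}_p^{n/2}\to\mathbb{F}_{p^{n/2}}$; for $y\in\mathbb{F}_p^{n/2}$ define $y^2=\phi^{-1}(\phi(y)^2)$. All Hilbert spaces are finite-dimensional; $\mathrm{L}(\mathcal H)$ denotes the linear operators on $\mathcal H$. A cq state is a density matrix $\rho_{XE}=\sum_x|x\rangle\langle x|_X\otimes\rho_E^x$ with $\rho_E^x\ge 0$ and $\sum_x\mathrm{Tr}\,\rho^x_E=1$. Its min-entropy is $H_{\min}(X|E)_\rho=\max\{\lambda\ge 0:\exists\,\sigma_E\ge0,\ \mathrm{Tr}\,\sigma_E\le1,\ 2^{-\lambda}I_X\otimes\sigma_E\ge\rho_{XE}\}$; equivalently $2^{-H_{\min}(X|E)_\rho}=\sup_{\{M_x\}}\sum_x\mathrm{Tr}(M_x\rho_E^x)$ over POVMs $\{M_x\}$ on $\mathcal H_E$. No fixed points: a CPTP map $T:\mathrm{L}(\mathcal H_Y\otimes\mathcal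 H_E)\to\mathrm{L}(\mathcal H_Y\otimes\mathcal H_{E'})$ has no fixed points if for every density matrix $\rho_E$ on $\mathcal H_E$ and every computational basis state $|y\rangle\in\mathcal H_Y$, $\langle y|\,\mathrm{Tr}_{E'}\big(T(|y\rangle\langle y|\otimes\rho_E)\big)|y\rangle=0$. Quantum-proof non-malleable extractor: let $\mathcal H_X,\mathcal H_Y,\mathcal H_Z$ have computational bases indexed by the finite sets $\mathcal X,\mathcal Y,\mathcal Z$. A function $\mathrm{nmExt}:\mathcal X\times\mathcal Y\to\mathcal Z$ is a $(k,\varepsilon)$ quantum-proof non-malleable extractor if for every finite-dimensional $\mathcal H_E,\mathcal H_{E'}$, every cq state $\rho_{XE}$ with $H_{\min}(X|E)_\rho\ge k$ and every CPTP map $\mathrm{Adv}:\mathrm{L}(\mathcal H_Y\otimes\mathcal H_E)\to\mathrm{L}(\mathcal H_Y\otimes\mathcal H_{E'})$ with no fixed points, $$\tfrac12\big\|\sigma_{\mathrm{nmExt}(X,Y)\,\mathrm{nmExt}(X,Y')\,YY'E'}-U_Z\otimes\sigma_{\mathrm{nmExt}(X,Y')\,YY'E'}\big\|_1\le\varepsilon,$$ where $U_Z$ is the maximally mixed state on $\mathcal H_Z$, $\sigma_{YY'XE'}=\frac1{|\mathcal Y|}\sum_{y}|y\rangle\langle y|_Y\otimes(I_X\otimes\mathrm{Adv})(|y\rangle\langle y|\otimes\rho_{XE})$, the $\mathcal H_Y$-output of $\mathrm{Adv}$ being the register $Y'$, which is treated as a classical register (diagonal in the computational basis), and $\sigma_{\mathrm{nmExt}(X,Y)\mathrm{nmExt}(X,Y')YY'E'}$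 is obtained by classically computing $\mathrm{nmExt}(X,Y)$ and $\mathrm{nmExt}(X,Y')$ into ancilla registers and tracing out $X$. Here $\mathcal X=\mathbb{F}_p^n$, $\mathcal Y=\mathbb{F}_p^{n/2}$, $\mathcal Z=\mathbb{F}_p$. *)

theory Defs
  imports
    Complex_Main
    "HOL-Library.FuncSet"
    "HOL-Library.Nonpos_Ints"
    "Jordan_Normal_Form.Matrix"
    "Berlekamp_Zassenhaus.Finite_Field"
begin

text \<open>
  A finite-dimensional Hilbert space is given by a finite set \<open>I\<close> indexing its computational
  (orthonormal) basis. An operator on it is the array of its matrix entries
  \<open>A i j\<close> (row \<open>i\<close>, column \<open>j\<close>), required to vanish outside \<open>I\<close> so
  that operators are equal iff their arrays are. A tensor product of Hilbert spaces is indexed by the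
  product of the index sets; no enumeration of basis vectors by numbers is needed.
\<close>

type_synonym 'i operator = "'i \<Rightarrow> 'i \<Rightarrow> complex"

definition operators :: "'i set \<Rightarrow> 'i operator set" where
  "operators I = {A. \<forall>i j. i \<notin> I \<or> j \<notin> I \<longrightarrow> A i j = 0}"

definition op_id :: "'i set \<Rightarrow> 'i operator" where
  "op_id I = (\<lambda>i j. if i = j \<and> i \<in> I then 1 else 0)"

definition op_adjoint :: "'i operator \<Rightarrow> 'i operator" where
  "op_adjoint A = (\<lambda>i j. cnj (A j i))"

definition op_mult :: "'i set \<Rightarrow> 'i operator \<Rightarrow> 'i operator \<Rightarrow> 'i operator" where
  "op_mult I A B = (\<lambda>i k. \<Sum>j\<in>I. A i j * B j k)"

definition op_minus :: "'i operator \<Rightarrow> 'i operator \<Rightarrow> 'i operator" where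
  "op_minus A B = (\<lambda>i j. A i j - B i j)"

definition op_scale :: "complex \<Rightarrow> 'i operator \<Rightarrow> 'i operator" where
  "op_scale c A = (\<lambda>i j. c * A i j)"

definition op_tensor :: "'i operator \<Rightarrow> 'j operator \<Rightarrow> ('i \<times> 'j) operator" where
  "op_tensor A B = (\<lambda>(i, j) (i', j'). A i i' * B j j')"

definition op_trace :: "'i set \<Rightarrow> 'i operator \<Rightarrow> complex" where
  "op_trace I A = (\<Sum>i\<in>I. A i i)"

definition ptrace_fst :: "'i set \<Rightarrow> ('i \<times> 'j) operator \<Rightarrow> 'j operator" where
  "ptrace_fst I A = (\<lambda>j j'. \<Sum>i\<in>I. A (i, j) (i, j'))"

definition ptrace_snd :: "'j set \<Rightarrow> ('i \<times> 'j) operator \<Rightarrow> 'i operator" where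
  "ptrace_snd J A = (\<lambda>i i'. \<Sum>j\<in>J. A (i, j) (i', j))"

text \<open>The projector \<open>|y><y|\<close>.\<close>

definition basis_proj :: "'i \<Rightarrow> 'i operator" where
  "basis_proj y = (\<lambda>i j. if i = y \<and> j = y then 1 else 0)"

text \<open>Over the complex numbers, a nonnegative real quadratic form already forces Hermiticity.\<close>

definition positive_op :: "'i set \<Rightarrow> 'i operator \<Rightarrow> bool" where
  "positive_op I A \<longleftrightarrow> A \<in> operators I \<and>
     (\<forall>v :: 'i \<Rightarrow> complex. (\<Sum>i\<in>I. \<Sum>j\<in>I. cnj (v i) * A i j * v j) \<in> \<real>\<^sub>\<ge>\<^sub>0)"

definition density_op :: "'i set \<Rightarrow> 'i operator \<Rightarrow> bool" where
  "density_op I A \<longleftrightarrow> positive_op I A \<and> op_trace I A = 1"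

definition op_sqrt :: "'i set \<Rightarrow> 'i operator \<Rightarrow> 'i operator" where
  "op_sqrt I A = (THE B. positive_op I B \<and> op_mult I B B = A)"

definition trace_norm :: "'i set \<Rightarrow> 'i operator \<Rightarrow> real" where
  "trace_norm I A = Re (op_trace I (op_sqrt I (op_mult I (op_adjoint A) A)))"

text \<open>The map \<open>id \<otimes> T\<close>, acting blockwise on operators over a product.\<close>

definition id_tensor ::
  "('i operator \<Rightarrow> 'j operator) \<Rightarrow> ('a \<times> 'i) operator \<Rightarrow> ('a \<times> 'j) operator" where
  "id_tensor T M = (\<lambda>(a, j) (b, j'). T (\<lambda>i i'. M (a, i) (b, i')) j j')"

text \<open>Completely positive trace-preserving maps from operators over \<open>I\<close> to operators over \<open>J\<close>.\<close>

definition cptp :: "'i set \<Rightarrow> 'j set \<Rightarrow> ('i operator \<Rightarrow> 'j operator) \<Rightarrow> bool" where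
  "cptp I J T \<longleftrightarrow>
     T \<in> operators I \<rightarrow> operators J \<and>
     (\<forall>A \<in> operators I. \<forall>B \<in> operators I.
        T (\<lambda>i j. A i j + B i j) = (\<lambda>i j. T A i j + T B i j)) \<and>
     (\<forall>c. \<forall>A \<in> operators I. T (op_scale c A) = op_scale c (T A)) \<and>
     (\<forall>r::nat. \<forall>M. positive_op ({..<r} \<times> I) M \<longrightarrow> positive_op ({..<r} \<times> J) (id_tensor T M)) \<and>
     (\<forall>A \<in> operators I. op_trace J (T A) = op_trace I A)"

text \<open>
  A cq state is given by its family of conditional operators \<open>\<rho> x\<close> on the second register;
  \<open>cq_op\<close> is the corresponding operator on the joint space.
\<close>

definition cq_op :: "'x set \<Rightarrow> ('x \<Rightarrow> 'e operator) \<Rightarrow> ('x \<times> 'e) operator" where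
  "cq_op X \<rho> = (\<lambda>u v. \<Sum>x\<in>X. op_tensor (basis_proj x) (\<rho> x) u v)"

definition cq_state :: "'x set \<Rightarrow> 'e set \<Rightarrow> ('x \<Rightarrow> 'e operator) \<Rightarrow> bool" where
  "cq_state X E \<rho> \<longleftrightarrow> (\<forall>x\<in>X. positive_op E (\<rho> x)) \<and> (\<Sum>x\<in>X. op_trace E (\<rho> x)) = 1"

text \<open>For a cq state over finite sets the set below has a maximum, which \<open>Sup\<close> then denotes.\<close>

definition min_entropy :: "'x set \<Rightarrow> 'e set \<Rightarrow> ('x \<Rightarrow> 'e operator) \<Rightarrow> real" where
  "min_entropy X E \<rho> = Sup {l. 0 \<le> l \<and>
     (\<exists>\<sigma>. positive_op E \<sigma> \<and> Re (op_trace E \<sigma>) \<le> 1 \<and>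
        positive_op (X \<times> E)
          (op_minus (op_scale (of_real (2 powr (- l))) (op_tensor (op_id X) \<sigma>)) (cq_op X \<rho>)))}"

definition no_fixed_points ::
  "'y set \<Rightarrow> 'e set \<Rightarrow> 'f set \<Rightarrow> (('y \<times> 'e) operator \<Rightarrow> ('y \<times> 'f) operator) \<Rightarrow> bool" where
  "no_fixed_points Y E E' T \<longleftrightarrow>
     (\<forall>\<rho>. \<forall>y\<in>Y. density_op E \<rho> \<longrightarrow>
        ptrace_snd E' (T (op_tensor (basis_proj y) \<rho>)) y y = 0)"

text \<open>
  The state of the registers \<open>Y, Y', X, E'\<close> after the adversary acted. The indicator
  \<open>y1' = y2'\<close> dephases \<open>Y'\<close> in the computational basis.
\<close>

definition attack_state ::
  "'y set \<Rightarrow> (('y \<times> 'e) operator \<Rightarrow> ('y \<times> 'f) operator) \<Rightarrow> ('x \<times> 'e) operator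
     \<Rightarrow> ('y \<times> 'y \<times> 'x \<times> 'f) operator" where
  "attack_state Y Adv \<rho>XE = (\<lambda>(y1, y1', x1, f1) (y2, y2', x2, f2).
     1 / of_nat (card Y) *
     (\<Sum>y\<in>Y. basis_proj y y1 y2 *
        (if y1' = y2' then
           id_tensor Adv
             (\<lambda>(x, w, e) (x', w', e'). basis_proj y w w' * \<rho>XE (x, e) (x', e'))
             (x1, y1', f1) (x2, y2', f2)
         else 0)))"

text \<open>
  The state of the registers \<open>ext(X,Y), ext(X,Y'), Y, Y', E'\<close>: apply to
  \<open>\<sigma>\<close> the isometry
  \<open>|y, y', x, f> \<mapsto> |ext x y> |ext x y'> |y, y', x, f>\<close> and trace out \<open>X\<close>.
\<close>

definition ext_state ::
  "'x set \<Rightarrow> ('x \<Rightarrow> 'y \<Rightarrow> 'z) \<Rightarrow> ('y \<times> 'y \<times> 'x \<times> 'f) operator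
     \<Rightarrow> ('z \<times> 'z \<times> 'y \<times> 'y \<times> 'f) operator" where
  "ext_state X ext \<sigma> = (\<lambda>(z1, z1', y1, y1', f1) (z2, z2', y2, y2', f2).
     \<Sum>x\<in>X.
       if z1 = ext x y1 \<and> z1' = ext x y1' \<and> z2 = ext x y2 \<and> z2' = ext x y2'
       then \<sigma> (y1, y1', x, f1) (y2, y2', x, f2) else 0)"

definition max_mixed :: "'z set \<Rightarrow> 'z operator" where
  "max_mixed Z = op_scale (1 / of_nat (card Z)) (op_id Z)"

text \<open>
  The side-information spaces range over all finite dimensions \<open>d\<close> and \<open>d'\<close>.
\<close>

definition quantum_proof_nm_extractor ::
  "'x set \<Rightarrow> 'y set \<Rightarrow> 'z set \<Rightarrow> ('x \<Rightarrow> 'y \<Rightarrow> 'z) \<Rightarrow> real \<Rightarrow> real \<Rightarrow> bool" where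
  "quantum_proof_nm_extractor X Y Z ext k \<epsilon> \<longleftrightarrow>
     finite X \<and> finite Y \<and> finite Z \<and> ext \<in> X \<rightarrow> Y \<rightarrow> Z \<and>
     (\<forall>(d::nat) (d'::nat) \<rho> Adv.
        cq_state X {..<d} \<rho> \<and> min_entropy X {..<d} \<rho> \<ge> k \<and>
        cptp (Y \<times> {..<d}) (Y \<times> {..<d'}) Adv \<and>
        no_fixed_points Y {..<d} {..<d'} Adv \<longrightarrow>
        (let \<sigma> = ext_state X ext (attack_state Y Adv (cq_op X \<rho>))
         in 1 / 2 * trace_norm (Z \<times> Z \<times> Y \<times> Y \<times> {..<d'})
              (op_minus \<sigma> (op_tensor (max_mixed Z) (ptrace_fst Z \<sigma>))) \<le> \<epsilon>))"

text \<open>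
  The prime field is \<open>'p mod_ring\<close> with \<open>CARD('p)\<close> prime. Its scalars act on a field
  \<open>'q\<close> of the same characteristic through the embedding
  \<open>c \<mapsto> of_int (to_int_mod_ring c)\<close>.
\<close>

definition prime_field_linear ::
  "nat \<Rightarrow> ('p::prime_card mod_ring vec \<Rightarrow> 'q::field) \<Rightarrow> bool" where
  "prime_field_linear m \<phi> \<longleftrightarrow>
     (\<forall>u \<in> carrier_vec m. \<forall>v \<in> carrier_vec m. \<phi> (u + v) = \<phi> u + \<phi> v) \<and>
     (\<forall>c. \<forall>v \<in> carrier_vec m. \<phi> (c \<cdot>\<^sub>v v) = of_int (to_int_mod_ring c) * \<phi> v)"

definition vec_square ::
  "nat \<Rightarrow> ('p::prime_card mod_ring vec \<Rightarrow> 'q::field) \<Rightarrow> 'p mod_ring vec \<Rightarrow> 'p mod_ring vec" where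
  "vec_square m \<phi> y = inv_into (carrier_vec m) \<phi> ((\<phi> y)\<^sup>2)"

definition nmExt ::
  "nat \<Rightarrow> ('p::prime_card mod_ring vec \<Rightarrow> 'q::field)
     \<Rightarrow> 'p mod_ring vec \<Rightarrow> 'p mod_ring vec \<Rightarrow> 'p mod_ring" where
  "nmExt n \<phi> x y = x \<bullet> (y @\<^sub>v vec_square (n div 2) \<phi> y)"

end

theory Submission
  imports
    Defs
    "Berlekamp_Zassenhaus.Berlekamp_Type_Based"
    "HOL-Analysis.Function_Topology"
    "HOL-Analysis.L2_Norm"
begin

text \<open>
  Write \<open>c\<close> for \<open>2\<close> to the power \<open>- H\<close>, where \<open>H\<close> is (almost) the min-entropy, so that
  \<open>\<rho> x \<le> c \<sigma>\<close> for a fixed state \<open>\<sigma>\<close>, and let the adversary be given by Kraus operators. By duality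
  the trace norm is a trace against a contraction, block by block in the classical registers.
  Expanding the two extractor outputs in additive characters of the prime field reduces everything to sums
  over \<open>x, y, y'\<close> of \<open>\<omega> (x \<bullet> \<gamma> y y')\<close> times a trace against \<open>\<rho> x\<close>, with
  \<open>\<gamma> y y' = a (y, y\<^sup>2) + b (y', y'\<^sup>2)\<close> and \<open>a \<noteq> 0\<close>. One application of Cauchy-Schwarz replaces
  \<open>\<rho> x\<close> by \<open>c \<sigma>\<close>; orthogonality of the characters of the vector space then leaves the sum over
  frequencies \<open>g\<close> of the squared norms of the operators collected at \<open>\<gamma> y y' = g\<close>. As
  \<open>y' \<noteq> y\<close>, each \<open>g\<close> is attained for at most two values of \<open>y\<close>, so that this sum is at most twice
  the number of seeds. Every Fourier coefficient is thus at most the square root of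
  \<open>2 c p\<^sup>n / |Y|\<close>, which beats the required bound; for \<open>\<epsilon> \<ge> 1\<close>, the claim is the trivial bound on the trace distance.
\<close>

section \<open>Operators and the spectral theorem\<close>

text \<open>The side information is quantum, so the answer \<open>y'\<close> cannot be fixed as a
  function of \<open>y\<close> and the pairs cannot simply be counted. Instead the dual contraction
  is moved back through the Kraus operators, which turns each pair \<open>(y, y')\<close> into an
  operator on the side information before the attack. Answers to the same seed add up without loss,
  as together they form one trace-preserving map; only distinct seeds with the same frequency cost a
  factor, namely their number. Hence seeds are counted and not pairs: for \<open>b = 0\<close> all
  answers share the frequency of the seed. Min-entropy has a single task, to replace
  \<open>\<rho> x\<close> by an operator that does not depend on \<open>x\<close>, so that
  characters can be summed over \<open>x\<close>. The balance of constants, with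
  \<open>q = |Y|\<close> and \<open>q^2 = p^n\<close>: fewer than \<open>p^2\<close> coefficients,
  each at most \<open>sqrt (2 c q)\<close>, give a trace norm of at most
  \<open>p^2 sqrt (2 c q)\<close>. For \<open>c \<le> 4 \<epsilon>^4 / (q p^6)\<close> this is at
  most \<open>sqrt 8 \<epsilon>^2 / p\<close>, hence at most \<open>2 \<epsilon>^2\<close>.\<close>

definition ip :: "'i set \<Rightarrow> ('i \<Rightarrow> complex) \<Rightarrow> ('i \<Rightarrow> complex) \<Rightarrow> complex" where
  "ip I u v = (\<Sum>i\<in>I. cnj (u i) * v i)"

abbreviation norm_sq :: "'i set \<Rightarrow> ('i \<Rightarrow> complex) \<Rightarrow> real" where
  "norm_sq I v \<equiv> (\<Sum>i\<in>I. (cmod (v i))\<^sup>2)"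

definition app :: "'i set \<Rightarrow> ('j \<Rightarrow> 'i \<Rightarrow> complex) \<Rightarrow> ('i \<Rightarrow> complex) \<Rightarrow> 'j \<Rightarrow> complex" where
  "app I A v = (\<lambda>i. \<Sum>j\<in>I. A i j * v j)"

definition hermitian_op :: "'i operator \<Rightarrow> bool" where
  "hermitian_op A \<longleftrightarrow> (\<forall>i j. A i j = cnj (A j i))"

lemma ip_self: "ip I u u = of_real (\<Sum>i\<in>I. (cmod (u i))\<^sup>2)"
  unfolding ip_def of_real_sum
  by (intro sum.cong refl) (metis complex_norm_square mult.commute of_real_power)

lemma ip_cnj: "cnj (ip I u v) = ip I v u"
  by (simp add: ip_def mult.commute)

lemma ip_add_right: "ip I u (\<lambda>i. v i + w i) = ip I u v + ip I u w"
  by (simp add: ip_def sum.distrib algebra_simps)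

lemma ip_scale_right: "ip I u (\<lambda>i. c * v i) = c * ip I u v"
  by (simp add: ip_def sum_distrib_left algebra_simps)

lemma ip_add_left: "ip I (\<lambda>i. v i + w i) u = ip I v u + ip I w u"
  by (simp add: ip_def sum.distrib algebra_simps)

lemma ip_scale_left: "ip I (\<lambda>i. c * v i) u = cnj c * ip I v u"
  by (simp add: ip_def sum_distrib_left algebra_simps)

lemma ip_sum_right: "ip I u (\<lambda>i. \<Sum>k\<in>K. v k i) = (\<Sum>k\<in>K. ip I u (v k))"
  unfolding ip_def by (subst sum.swap) (simp add: sum_distrib_left)

lemma app_add: "app I A (\<lambda>i. v i + w i) = (\<lambda>i. app I A v i + app I A w i)"
  by (simp add: app_def sum.distrib algebra_simps)

lemma app_scale: "app I A (\<lambda>i. c * v i) = (\<lambda>i. c * app I A v i)"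
  by (simp add: app_def sum_distrib_left algebra_simps)

lemma app_mult: "app I A (app I B v) = app I (op_mult I A B) v"
proof
  fix i
  have "app I A (app I B v) i = (\<Sum>j\<in>I. \<Sum>k\<in>I. A i j * B j k * v k)"
    by (simp add: app_def sum_distrib_left mult.assoc)
  also have "\<dots> = (\<Sum>k\<in>I. \<Sum>j\<in>I. A i j * B j k * v k)" by (rule sum.swap)
  also have "\<dots> = app I (op_mult I A B) v i" by (simp add: app_def op_mult_def sum_distrib_right)
  finally show "app I A (app I B v) i = app I (op_mult I A B) v i" .
qed

lemma hermitian_ip:
  assumes "hermitian_op A"
  shows "ip I u (app I A v) = ip I (app I A u) v"
proof -
  have "ip I u (app I A v) = (\<Sum>i\<in>I. \<Sum>j\<in>I. cnj (u i) * A i j * v j)"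
    by (simp add: ip_def app_def sum_distrib_left mult.assoc)
  also have "\<dots> = (\<Sum>j\<in>I. \<Sum>i\<in>I. cnj (A j i * u i) * v j)"
    using assms unfolding hermitian_op_def
    by (subst sum.swap) (intro sum.cong refl, metis complex_cnj_mult mult.commute)
  also have "\<dots> = ip I (app I A u) v"
    by (simp add: ip_def app_def sum_distrib_right)
  finally show ?thesis .
qed

lemma ip_app_sum: "ip I u (app I A v) = (\<Sum>i\<in>I. \<Sum>j\<in>I. cnj (u i) * A i j * v j)"
  by (simp add: ip_def app_def sum_distrib_left mult.assoc)

lemma sq_sum_eq_0_imp:
  assumes "finite I" "ip I u u = 0" "i \<in> I"
  shows "u i = 0"
  using assms by (auto simp: ip_self sum_nonneg_eq_0_iff simp flip: of_real_sum)

section \<open>Eigenvectors by maximising the Rayleigh quotient\<close>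

text \<open>First-order condition at a maximum, without derivatives: at \<open>t = - a / c\<close>
  with \<open>c > \<bar>b\<bar>\<close> a nonzero linear term outweighs the quadratic one.\<close>

lemma linear_dominated_by_square:
  fixes a b :: real
  assumes "\<And>t. 0 \<le> 2 * t * a + t\<^sup>2 * b"
  shows "a = 0"
proof (rule ccontr)
  assume "a \<noteq> 0"
  define c where "c = \<bar>b\<bar> + 1"
  have c: "c > 0" by (simp add: c_def)
  have "0 \<le> 2 * (- a / c) * a + (- a / c)\<^sup>2 * b" by (rule assms)
  also have "\<dots> \<le> 2 * (- a / c) * a + (- a / c)\<^sup>2 * c"
    by (intro add_left_mono mult_left_mono) (auto simp: c_def)
  also have "\<dots> = - (a\<^sup>2 / c)"
    using c by (simp add: power2_eq_square field_simps)
  also have "\<dots> < 0" using \<open>a \<noteq> 0\<close> c by simp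
  finally show False by simp
qed

text \<open>The Rayleigh quotient of \<open>A\<close> attains its maximum on the unit sphere of the
  range of \<open>Q\<close>, and the first variation there shows that a maximiser is an eigenvector.
  Carrying \<open>Q\<close> along places the next eigenvector inside the part of the space not yet
  diagonalised.\<close>

lemma eigenvector_in_range_of_projection:
  fixes A Q :: "'i operator"
  assumes fin: "finite I" and Aop: "A \<in> operators I" and Qop: "Q \<in> operators I"
    and herm: "hermitian_op A"
    and idem: "op_mult I Q Q = Q" and comm: "op_mult I A Q = op_mult I Q A"
    and nz: "Q \<noteq> (\<lambda>i j. 0)"
  obtains v \<mu> where "\<And>i. i \<notin> I \<Longrightarrow> v i = 0" "ip I v v = 1" "app I Q v = v"
    "app I A v = (\<lambda>i. complex_of_real \<mu> * v i)"
proof -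
  define S where "S = {v. (\<forall>i. i \<notin> I \<longrightarrow> v i = 0) \<and> ip I v v = 1 \<and> (\<forall>i. app I Q v i = v i)}"
  define D :: "complex set" where "D = (\<lambda>z. Complex (fst z) (snd z)) ` ({-1..1} \<times> {-1..1})"
  have "compact D"
    unfolding D_def Complex_eq
    by (intro compact_continuous_image compact_Times compact_Icc continuous_intros)
  have in_D: "z \<in> D" if "cmod z \<le> 1" for z
  proof -
    have "\<bar>Re z\<bar> \<le> 1" "\<bar>Im z\<bar> \<le> 1"
      using that abs_Re_le_cmod[of z] abs_Im_le_cmod[of z] by linarith+
    hence "(Re z, Im z) \<in> {-1..1} \<times> {-1..1}" by auto
    thus ?thesis unfolding D_def by (rule rev_image_eqI) simp
  qed
  \<comment> \<open>The index type may be infinite, so compactness is taken in the product topology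
    on all functions: coordinates in \<open>I\<close> stay in the square \<open>D\<close>, all
    others are pinned to \<open>0\<close>.\<close>
  define K :: "('i \<Rightarrow> complex) set" where "K = Pi\<^sub>E UNIV (\<lambda>i. if i \<in> I then D else {0})"
  have "compact K"
  proof -
    have "compactin (product_topology (\<lambda>i. euclidean) (UNIV :: 'i set)) K"
      unfolding K_def using \<open>compact D\<close> by (subst compactin_PiE) auto
    thus ?thesis by (simp add: euclidean_product_topology)
  qed
  have cont: "continuous_on UNIV (\<lambda>v::'i \<Rightarrow> complex. v i)" for i
    by (rule continuous_on_product_coordinates)
  have cont_app: "continuous_on UNIV (\<lambda>v::'i \<Rightarrow> complex. app I B v i)" for i B
    unfolding app_def by (intro continuous_intros cont)
  have cont_ip: "continuous_on UNIV (\<lambda>v. ip I v (f v))"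
    if "\<And>i. continuous_on UNIV (\<lambda>v. f v i)" for f :: "('i \<Rightarrow> complex) \<Rightarrow> 'i \<Rightarrow> complex"
    unfolding ip_def by (intro continuous_intros cont that)
  have "closed S"
    unfolding S_def
    by (intro closed_Collect_conj closed_Collect_all closed_Collect_imp closed_Collect_eq cont
        cont_app cont_ip continuous_intros open_Collect_const)
  have "S \<subseteq> K"
  proof
    fix v assume v: "v \<in> S"
    have "cmod (v i) \<le> 1" if "i \<in> I" for i
    proof -
      have "(cmod (v i))\<^sup>2 \<le> (\<Sum>i\<in>I. (cmod (v i))\<^sup>2)"
        by (rule member_le_sum[OF that]) (auto simp: fin)
      also have "\<dots> = 1"
        using v unfolding S_def ip_self of_real_eq_1_iff by auto
      finally show ?thesis by (simp add: abs_square_le_1)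
    qed
    thus "v \<in> K" using v in_D by (auto simp: K_def S_def)
  qed
  with \<open>compact K\<close> \<open>closed S\<close> have "compact S"
    by (metis compact_Int_closed inf.absorb2 )
  have "S \<noteq> {}"
  proof -
    obtain a b where ab: "Q a b \<noteq> 0" using nz by (meson ext)
    with Qop have I: "a \<in> I" "b \<in> I" by (auto simp: operators_def)
    \<comment> \<open>A nonzero column of an idempotent is fixed by it; normalised, it lies in
      \<open>S\<close>.\<close>
    define u where "u = (\<lambda>i. Q i b)"
    have "app I Q u = (\<lambda>i. op_mult I Q Q i b)" by (simp add: app_def op_mult_def u_def)
    hence Qu: "app I Q u = u" by (simp add: idem u_def)
    have "ip I u u \<noteq> 0" using sq_sum_eq_0_imp[OF fin _ I(1), of u] ab by (auto simp: u_def)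
    define r where "r = (\<Sum>i\<in>I. (cmod (u i))\<^sup>2)"
    have r2: "ip I u u = of_real r" unfolding r_def by (rule ip_self)
    have "r \<ge> 0" by (simp add: r_def sum_nonneg)
    with \<open>ip I u u \<noteq> 0\<close> r2 have r1: "r > 0" by auto
    note r = r1 r2
    define c where "c = 1 / sqrt r"
    have c: "c * c * r = 1" using r(1) by (simp add: c_def field_simps)
    define w where "w = (\<lambda>i. of_real c * u i)"
    have "ip I w w = of_real (c * c * r)"
      unfolding w_def ip_scale_left ip_scale_right r(2) by simp
    moreover have "app I Q w = w" unfolding w_def app_scale Qu ..
    moreover have "u i = 0" if "i \<notin> I" for i using Qop that by (auto simp: u_def operators_def)
    ultimately have "w \<in> S" using c by (auto simp: S_def w_def)
    thus ?thesis by blast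
  qed
  have cf: "continuous_on S (\<lambda>v. Re (ip I v (app I A v)))"
    by (rule continuous_on_subset[of UNIV]) (intro continuous_intros cont_ip cont_app, simp)
  obtain v where v: "v \<in> S" and vmax: "\<And>w. w \<in> S \<Longrightarrow> Re (ip I w (app I A w)) \<le> Re (ip I v (app I A v))"
    using continuous_attains_sup[OF \<open>compact S\<close> \<open>S \<noteq> {}\<close> cf] by blast
  define \<mu> where "\<mu> = Re (ip I v (app I A v))"
  have supp: "v i = 0" if "i \<notin> I" for i using v that by (auto simp: S_def)
  have Qv: "app I Q v = v" using v by (auto simp: S_def)
  have nv: "ip I v v = 1" using v by (auto simp: S_def)
  define h where "h = (\<lambda>w. Re (ip I w (app I A w)))"
  have hmax: "h w \<le> \<mu> * Re (ip I w w)"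
    if "\<And>i. i \<notin> I \<Longrightarrow> w i = 0" "app I Q w = w" for w
  proof (cases "ip I w w = 0")
    case True
    hence "\<And>i. i \<in> I \<Longrightarrow> w i = 0" using sq_sum_eq_0_imp[OF fin] by blast
    hence "h w = 0" by (simp add: h_def ip_def)
    thus ?thesis using True by simp
  next
    case False
    define r where "r = (\<Sum>i\<in>I. (cmod (w i))\<^sup>2)"
    have r2: "ip I w w = of_real r" unfolding r_def by (rule ip_self)
    have "r \<ge> 0" by (simp add: r_def sum_nonneg)
    with False r2 have r1: "r > 0" by auto
    note r = r1 r2
    define c where "c = 1 / sqrt r"
    have c: "c * c * r = 1" using r(1) by (simp add: c_def field_simps)
    define u where "u = (\<lambda>i. of_real c * w i)"
    have "ip I u u = of_real (c * c * r)"
      unfolding u_def ip_scale_left ip_scale_right r(2) by simp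
    moreover have "app I Q u = u" unfolding u_def app_scale that(2) ..
    ultimately have "u \<in> S" using that(1) c by (auto simp: S_def u_def)
    hence "h u \<le> \<mu>" using vmax by (simp add: h_def \<mu>_def)
    moreover have "h u = c * c * h w"
      unfolding h_def u_def ip_scale_left ip_scale_right app_scale by simp
    moreover have "h w = r * (c * c * h w)" using c by (metis mult.commute mult.left_commute mult_1)
    ultimately have "h w \<le> r * \<mu>"
      using r(1) by (metis mult_left_mono less_imp_le)
    thus ?thesis using r by (simp add: mult.commute)
  qed
  \<comment> \<open>The residual of the eigenvalue equation serves as the direction of variation. It
    stays in the range of \<open>Q\<close> since \<open>A\<close> commutes with \<open>Q\<close>,
    and the linear coefficient along it is \<open>Re (ip I z z)\<close> itself.\<close>
  define z where "z = (\<lambda>i. complex_of_real \<mu> * v i - app I A v i)"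
  have z_eq: "z = (\<lambda>i. complex_of_real \<mu> * v i + (-1) * app I A v i)" by (simp add: z_def)
  have zsupp: "z i = 0" if "i \<notin> I" for i
    using supp[OF that] Aop that by (simp add: z_def app_def operators_def)
  have Qz: "app I Q z = z"
  proof -
    have "app I Q (app I A v) = app I A v"
      by (simp add: app_mult flip: comm) (simp add: Qv flip: app_mult)
    thus ?thesis unfolding z_eq app_add app_scale by (simp add: Qv)
  qed
  have zz: "ip I v (app I A z) = ip I (app I A v) z" "ip I z (app I A v) = cnj (ip I (app I A v) z)"
    by (auto simp: hermitian_ip[OF herm] ip_cnj)
  have "Re (ip I z z) = 0"
  proof (rule linear_dominated_by_square)
    fix t :: real
    define w where "w = (\<lambda>i. v i + of_real t * z i)"
    have 1: "h w \<le> \<mu> * Re (ip I w w)"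
      by (rule hmax) (auto simp: w_def supp zsupp app_add app_scale Qv Qz)
    have 2: "h w = \<mu> + 2 * t * Re (ip I (app I A v) z) + t\<^sup>2 * h z"
      unfolding h_def w_def app_add app_scale ip_add_left ip_add_right ip_scale_left
        ip_scale_right zz \<mu>_def by (simp add: power2_eq_square algebra_simps)
    have 3: "Re (ip I w w) = 1 + 2 * t * Re (ip I v z) + t\<^sup>2 * Re (ip I z z)"
      using ip_cnj[of I v z, symmetric]
      unfolding w_def ip_add_left ip_add_right ip_scale_left ip_scale_right nv
      by (simp add: power2_eq_square algebra_simps)
    have "ip I (\<lambda>i. of_real \<mu> * v i + (-1) * app I A v i) z
        = of_real \<mu> * ip I v z - ip I (app I A v) z"
      unfolding ip_add_left ip_scale_left by simp
    hence 4: "Re (ip I z z) = \<mu> * Re (ip I v z) - Re (ip I (app I A v) z)"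
      unfolding z_eq[symmetric] by simp
    show "0 \<le> 2 * t * Re (ip I z z) + t\<^sup>2 * (\<mu> * Re (ip I z z) - h z)"
      using 1 unfolding 2 3 4 by (simp add: algebra_simps)
  qed
  hence "ip I z z = 0" unfolding ip_self by (simp only: Re_complex_of_real of_real_0)
  hence "z i = 0" for i using sq_sum_eq_0_imp[OF fin] zsupp by blast
  hence "app I A v = (\<lambda>i. complex_of_real \<mu> * v i)" by (auto simp: z_def)
  with supp nv Qv show ?thesis by (rule that)
qed

lemma cauchy_schwarz_complex_sum:
  fixes x y :: "'k \<Rightarrow> complex"
  shows "(cmod (\<Sum>k\<in>K. x k * y k))\<^sup>2 \<le> (\<Sum>k\<in>K. (cmod (x k))\<^sup>2) * (\<Sum>k\<in>K. (cmod (y k))\<^sup>2)"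
proof -
  have "cmod (\<Sum>k\<in>K. x k * y k) \<le> (\<Sum>k\<in>K. \<bar>cmod (x k)\<bar> * \<bar>cmod (y k)\<bar>)"
    by (rule norm_sum[THEN order_trans]) (simp add: norm_mult)
  also have "\<dots> \<le> L2_set (\<lambda>k. cmod (x k)) K * L2_set (\<lambda>k. cmod (y k)) K"
    by (rule L2_set_mult_ineq)
  finally have "(cmod (\<Sum>k\<in>K. x k * y k))\<^sup>2
      \<le> (L2_set (\<lambda>k. cmod (x k)) K * L2_set (\<lambda>k. cmod (y k)) K)\<^sup>2"
    by (rule power_mono) simp
  thus ?thesis by (simp add: power_mult_distrib L2_set_def sum_nonneg)
qed

section \<open>Diagonalisation of Hermitian operators\<close>

text \<open>The operator \<open>\<Sum>k<m. f k |V k><V k|\<close>. Orthonormal \<open>V\<close>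
  gives a spectral decomposition; \<open>f = 1\<close> with vectors of any length gives a Gram
  decomposition of a positive operator.\<close>

definition outer_sum ::
  "nat \<Rightarrow> (nat \<Rightarrow> complex) \<Rightarrow> (nat \<Rightarrow> 'i \<Rightarrow> complex) \<Rightarrow> 'i operator" where
  "outer_sum m f V = (\<lambda>i j. \<Sum>k<m. f k * V k i * cnj (V k j))"

definition orthonormal :: "'i set \<Rightarrow> nat \<Rightarrow> (nat \<Rightarrow> 'i \<Rightarrow> complex) \<Rightarrow> bool" where
  "orthonormal I m V \<longleftrightarrow> (\<forall>k<m. \<forall>l<m. ip I (V k) (V l) = (if k = l then 1 else 0)) \<and>
     (\<forall>k<m. \<forall>i. i \<notin> I \<longrightarrow> V k i = 0)"

lemma app_outer_sum: "app I (outer_sum m f V) w = (\<lambda>i. \<Sum>k<m. f k * ip I (V k) w * V k i)"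
proof
  fix i
  have "app I (outer_sum m f V) w i = (\<Sum>j\<in>I. \<Sum>k<m. f k * V k i * cnj (V k j) * w j)"
    by (simp add: app_def outer_sum_def sum_distrib_right)
  also have "\<dots> = (\<Sum>k<m. \<Sum>j\<in>I. f k * V k i * cnj (V k j) * w j)" by (rule sum.swap)
  also have "\<dots> = (\<Sum>k<m. f k * ip I (V k) w * V k i)"
    by (simp add: ip_def sum_distrib_left sum_distrib_right mult_ac)
  finally show "app I (outer_sum m f V) w i = (\<Sum>k<m. f k * ip I (V k) w * V k i)" .
qed

lemma ip_outer_sum:
  "ip I a (app I (outer_sum m f V) b) = (\<Sum>k<m. f k * ip I a (V k) * ip I (V k) b)"
  unfolding app_outer_sum ip_sum_right ip_scale_right by (simp add: mult_ac)

lemma op_mult_eq_app: "op_mult I A B i k = app I A (\<lambda>j. B j k) i"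
  by (simp add: op_mult_def app_def)

text \<open>Functional calculus in a fixed eigenbasis: squares, absolute values and signs of a
  Hermitian operator are formed on its eigenvalues.\<close>

lemma op_mult_outer_sum:
  assumes "orthonormal I m V"
  shows "op_mult I (outer_sum m f V) (outer_sum m g V) = outer_sum m (\<lambda>k. f k * g k) V"
proof (intro ext)
  fix i j
  have ip: "ip I (V k) (\<lambda>l. outer_sum m g V l j) = g k * cnj (V k j)" if "k < m" for k
  proof -
    have "(\<lambda>l. outer_sum m g V l j) = (\<lambda>i. \<Sum>l<m. (g l * cnj (V l j)) * V l i)"
      by (simp add: outer_sum_def mult_ac)
    hence "ip I (V k) (\<lambda>l. outer_sum m g V l j)
        = (\<Sum>l<m. g l * cnj (V l j) * ip I (V k) (V l))"
      by (simp only: ip_sum_right ip_scale_right)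
    also have "\<dots> = (\<Sum>l<m. if l = k then g k * cnj (V k j) else 0)"
      using assms that by (intro sum.cong refl) (simp add: orthonormal_def)
    also have "\<dots> = g k * cnj (V k j)" using that by (subst sum.delta) auto
    finally show ?thesis .
  qed
  have "op_mult I (outer_sum m f V) (outer_sum m g V) i j
      = (\<Sum>k<m. f k * (g k * cnj (V k j)) * V k i)"
    unfolding op_mult_eq_app app_outer_sum by (intro sum.cong refl) (simp add: ip)
  thus "op_mult I (outer_sum m f V) (outer_sum m g V) i j = outer_sum m (\<lambda>k. f k * g k) V i j"
    by (simp add: outer_sum_def mult_ac)
qed

lemma op_trace_outer_sum:
  assumes "orthonormal I m V"
  shows "op_trace I (outer_sum m f V) = (\<Sum>k<m. f k)"
proof -
  have "op_trace I (outer_sum m f V) = (\<Sum>k<m. f k * ip I (V k) (V k))"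
    unfolding op_trace_def outer_sum_def ip_def sum_distrib_left
    by (subst sum.swap) (simp add: mult_ac)
  also have "\<dots> = (\<Sum>k<m. f k)"
    using assms by (intro sum.cong) (auto simp: orthonormal_def)
  finally show ?thesis .
qed

text \<open>Induction on a bound for the trace of the projection \<open>Q\<close>, which stands in
  for its rank. An eigenvector \<open>v\<close> of \<open>A\<close> in the range of \<open>Q\<close>
  is split off; \<open>Q - |v><v|\<close> is again a projection commuting with \<open>A\<close>, and
  its trace is smaller by one. Eigenvectors found later lie in its range and are therefore
  orthogonal to \<open>v\<close>.\<close>

lemma projection_decomposition:
  fixes A Q :: "'i operator"
  assumes fin: "finite I" and Aop: "A \<in> operators I" and herm: "hermitian_op A"
  shows "Q \<in> operators I \<Longrightarrow> hermitian_op Q \<Longrightarrow> op_mult I Q Q = Q \<Longrightarrow>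
    op_mult I A Q = op_mult I Q A \<Longrightarrow> Re (op_trace I Q) \<le> real n \<Longrightarrow>
    \<exists>m V \<mu>. orthonormal I m V \<and> Q = outer_sum m (\<lambda>k. 1) V \<and>
      (\<forall>k<m. app I Q (V k) = V k \<and> app I A (V k) = (\<lambda>i. complex_of_real (\<mu> k) * V k i))"
proof (induction n arbitrary: Q)
  case 0
  have "Q i j = 0" for i j
  proof (cases "i \<in> I \<and> j \<in> I")
    case True
    \<comment> \<open>For a Hermitian idempotent the trace is the sum of the squares of all
      \<open>cmod (Q a b)\<close>, so a trace of at most zero forces \<open>Q = 0\<close>.\<close>
    have "Q a a = of_real (\<Sum>b\<in>I. (cmod (Q a b))\<^sup>2)" for a
    proof -
      have "Q a a = op_mult I Q Q a a" by (simp add: 0)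
      also have "\<dots> = (\<Sum>b\<in>I. Q a b * cnj (Q a b))"
        using 0(2) unfolding op_mult_def hermitian_op_def by (intro sum.cong refl) metis
      also have "\<dots> = of_real (\<Sum>b\<in>I. (cmod (Q a b))\<^sup>2)"
        unfolding of_real_sum by (intro sum.cong refl) (metis complex_norm_square of_real_power)
      finally show ?thesis .
    qed
    hence "Re (op_trace I Q) = (\<Sum>a\<in>I. \<Sum>b\<in>I. (cmod (Q a b))\<^sup>2)"
      unfolding op_trace_def by (metis (no_types, lifting) Re_complex_of_real Re_sum sum.cong)
    with 0(5) have "(\<Sum>a\<in>I. \<Sum>b\<in>I. (cmod (Q a b))\<^sup>2) = 0"
      by (simp add: sum_nonneg antisym)
    thus ?thesis using True fin by (simp add: sum_nonneg_eq_0_iff sum_nonneg)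
  next
    case False
    thus ?thesis using 0(1) by (auto simp: operators_def)
  qed
  hence "Q = outer_sum 0 (\<lambda>k. 1) (\<lambda>_ _. 0)" by (auto simp: outer_sum_def)
  thus ?case by (intro exI[of _ 0]) (auto simp: orthonormal_def outer_sum_def)
next
  case (Suc n)
  show ?case
  proof (cases "Q = (\<lambda>i j. 0)")
    case True
    thus ?thesis by (intro exI[of _ 0]) (auto simp: orthonormal_def outer_sum_def)
  next
    case False
    obtain v \<nu> where v: "\<And>i. i \<notin> I \<Longrightarrow> v i = 0" "ip I v v = 1" "app I Q v = v"
      "app I A v = (\<lambda>i. complex_of_real \<nu> * v i)"
      using eigenvector_in_range_of_projection[OF fin Aop Suc.prems(1) herm Suc.prems(3,4) False]
      by blast
    define R where "R = (\<lambda>i j. Q i j - v i * cnj (v j))"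
    have R_col: "(\<lambda>i. R i j) = (\<lambda>i. Q i j + (- cnj (v j)) * v i)" for j
      by (simp add: R_def mult.commute)
    have appR: "app I R w = (\<lambda>i. app I Q w i - v i * ip I v w)" for w
      by (simp add: R_def app_def ip_def sum_subtractf algebra_simps sum_distrib_left)
    have ipcol: "ip I v (\<lambda>i. B i j) = cnj (app I B v j)" if "hermitian_op B" for B j
      unfolding ip_def app_def cnj_sum
      using that by (intro sum.cong refl) (metis complex_cnj_mult hermitian_op_def mult.commute)
    have Qv: "app I R v = (\<lambda>i. 0)" by (simp add: appR v)
    have "R \<in> operators I" using Suc.prems(1) v(1) by (auto simp: R_def operators_def)
    moreover have hR: "hermitian_op R"
      using Suc.prems(2) unfolding hermitian_op_def R_def
      by (metis complex_cnj_cnj complex_cnj_diff complex_cnj_mult mult.commute)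
    moreover have "op_mult I R R = R"
    proof (intro ext)
      fix i j
      have "op_mult I R R i j = app I R (\<lambda>i. Q i j) i"
        unfolding op_mult_eq_app R_col app_add app_scale Qv by simp
      also have "\<dots> = R i j"
        unfolding appR ipcol[OF Suc.prems(2)] v op_mult_eq_app[symmetric] Suc.prems
        by (simp add: R_def)
      finally show "op_mult I R R i j = R i j" .
    qed
    moreover have "op_mult I A R = op_mult I R A"
    proof (intro ext)
      fix i j
      have "op_mult I A R i j = op_mult I A Q i j - cnj (v j) * of_real \<nu> * v i"
        unfolding op_mult_eq_app R_col app_add app_scale v by simp
      moreover have "op_mult I R A i j = op_mult I Q A i j - cnj (v j) * of_real \<nu> * v i"
        unfolding op_mult_eq_app appR ipcol[OF herm] v by simp
      ultimately show "op_mult I A R i j = op_mult I R A i j" by (simp add: Suc.prems)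
    qed
    moreover have "Re (op_trace I R) \<le> real n"
    proof -
      have "op_trace I R = op_trace I Q - ip I v v"
        by (simp add: op_trace_def R_def ip_def sum_subtractf mult.commute)
      thus ?thesis using Suc.prems(5) v(2) by simp
    qed
    ultimately obtain m V \<mu> where IH: "orthonormal I m V" "R = outer_sum m (\<lambda>k. 1) V"
      "\<And>k. k < m \<Longrightarrow> app I R (V k) = V k"
      "\<And>k. k < m \<Longrightarrow> app I A (V k) = (\<lambda>i. complex_of_real (\<mu> k) * V k i)"
      using Suc.IH[of R] by auto
    have orth: "ip I v (V k) = 0" if "k < m" for k
    proof -
      have "ip I v (V k) = ip I v (app I R (V k))" by (simp add: IH(3) that)
      also have "\<dots> = 0" unfolding hermitian_ip[OF hR] Qv by (simp add: ip_def)
      finally show ?thesis .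
    qed
    have orth': "ip I (V k) v = 0" if "k < m" for k
      using ip_cnj[of I v "V k"] orth[OF that] by simp
    have "app I Q (V k) = V k" if "k < m" for k
      using IH(3)[OF that] by (simp add: appR orth that)
    define U where "U = V(m := v)"
    have "orthonormal I (Suc m) U"
      using IH(1) v(1,2) orth orth' unfolding orthonormal_def U_def less_Suc_eq by auto
    moreover have "Q = outer_sum (Suc m) (\<lambda>k. 1) U"
    proof (intro ext)
      fix i j
      have "Q i j = R i j + v i * cnj (v j)" by (simp add: R_def)
      thus "Q i j = outer_sum (Suc m) (\<lambda>k. 1) U i j"
        by (simp add: IH(2) outer_sum_def U_def)
    qed
    moreover have "\<forall>k<Suc m. app I Q (U k) = U k \<and>
        app I A (U k) = (\<lambda>i. complex_of_real ((\<mu>(m := \<nu>)) k) * U k i)"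
      using v IH(4) \<open>\<And>k. k < m \<Longrightarrow> app I Q (V k) = V k\<close> by (auto simp: U_def less_Suc_eq)
    ultimately show ?thesis by blast
  qed
qed

lemma app_op_id:
  assumes "finite I" "i \<in> I"
  shows "app I (op_id I) v i = v i"
proof -
  have "app I (op_id I) v i = (\<Sum>j\<in>I. if i = j then v j else 0)"
    unfolding app_def op_id_def using assms by (intro sum.cong) auto
  thus ?thesis using assms by simp
qed

lemma ip_app_op_id: "finite I \<Longrightarrow> ip I u (app I (op_id I) v) = ip I u v"
  unfolding ip_def by (intro sum.cong refl) (simp add: app_op_id)

text \<open>The case \<open>Q = op_id I\<close>. The resolution of the identity is recorded
  separately, since Parseval and the expansion of a second operator in this eigenbasis rest on
  it.\<close>

lemma spectral_decomposition:
  fixes A :: "'i operator"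
  assumes fin: "finite I" and Aop: "A \<in> operators I" and herm: "hermitian_op A"
  obtains m V \<mu> where "orthonormal I m V" "op_id I = outer_sum m (\<lambda>k. 1) V"
    "A = outer_sum m (\<lambda>k. complex_of_real (\<mu> k)) V"
    "\<And>k. k < m \<Longrightarrow> app I A (V k) = (\<lambda>i. complex_of_real (\<mu> k) * V k i)"
proof -
  have id: "op_mult I (op_id I) B = B" if "B \<in> operators I" for B
  proof (intro ext)
    fix i j
    show "op_mult I (op_id I) B i j = B i j"
    proof (cases "i \<in> I")
      case True thus ?thesis by (simp add: op_mult_eq_app app_op_id fin)
    next
      case False thus ?thesis using that by (simp add: op_mult_def op_id_def operators_def)
    qed
  qed
  have id': "op_mult I B (op_id I) = B" if "B \<in> operators I" for B
  proof (intro ext)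
    fix i j
    have "op_mult I B (op_id I) i j = (\<Sum>k\<in>I. if k = j then B i k else 0)"
      unfolding op_mult_def op_id_def by (intro sum.cong) auto
    also have "\<dots> = B i j" using that fin by (auto simp: operators_def)
    finally show "op_mult I B (op_id I) i j = B i j" .
  qed
  have idop: "op_id I \<in> operators I" by (auto simp: op_id_def operators_def)
  have "\<exists>n. Re (op_trace I (op_id I)) \<le> real n" by (rule real_arch_simple)
  then obtain n where n: "Re (op_trace I (op_id I)) \<le> real n" ..
  have "hermitian_op (op_id I)" by (auto simp: op_id_def hermitian_op_def)
  from projection_decomposition[OF fin Aop herm idop this id[OF idop] _ n] id[OF Aop] id'[OF Aop]
  obtain m V \<mu> where *: "orthonormal I m V" "op_id I = outer_sum m (\<lambda>k. 1) V"
    "\<And>k. k < m \<Longrightarrow> app I A (V k) = (\<lambda>i. complex_of_real (\<mu> k) * V k i)"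
    by auto
  have "A = outer_sum m (\<lambda>k. complex_of_real (\<mu> k)) V"
  proof (intro ext)
    fix i j
    have "A i j = op_mult I A (outer_sum m (\<lambda>k. 1) V) i j"
      by (simp add: id'[OF Aop] flip: *(2))
    also have "\<dots> = (\<Sum>k<m. cnj (V k j) * app I A (V k) i)"
      unfolding op_mult_def outer_sum_def app_def sum_distrib_left
      by (subst sum.swap) (simp add: mult_ac)
    also have "\<dots> = outer_sum m (\<lambda>k. complex_of_real (\<mu> k)) V i j"
      by (simp add: *(3) outer_sum_def mult_ac)
    finally show "A i j = outer_sum m (\<lambda>k. complex_of_real (\<mu> k)) V i j" .
  qed
  with * show ?thesis using that by blast
qed

section \<open>Positive operators, Gram vectors and the square root\<close>

lemma positive_op_ip: "positive_op I A \<longleftrightarrow> A \<in> operators I \<and> (\<forall>v. ip I v (app I A v) \<in> \<real>\<^sub>\<ge>\<^sub>0)"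
  by (simp add: positive_op_def ip_app_sum)

text \<open>Polarisation: the form is real at \<open>e i + e j\<close> and at
  \<open>e i + \<i> * e j\<close>, which makes the imaginary and the real part of
  \<open>A i j - cnj (A j i)\<close> vanish.\<close>

lemma positive_op_hermitian:
  assumes fin: "finite I" and pos: "positive_op I A"
  shows "hermitian_op A"
proof -
  have Aop: "A \<in> operators I" using pos by (simp add: positive_op_def)
  have im: "Im (ip I v (app I A v)) = 0" for v
  proof -
    have "ip I v (app I A v) \<in> \<real>\<^sub>\<ge>\<^sub>0" using pos unfolding positive_op_ip by blast
    thus ?thesis by (elim nonneg_Reals_cases) simp
  qed
  define e where "e = (\<lambda>(i::'a) l. if l = i then 1 else (0::complex))"
  have e: "ip I (e i) (app I A (e j)) = A i j" if "i \<in> I" "j \<in> I" for i j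
  proof -
    have "app I A (e j) = (\<lambda>i. \<Sum>l\<in>I. if l = j then A i l else 0)"
      unfolding app_def e_def by (intro ext sum.cong) auto
    hence "app I A (e j) = (\<lambda>i. A i j)" using that fin by simp
    moreover have "ip I (e i) w = w i" for w
    proof -
      have "ip I (e i) w = (\<Sum>l\<in>I. if l = i then w l else 0)"
        unfolding ip_def e_def by (intro sum.cong) auto
      thus ?thesis using that fin by simp
    qed
    ultimately show ?thesis by simp
  qed
  have "A i j = cnj (A j i)" for i j
  proof (cases "i \<in> I \<and> j \<in> I")
    case True
    hence ij: "i \<in> I" "j \<in> I" by auto
    have q: "ip I (\<lambda>l. e i l + c * e j l) (app I A (\<lambda>l. e i l + c * e j l))
        = A i i + c * A i j + cnj c * A j i + cnj c * c * A j j" for c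
      unfolding app_add app_scale ip_add_left ip_add_right ip_scale_left ip_scale_right
      by (simp add: e[OF ij(1) ij(1)] e[OF ij] e[OF ij(2) ij(1)] e[OF ij(2) ij(2)] distrib_left)
    have d: "Im (A i i) = 0" "Im (A j j) = 0"
      using im[of "e i"] im[of "e j"] by (simp_all add: e ij)
    have "Im (A i j) + Im (A j i) = 0"
      using im[of "\<lambda>l. e i l + 1 * e j l"] unfolding q by (simp add: d)
    moreover have "Re (A i j) - Re (A j i) = 0"
      using im[of "\<lambda>l. e i l + \<i> * e j l"] unfolding q by (simp add: d)
    ultimately show ?thesis by (simp add: complex_eq_iff)
  next
    case False
    thus ?thesis using Aop by (auto simp: operators_def)
  qed
  thus ?thesis unfolding hermitian_op_def by blast
qed

lemma outer_sum_in_operators: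
  "orthonormal I m V \<Longrightarrow> outer_sum m f V \<in> operators I"
  by (auto simp: orthonormal_def outer_sum_def operators_def intro!: sum.neutral)

lemma mult_cnj_self: "z * cnj z = complex_of_real ((cmod z)\<^sup>2)"
  by (metis complex_norm_square of_real_power)

lemma eigenvalue_of_positive:
  assumes "positive_op I A" "ip I v v = 1" "app I A v = (\<lambda>i. complex_of_real \<mu> * v i)"
  shows "\<mu> \<ge> 0"
proof -
  have "ip I v (app I A v) \<in> \<real>\<^sub>\<ge>\<^sub>0" using assms(1) unfolding positive_op_ip by blast
  thus ?thesis unfolding assms(3) ip_scale_right assms(2) by simp
qed

text \<open>Square roots of the eigenvalues are absorbed into the eigenvectors. Traces against
  positive operators thereby become sums over vectors, to which the scalar Cauchy-Schwarz inequality
  applies.\<close>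

lemma positive_op_gram:
  assumes fin: "finite I" and pos: "positive_op I A"
  obtains m u where "A = outer_sum m (\<lambda>k. 1) u"
proof -
  have "A \<in> operators I" using pos by (simp add: positive_op_def)
  from spectral_decomposition[OF fin this positive_op_hermitian[OF fin pos]]
  obtain m V \<mu> where *: "orthonormal I m V"
    "A = outer_sum m (\<lambda>k. complex_of_real (\<mu> k)) V"
    "\<And>k. k < m \<Longrightarrow> app I A (V k) = (\<lambda>i. complex_of_real (\<mu> k) * V k i)" by metis
  have nn: "\<mu> k \<ge> 0" if "k < m" for k
    using eigenvalue_of_positive[OF pos _ *(3)[OF that]] *(1) that
    by (simp add: orthonormal_def)
  have "outer_sum m (\<lambda>k. complex_of_real (\<mu> k)) V
      = outer_sum m (\<lambda>k. 1) (\<lambda>k i. of_real (sqrt (\<mu> k)) * V k i)"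
  proof -
    have "complex_of_real (\<mu> k) * x * y = 1 * (of_real (sqrt (\<mu> k)) * x) * (of_real (sqrt (\<mu> k)) * y)"
      if "k < m" for k x y
    proof -
      have "complex_of_real (\<mu> k) = of_real (sqrt (\<mu> k)) * of_real (sqrt (\<mu> k))"
        unfolding of_real_mult[symmetric] using nn[OF that] by simp
      thus ?thesis by (simp add: mult_ac)
    qed
    thus ?thesis unfolding outer_sum_def by (auto intro!: ext sum.cong)
  qed
  with *(2) show ?thesis by (intro that) simp
qed

lemma positive_op_outer_sum:
  assumes "orthonormal I m V" "\<And>k. k < m \<Longrightarrow> f k \<ge> 0"
  shows "positive_op I (outer_sum m (\<lambda>k. complex_of_real (f k)) V)"
  unfolding positive_op_ip
proof (intro conjI allI)
  fix v
  have "ip I v (app I (outer_sum m (\<lambda>k. complex_of_real (f k)) V) v)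
      = of_real (\<Sum>k<m. f k * (cmod (ip I v (V k)))\<^sup>2)"
    unfolding ip_outer_sum of_real_sum of_real_mult mult_cnj_self[symmetric] ip_cnj
    by (simp add: mult_ac)
  moreover have "(\<Sum>k<m. f k * (cmod (ip I v (V k)))\<^sup>2) \<ge> 0"
    using assms(2) by (intro sum_nonneg) auto
  ultimately show "ip I v (app I (outer_sum m (\<lambda>k. complex_of_real (f k)) V) v) \<in> \<real>\<^sub>\<ge>\<^sub>0"
    by (metis nonneg_Reals_of_real_iff)
qed (rule outer_sum_in_operators[OF assms(1)])

text \<open>Needed because \<open>op_sqrt\<close> is a definite description. For an eigenvector
  \<open>w\<close> of \<open>B\<close> with eigenvalue \<open>\<mu> > 0\<close>, the vector
  \<open>P w - \<mu> w\<close> satisfies the eigenvalue equation of \<open>P\<close> for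
  \<open>- \<mu>\<close>, so positivity makes it zero; for \<open>\<mu> = 0\<close> the norm of
  \<open>P w\<close> vanishes. Hence \<open>P\<close> and \<open>B\<close> agree on an eigenbasis of
  \<open>B\<close>.\<close>

lemma positive_sqrt_unique:
  assumes fin: "finite I" and B: "positive_op I B" and P: "positive_op I P"
    and eq: "op_mult I B B = op_mult I P P"
  shows "B = P"
proof -
  have Bop: "B \<in> operators I" and Pop: "P \<in> operators I" using B P by (auto simp: positive_op_def)
  note hP = positive_op_hermitian[OF fin P]
  from spectral_decomposition[OF fin Bop positive_op_hermitian[OF fin B]]
  obtain m V \<mu> where *: "orthonormal I m V" "op_id I = outer_sum m (\<lambda>k. 1) V"
    "B = outer_sum m (\<lambda>k. complex_of_real (\<mu> k)) V"
    "\<And>k. k < m \<Longrightarrow> app I B (V k) = (\<lambda>i. complex_of_real (\<mu> k) * V k i)" by metis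
  have Psupp: "app I P w i = 0" if "i \<notin> I" for w i
    using Pop that by (simp add: app_def operators_def)
  have eig: "app I P (V k) = (\<lambda>i. complex_of_real (\<mu> k) * V k i)" if k: "k < m" for k
  proof -
    define w where "w = V k"
    have nn: "\<mu> k \<ge> 0"
      using eigenvalue_of_positive[OF B _ *(4)[OF that]] *(1) that by (simp add: orthonormal_def)
    have sq: "app I P (app I P w) = (\<lambda>i. of_real (\<mu> k) * (of_real (\<mu> k) * w i))"
      unfolding app_mult eq[symmetric] unfolding app_mult[symmetric] w_def *(4)[OF k] app_scale ..
    have "\<mu> k = 0 \<or> \<mu> k > 0" using nn by auto
    thus ?thesis
    proof
      assume 0: "\<mu> k = 0"
      have "ip I (app I P w) (app I P w) = ip I w (app I P (app I P w))"
        by (simp add: hermitian_ip[OF hP])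
      also have "\<dots> = 0" unfolding sq by (simp add: 0 ip_def)
      finally have "app I P w i = 0" for i using sq_sum_eq_0_imp[OF fin] Psupp by blast
      thus ?thesis by (auto simp: w_def 0)
    next
      assume p: "\<mu> k > 0"
      define z where "z = (\<lambda>i. app I P w i + (- of_real (\<mu> k)) * w i)"
      have "app I P z = (\<lambda>i. (- of_real (\<mu> k)) * z i)"
        unfolding z_def app_add app_scale sq by (auto simp: algebra_simps)
      hence "ip I z (app I P z) = - of_real (\<mu> k) * ip I z z" by (simp only: ip_scale_right)
      moreover have "ip I z (app I P z) \<in> \<real>\<^sub>\<ge>\<^sub>0" using P by (simp add: positive_op_ip)
      ultimately have "- (\<mu> k * (\<Sum>i\<in>I. (cmod (z i))\<^sup>2)) \<ge> 0"
        unfolding ip_self by (metis minus_mult_left nonneg_Reals_of_real_iff of_real_minus of_real_mult)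
      moreover have "(\<Sum>i\<in>I. (cmod (z i))\<^sup>2) \<ge> 0" by (simp add: sum_nonneg)
      ultimately have "(\<Sum>i\<in>I. (cmod (z i))\<^sup>2) = 0" using p
        by (smt (verit) mult_pos_pos)
      hence "ip I z z = 0" unfolding ip_self by simp
      moreover have "z i = 0" if "i \<notin> I" for i
        using Psupp[OF that] *(1) k that by (simp add: z_def w_def orthonormal_def)
      ultimately have "z i = 0" for i using sq_sum_eq_0_imp[OF fin] by blast
      thus ?thesis by (auto simp: z_def w_def)
    qed
  qed
  show ?thesis
  proof (intro ext)
    fix i j
    have "P i j = (\<Sum>k\<in>I. if k = j then P i k else 0)"
      using Pop fin by (auto simp: operators_def)
    also have "\<dots> = op_mult I P (op_id I) i j"
      unfolding op_mult_def op_id_def by (intro sum.cong) auto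
    also have "\<dots> = (\<Sum>k<m. cnj (V k j) * app I P (V k) i)"
      unfolding op_mult_def *(2) outer_sum_def app_def sum_distrib_left
      by (subst sum.swap) (simp add: mult_ac)
    also have "\<dots> = B i j"
      unfolding *(3) by (simp add: eig outer_sum_def mult_ac)
    finally show "B i j = P i j" by simp
  qed
qed

section \<open>Duality between the trace norm and contractions\<close>

text \<open>Operator norm at most one, phrased through the sesquilinear form: restricting to a block
  or composing with Kraus operators then only changes the vectors \<open>a\<close> and
  \<open>b\<close>.\<close>

definition contraction_op :: "'i set \<Rightarrow> 'i operator \<Rightarrow> bool" where
  "contraction_op I W \<longleftrightarrow> (\<forall>a b. (cmod (ip I a (app I W b)))\<^sup>2
     \<le> (\<Sum>i\<in>I. (cmod (a i))\<^sup>2) * (\<Sum>i\<in>I. (cmod (b i))\<^sup>2))"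

text \<open>The optimal contraction is the sign of \<open>A\<close>, formed on the same
  eigenvectors; \<open>P\<close>, the absolute value of \<open>A\<close>, is the square root in the
  definition of the trace norm. An attaining \<open>W\<close> makes the trace norm linear in
  \<open>A\<close>, so that the Fourier expansion can be inserted.\<close>

lemma trace_norm_dual:
  assumes fin: "finite I" and Aop: "A \<in> operators I" and herm: "hermitian_op A"
  obtains W where "contraction_op I W"
    "complex_of_real (trace_norm I A) = (\<Sum>i\<in>I. \<Sum>j\<in>I. W j i * A i j)"
proof -
  from spectral_decomposition[OF fin Aop herm]
  obtain m V \<mu> where *: "orthonormal I m V" "op_id I = outer_sum m (\<lambda>k. 1) V"
    "A = outer_sum m (\<lambda>k. complex_of_real (\<mu> k)) V" by metis
  define P where "P = outer_sum m (\<lambda>k. complex_of_real \<bar>\<mu> k\<bar>) V"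
  define W where "W = outer_sum m (\<lambda>k. complex_of_real (sgn (\<mu> k))) V"
  have "op_adjoint A i j = A i j" for i j
    using herm unfolding op_adjoint_def hermitian_op_def by (rule_tac sym) blast
  hence "op_adjoint A = A" by blast
  hence "op_mult I (op_adjoint A) A = op_mult I A A" by simp
  also have "\<dots> = op_mult I P P"
    unfolding *(3) P_def op_mult_outer_sum[OF *(1)]
    by (simp flip: of_real_mult)
  finally have sq: "op_mult I (op_adjoint A) A = op_mult I P P" .
  have posP: "positive_op I P" unfolding P_def by (rule positive_op_outer_sum[OF *(1)]) simp
  have "op_sqrt I (op_mult I (op_adjoint A) A) = P"
    unfolding op_sqrt_def sq
    by (rule the_equality) (blast intro: posP positive_sqrt_unique[OF fin _ posP])+
  hence "trace_norm I A = (\<Sum>k<m. \<bar>\<mu> k\<bar>)"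
    by (simp add: trace_norm_def P_def op_trace_outer_sum[OF *(1)])
  moreover have "op_trace I (op_mult I A W) = (\<Sum>k<m. complex_of_real \<bar>\<mu> k\<bar>)"
    unfolding *(3) W_def op_mult_outer_sum[OF *(1)] op_trace_outer_sum[OF *(1)]
    by (intro sum.cong refl) (simp only: abs_sgn of_real_mult)
  ultimately have tn: "complex_of_real (trace_norm I A) = (\<Sum>i\<in>I. \<Sum>j\<in>I. W j i * A i j)"
    by (simp add: op_trace_def op_mult_def mult.commute)
  have "contraction_op I W"
    unfolding contraction_op_def
  proof (intro allI)
    fix a b
    have parseval: "(\<Sum>k<m. (cmod (ip I (V k) w))\<^sup>2) = (\<Sum>i\<in>I. (cmod (w i))\<^sup>2)" for w
    proof -
      have "complex_of_real (\<Sum>k<m. (cmod (ip I (V k) w))\<^sup>2) = ip I w (app I (op_id I) w)"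
        unfolding *(2) ip_outer_sum of_real_sum mult_cnj_self[symmetric] ip_cnj
        by (simp add: mult_ac)
      also have "\<dots> = of_real (\<Sum>i\<in>I. (cmod (w i))\<^sup>2)"
        unfolding ip_app_op_id[OF fin] ip_self ..
      finally show ?thesis unfolding of_real_eq_iff .
    qed
    have nsw: "cmod (ip I a (V k)) = cmod (ip I (V k) a)" for k
      unfolding ip_cnj[of I "V k" a, symmetric] by simp
    have "(cmod (ip I a (app I W b)))\<^sup>2
        \<le> (\<Sum>k<m. (cmod (complex_of_real (sgn (\<mu> k)) * ip I a (V k)))\<^sup>2)
           * (\<Sum>k<m. (cmod (ip I (V k) b))\<^sup>2)"
      unfolding W_def ip_outer_sum by (rule cauchy_schwarz_complex_sum)
    also have "\<dots> \<le> (\<Sum>k<m. (cmod (ip I (V k) a))\<^sup>2) * (\<Sum>k<m. (cmod (ip I (V k) b))\<^sup>2)"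
    proof (intro mult_right_mono sum_mono power_mono sum_nonneg)
      fix k
      have "cmod (complex_of_real (sgn (\<mu> k))) \<le> 1" by (simp add: sgn_real_def)
      thus "cmod (complex_of_real (sgn (\<mu> k)) * ip I a (V k)) \<le> cmod (ip I (V k) a)"
        unfolding norm_mult by (subst nsw) (simp add: mult_left_le_one_le)
    qed auto
    finally show "(cmod (ip I a (app I W b)))\<^sup>2
        \<le> (\<Sum>i\<in>I. (cmod (a i))\<^sup>2) * (\<Sum>i\<in>I. (cmod (b i))\<^sup>2)"
      unfolding parseval .
  qed
  from this tn show ?thesis by (rule that)
qed

section \<open>Kraus operators\<close>

lemma additive_map_sum:
  assumes lin: "\<And>A B. A \<in> operators I \<Longrightarrow> B \<in> operators I \<Longrightarrow>
      T (\<lambda>i j. A i j + B i j) = (\<lambda>i j. T A i j + T B i j)"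
    and scale: "\<And>c A. A \<in> operators I \<Longrightarrow> T (op_scale c A) = op_scale c (T A)"
    and "finite S" "\<And>s. s \<in> S \<Longrightarrow> X s \<in> operators I"
  shows "T (\<lambda>i j. \<Sum>s\<in>S. c s * X s i j) = (\<lambda>i j. \<Sum>s\<in>S. c s * T (X s) i j)"
  using assms(3,4)
proof (induction S rule: finite_induct)
  case empty
  have "(\<lambda>i j. 0) \<in> operators I" by (simp add: operators_def)
  from scale[OF this, of 0] show ?case by (simp add: op_scale_def)
next
  case (insert s S)
  have "op_scale (c s) (X s) \<in> operators I"
    using insert.prems[of s] by (simp add: operators_def op_scale_def)
  moreover have "(\<lambda>i j. \<Sum>s\<in>S. c s * X s i j) \<in> operators I"
    using insert.prems by (auto simp: operators_def intro!: sum.neutral)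
  ultimately have "T (\<lambda>i j. op_scale (c s) (X s) i j + (\<Sum>s\<in>S. c s * X s i j))
      = (\<lambda>i j. T (op_scale (c s) (X s)) i j + T (\<lambda>i j. \<Sum>s\<in>S. c s * X s i j) i j)"
    by (rule lin)
  also have "\<dots> = (\<lambda>i j. c s * T (X s) i j + (\<Sum>s\<in>S. c s * T (X s) i j))"
    using insert.prems by (simp add: scale insert.IH) (simp add: op_scale_def)
  finally show ?case using insert.hyps by (simp add: op_scale_def)
qed

text \<open>This is \<open>L M L^*\<close>, the action of one Kraus operator.\<close>

definition conj_op :: "'i set \<Rightarrow> ('j \<Rightarrow> 'i \<Rightarrow> complex) \<Rightarrow> 'i operator \<Rightarrow> 'j operator" where
  "conj_op I L M = (\<lambda>j j'. \<Sum>i\<in>I. \<Sum>i'\<in>I. L j i * M i i' * cnj (L j' i'))"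

text \<open>Choi's argument: \<open>id \<otimes> T\<close> maps the unnormalised maximally entangled
  projector to a positive operator, whose Gram vectors, read as matrices, are Kraus operators. Trace
  preservation is recorded as a norm identity for vectors because in that form it limits the sums
  over answers.\<close>

lemma kraus_decomposition:
  fixes T :: "'i operator \<Rightarrow> 'j operator"
  assumes fin: "finite I" "finite J" and T: "cptp I J T"
  obtains m :: nat and K where
    "\<And>M j j'. M \<in> operators I \<Longrightarrow> T M j j' = (\<Sum>k<m. conj_op I (K k) M j j')"
    "\<And>v. (\<Sum>k<m. norm_sq J (app I (K k) v)) = norm_sq I v"
proof -
  define r where "r = card I"
  \<comment> \<open>Complete positivity is available for reference systems indexed by numbers, so
    the basis of \<open>I\<close> is enumerated.\<close>
  obtain h where h: "bij_betw h {..<r} I"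
    using ex_bij_betw_nat_finite[OF fin(1)] by (auto simp: r_def atLeast0LessThan)
  define g where "g = the_inv_into {..<r} h"
  have g: "g i < r" "h (g i) = i" if "i \<in> I" for i
    using h that the_inv_into_into[of h "{..<r}" i "{..<r}"] f_the_inv_into_f[of h "{..<r}" i]
    by (auto simp: g_def bij_betw_def)
  define ind where "ind = (\<lambda>(a, i). if a < r \<and> i = h a then 1 else (0::complex))"
  \<comment> \<open>The block of \<open>\<Omega>\<close> at \<open>(g a, g b)\<close> is the matrix
    unit of \<open>(a, b)\<close>, so \<open>id_tensor T \<Omega>\<close> holds the values of
    \<open>T\<close> on all matrix units.\<close>
  define \<Omega> where "\<Omega> = (\<lambda>u w. ind u * ind w)"
  have "positive_op ({..<r} \<times> I) \<Omega>"
    unfolding positive_op_def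
  proof (intro conjI allI)
    show "\<Omega> \<in> operators ({..<r} \<times> I)"
      using h by (auto simp: operators_def \<Omega>_def ind_def bij_betw_def)
    fix v :: "nat \<times> 'i \<Rightarrow> complex"
    define s where "s = (\<Sum>u\<in>{..<r} \<times> I. ind u * v u)"
    have "cnj (ind u) = ind u" for u by (auto simp: ind_def split: prod.splits)
    hence "(\<Sum>u\<in>{..<r} \<times> I. \<Sum>w\<in>{..<r} \<times> I. cnj (v u) * \<Omega> u w * v w) = cnj s * s"
      unfolding s_def \<Omega>_def sum_product cnj_sum complex_cnj_mult by (simp add: mult_ac)
    also have "\<dots> = of_real ((cmod s)\<^sup>2)" using mult_cnj_self[of s] by (simp add: mult.commute)
    finally show "(\<Sum>u\<in>{..<r} \<times> I. \<Sum>w\<in>{..<r} \<times> I. cnj (v u) * \<Omega> u w * v w) \<in> \<real>\<^sub>\<ge>\<^sub>0"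
      by (metis nonneg_Reals_of_real_iff zero_le_power2)
  qed
  hence "positive_op ({..<r} \<times> J) (id_tensor T \<Omega>)"
    using T unfolding cptp_def by blast
  then obtain m u where u: "id_tensor T \<Omega> = outer_sum m (\<lambda>k. 1) u"
    using positive_op_gram[of "{..<r} \<times> J"] fin by blast
  define K where "K = (\<lambda>k j i. u k (g i, j))"
  define unit :: "'i \<times> 'i \<Rightarrow> 'i operator" where "unit = (\<lambda>(a, b) i j. if i = a \<and> j = b then 1 else (0::complex))"
  have unit_op: "unit (a, b) \<in> operators I" if "a \<in> I" "b \<in> I" for a b
    using that by (auto simp: unit_def operators_def)
  have T_unit: "T (unit (a, b)) j j' = (\<Sum>k<m. K k j a * cnj (K k j' b))"
    if "a \<in> I" "b \<in> I" for a b j j'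
  proof -
    have "unit (a, b) = (\<lambda>i i'. \<Omega> (g a, i) (g b, i'))"
      using g that by (auto simp: unit_def \<Omega>_def ind_def intro!: ext)
    hence "T (unit (a, b)) j j' = id_tensor T \<Omega> (g a, j) (g b, j')" by (simp add: id_tensor_def)
    thus ?thesis by (simp add: u outer_sum_def K_def)
  qed
  have T_eq: "T M j j' = (\<Sum>k<m. conj_op I (K k) M j j')" if M: "M \<in> operators I" for M j j'
  proof -
    have "M = (\<lambda>i i'. \<Sum>s\<in>I \<times> I. M (fst s) (snd s) * unit s i i')"
    proof (intro ext)
      fix i i'
      have "(\<Sum>s\<in>I \<times> I. M (fst s) (snd s) * unit s i i')
          = (\<Sum>s\<in>I \<times> I. if s = (i, i') then M i i' else 0)"
        by (intro sum.cong) (auto simp: unit_def split: if_splits)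
      also have "\<dots> = M i i'" using M fin(1) by (auto simp: operators_def)
      finally show "M i i' = (\<Sum>s\<in>I \<times> I. M (fst s) (snd s) * unit s i i')" ..
    qed
    hence "T M = T (\<lambda>i i'. \<Sum>s\<in>I \<times> I. M (fst s) (snd s) * unit s i i')" by simp
    also have "\<dots> = (\<lambda>i j. \<Sum>s\<in>I \<times> I. M (fst s) (snd s) * T (unit s) i j)"
      by (rule additive_map_sum[where I = I]) (use T fin unit_op in \<open>auto simp: cptp_def\<close>)
    finally have "T M j j' = (\<Sum>s\<in>I \<times> I. M (fst s) (snd s) * T (unit s) j j')" by simp
    also have "\<dots> = (\<Sum>s\<in>I \<times> I. \<Sum>k<m. K k j (fst s) * M (fst s) (snd s) * cnj (K k j' (snd s)))"
      by (intro sum.cong refl) (auto simp: T_unit sum_distrib_left mult_ac)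
    also have "\<dots> = (\<Sum>k<m. conj_op I (K k) M j j')"
      unfolding conj_op_def by (subst sum.swap) (simp add: sum.cartesian_product case_prod_beta)
    finally show ?thesis .
  qed
  have tp: "(\<Sum>k<m. \<Sum>j\<in>J. K k j a * cnj (K k j b)) = (if a = b then 1 else 0)"
    if "a \<in> I" "b \<in> I" for a b
  proof -
    have "(\<Sum>k<m. \<Sum>j\<in>J. K k j a * cnj (K k j b)) = op_trace J (T (unit (a, b)))"
      unfolding op_trace_def T_unit[OF that] by (rule sum.swap)
    also have "\<dots> = op_trace I (unit (a, b))" using T unit_op[OF that] by (simp add: cptp_def)
    also have "\<dots> = (\<Sum>i\<in>I. if i = a then (if a = b then 1 else 0) else 0)"
      unfolding op_trace_def unit_def by (intro sum.cong) auto
    also have "\<dots> = (if a = b then 1 else 0)" using that fin by simp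
    finally show ?thesis .
  qed
  have norm: "(\<Sum>k<m. norm_sq J (app I (K k) v)) = norm_sq I v" for v
  proof -
    have "complex_of_real (\<Sum>k<m. norm_sq J (app I (K k) v))
        = (\<Sum>k<m. \<Sum>j\<in>J. \<Sum>a\<in>I. \<Sum>b\<in>I. v a * cnj (v b) * (K k j a * cnj (K k j b)))"
      unfolding of_real_sum mult_cnj_self[symmetric] app_def
      by (simp add: sum_product mult_ac)
    also have "\<dots> = (\<Sum>k<m. \<Sum>a\<in>I. \<Sum>j\<in>J. \<Sum>b\<in>I. v a * cnj (v b) * (K k j a * cnj (K k j b)))"
      by (intro sum.cong refl sum.swap)
    also have "\<dots> = (\<Sum>a\<in>I. \<Sum>k<m. \<Sum>b\<in>I. \<Sum>j\<in>J. v a * cnj (v b) * (K k j a * cnj (K k j b)))"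
      by (subst sum.swap) (intro sum.cong refl sum.swap)
    also have "\<dots> = (\<Sum>a\<in>I. \<Sum>b\<in>I. v a * cnj (v b) * (\<Sum>k<m. \<Sum>j\<in>J. K k j a * cnj (K k j b)))"
      unfolding sum_distrib_left by (intro sum.cong refl sum.swap)
    also have "\<dots> = (\<Sum>a\<in>I. \<Sum>b\<in>I. if b = a then v a * cnj (v a) else 0)"
      by (intro sum.cong refl) (auto simp: tp)
    also have "\<dots> = (\<Sum>a\<in>I. v a * cnj (v a))" using fin by simp
    also have "\<dots> = of_real (norm_sq I v)" by (simp add: mult_cnj_self)
    finally show ?thesis unfolding of_real_eq_iff .
  qed
  show ?thesis by (rule that) (fact T_eq, fact norm)
qed

section \<open>The Cauchy-Schwarz estimate for a weighted character sum\<close>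

lemma op_trace_gram: "op_trace I (outer_sum m (\<lambda>k. 1) u) = of_real (\<Sum>k<m. norm_sq I (u k))"
  unfolding op_trace_def outer_sum_def of_real_sum mult_cnj_self[symmetric]
  by (subst sum.swap) simp

lemma ip_gram:
  "ip I v (app I (outer_sum m (\<lambda>k. 1) u) v) = of_real (\<Sum>k<m. (cmod (ip I v (u k)))\<^sup>2)"
  unfolding ip_outer_sum of_real_sum mult_cnj_self[symmetric] ip_cnj by simp

text \<open>With \<open>B x = \<Sum>g\<in>G. \<omega> x g A g\<close> the sum consists of the traces
  of \<open>\<rho> x B x\<close>. Cauchy-Schwarz pairs the square root of \<open>\<rho> x\<close>
  with the square root of \<open>\<rho> x\<close> times \<open>B x\<close>. The first factor is the
  total trace, one. In the second, \<open>\<rho> x\<close> gives way to \<open>c \<sigma>\<close>;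
  orthogonality over \<open>x\<close> then removes the cross terms between frequencies and leaves
  the adjoints of the \<open>A g\<close> on Gram vectors of \<open>\<sigma>\<close>.\<close>

lemma weighted_character_sum_bound:
  fixes \<omega> :: "'x \<Rightarrow> 'g \<Rightarrow> complex" and A :: "'g \<Rightarrow> 'e operator"
  assumes fin: "finite X" "finite E" "finite G"
    and orth: "\<And>g g'. g \<in> G \<Longrightarrow> g' \<in> G \<Longrightarrow>
      (\<Sum>x\<in>X. \<omega> x g * cnj (\<omega> x g')) = (if g = g' then complex_of_real N else 0)"
    and "N \<ge> 0" "C \<ge> 0" "c \<ge> 0"
    and \<rho>: "\<And>x. x \<in> X \<Longrightarrow> positive_op E (\<rho> x)" "(\<Sum>x\<in>X. op_trace E (\<rho> x)) = 1"
    and \<sigma>: "positive_op E \<sigma>" "Re (op_trace E \<sigma>) \<le> 1"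
    and dom: "\<And>x v. x \<in> X \<Longrightarrow> Re (ip E v (app E (\<rho> x) v)) \<le> c * Re (ip E v (app E \<sigma> v))"
    and bound: "\<And>v. (\<Sum>g\<in>G. norm_sq E (app E (op_adjoint (A g)) v)) \<le> C * norm_sq E v"
  shows "(cmod (\<Sum>x\<in>X. \<Sum>g\<in>G. \<omega> x g * (\<Sum>e\<in>E. \<Sum>e'\<in>E. \<rho> x e e' * A g e' e)))\<^sup>2 \<le> c * N * C"
proof -
  have "\<forall>x\<in>X. \<exists>m u. \<rho> x = outer_sum m (\<lambda>k. 1) u"
    using positive_op_gram[OF fin(2) \<rho>(1)] by metis
  then obtain m r where r: "\<And>x. x \<in> X \<Longrightarrow> \<rho> x = outer_sum (m x) (\<lambda>k. 1) (r x)" by metis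
  obtain ms s where s: "\<sigma> = outer_sum ms (\<lambda>k. 1) s"
    using positive_op_gram[OF fin(2) \<sigma>(1)] by metis
  \<comment> \<open>Column \<open>e\<close> of the combination \<open>B x\<close> of the operators
    \<open>A g\<close>.\<close>
  define b where "b = (\<lambda>x e e'. \<Sum>g\<in>G. \<omega> x g * A g e' e)"
  define S where "S = (SIGMA x:X. {..<m x} \<times> E)"
  have finS: "finite S" using fin by (auto simp: S_def)
  have split: "(\<Sum>(x, k, e)\<in>S. f x k e) = (\<Sum>x\<in>X. \<Sum>k<m x. \<Sum>e\<in>E. f x k e)"
    for f :: "'x \<Rightarrow> nat \<Rightarrow> 'e \<Rightarrow> 'b::comm_monoid_add"
    unfolding S_def using fin by (simp add: sum.Sigma sum.cartesian_product)
  have "(\<Sum>x\<in>X. \<Sum>g\<in>G. \<omega> x g * (\<Sum>e\<in>E. \<Sum>e'\<in>E. \<rho> x e e' * A g e' e))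
      = (\<Sum>(x, k, e)\<in>S. r x k e * cnj (ip E (b x e) (r x k)))"
    unfolding split
  proof (intro sum.cong refl)
    fix x assume x: "x \<in> X"
    have "(\<Sum>g\<in>G. \<omega> x g * (\<Sum>e\<in>E. \<Sum>e'\<in>E. \<rho> x e e' * A g e' e))
        = (\<Sum>g\<in>G. \<Sum>e\<in>E. \<Sum>e'\<in>E. \<rho> x e e' * (\<omega> x g * A g e' e))"
      by (simp add: sum_distrib_left mult_ac)
    also have "\<dots> = (\<Sum>e\<in>E. \<Sum>g\<in>G. \<Sum>e'\<in>E. \<rho> x e e' * (\<omega> x g * A g e' e))"
      by (rule sum.swap)
    also have "\<dots> = (\<Sum>e\<in>E. \<Sum>e'\<in>E. \<Sum>g\<in>G. \<rho> x e e' * (\<omega> x g * A g e' e))"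
      by (intro sum.cong refl sum.swap)
    also have "\<dots> = (\<Sum>e\<in>E. \<Sum>e'\<in>E. \<rho> x e e' * b x e e')"
      by (simp add: b_def sum_distrib_left)
    also have "\<dots> = (\<Sum>e\<in>E. \<Sum>e'\<in>E. \<Sum>k<m x. r x k e * (b x e e' * cnj (r x k e')))"
      by (simp add: r[OF x] outer_sum_def sum_distrib_left sum_distrib_right mult_ac)
    also have "\<dots> = (\<Sum>e\<in>E. \<Sum>k<m x. \<Sum>e'\<in>E. r x k e * (b x e e' * cnj (r x k e')))"
      by (intro sum.cong refl sum.swap)
    also have "\<dots> = (\<Sum>k<m x. \<Sum>e\<in>E. \<Sum>e'\<in>E. r x k e * (b x e e' * cnj (r x k e')))"
      by (rule sum.swap)
    also have "\<dots> = (\<Sum>k<m x. \<Sum>e\<in>E. r x k e * cnj (ip E (b x e) (r x k)))"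
      by (simp add: ip_def sum_distrib_left)
    finally show "(\<Sum>g\<in>G. \<omega> x g * (\<Sum>e\<in>E. \<Sum>e'\<in>E. \<rho> x e e' * A g e' e))
        = (\<Sum>k<m x. \<Sum>e\<in>E. r x k e * cnj (ip E (b x e) (r x k)))" .
  qed
  also have "(cmod \<dots>)\<^sup>2 \<le> (\<Sum>z\<in>S. (cmod (case z of (x, k, e) \<Rightarrow> r x k e))\<^sup>2) *
      (\<Sum>z\<in>S. (cmod (case z of (x, k, e) \<Rightarrow> cnj (ip E (b x e) (r x k))))\<^sup>2)"
    using cauchy_schwarz_complex_sum[of "\<lambda>(x, k, e). r x k e"
        "\<lambda>(x, k, e). cnj (ip E (b x e) (r x k))" S] by (simp add: case_prod_beta)
  also have "(\<Sum>z\<in>S. (cmod (case z of (x, k, e) \<Rightarrow> r x k e))\<^sup>2) = 1"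
  proof -
    have "(\<Sum>z\<in>S. (cmod (case z of (x, k, e) \<Rightarrow> r x k e))\<^sup>2)
        = (\<Sum>(x, k, e)\<in>S. (cmod (r x k e))\<^sup>2)" by (simp add: case_prod_beta)
    also have "\<dots> = (\<Sum>x\<in>X. \<Sum>k<m x. norm_sq E (r x k))" by (rule split)
    also have "complex_of_real \<dots> = (\<Sum>x\<in>X. op_trace E (\<rho> x))"
      unfolding of_real_sum[of _ X] by (intro sum.cong refl) (simp add: r op_trace_gram)
    finally show ?thesis unfolding \<rho>(2) of_real_eq_1_iff .
  qed
  also have "(\<Sum>z\<in>S. (cmod (case z of (x, k, e) \<Rightarrow> cnj (ip E (b x e) (r x k))))\<^sup>2) \<le> c * N * C"
  proof -
    have "(\<Sum>z\<in>S. (cmod (case z of (x, k, e) \<Rightarrow> cnj (ip E (b x e) (r x k))))\<^sup>2)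
        = (\<Sum>(x, k, e)\<in>S. (cmod (ip E (b x e) (r x k)))\<^sup>2)" by (simp add: case_prod_beta)
    also have "\<dots> = (\<Sum>x\<in>X. \<Sum>e\<in>E. \<Sum>k<m x. (cmod (ip E (b x e) (r x k)))\<^sup>2)"
      unfolding split by (intro sum.cong refl sum.swap)
    also have "\<dots> = (\<Sum>x\<in>X. \<Sum>e\<in>E. Re (ip E (b x e) (app E (\<rho> x) (b x e))))"
      by (intro sum.cong refl) (simp add: r ip_gram)
    \<comment> \<open>Here the domination coming from min-entropy enters: the form on the right is
      the same for every \<open>x\<close>.\<close>
    also have "\<dots> \<le> (\<Sum>x\<in>X. \<Sum>e\<in>E. c * Re (ip E (b x e) (app E \<sigma> (b x e))))"
      by (intro sum_mono dom)
    also have "\<dots> = c * (\<Sum>x\<in>X. \<Sum>e\<in>E. \<Sum>k<ms. (cmod (ip E (b x e) (s k)))\<^sup>2)"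
      by (simp add: s ip_gram sum_distrib_left)
    also have "(\<Sum>x\<in>X. \<Sum>e\<in>E. \<Sum>k<ms. (cmod (ip E (b x e) (s k)))\<^sup>2)
        = (\<Sum>e\<in>E. \<Sum>k<ms. \<Sum>x\<in>X. (cmod (ip E (b x e) (s k)))\<^sup>2)"
      by (subst sum.swap) (intro sum.cong refl sum.swap)
    also have "\<dots> = (\<Sum>e\<in>E. \<Sum>k<ms. N * (\<Sum>g\<in>G. (cmod (app E (op_adjoint (A g)) (s k) e))\<^sup>2))"
    proof (intro sum.cong refl)
      fix e k
      define a where "a = (\<lambda>g. app E (op_adjoint (A g)) (s k) e)"
      have ip: "ip E (b x e) (s k) = (\<Sum>g\<in>G. cnj (\<omega> x g) * a g)" for x
      proof -
        have "ip E (b x e) (s k) = (\<Sum>e'\<in>E. \<Sum>g\<in>G. cnj (\<omega> x g) * (cnj (A g e' e) * s k e'))"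
          by (simp add: ip_def b_def sum_distrib_left sum_distrib_right mult_ac)
        also have "\<dots> = (\<Sum>g\<in>G. \<Sum>e'\<in>E. cnj (\<omega> x g) * (cnj (A g e' e) * s k e'))"
          by (rule sum.swap)
        finally show ?thesis by (simp add: a_def app_def op_adjoint_def sum_distrib_left)
      qed
      have "complex_of_real (\<Sum>x\<in>X. (cmod (ip E (b x e) (s k)))\<^sup>2)
          = (\<Sum>x\<in>X. \<Sum>g\<in>G. \<Sum>g'\<in>G. (a g * cnj (a g')) * (\<omega> x g' * cnj (\<omega> x g)))"
        unfolding of_real_sum mult_cnj_self[symmetric] ip
        by (simp add: sum_product mult_ac)
      also have "\<dots> = (\<Sum>g\<in>G. \<Sum>x\<in>X. \<Sum>g'\<in>G. (a g * cnj (a g')) * (\<omega> x g' * cnj (\<omega> x g)))"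
        by (rule sum.swap)
      also have "\<dots> = (\<Sum>g\<in>G. \<Sum>g'\<in>G. (a g * cnj (a g')) * (\<Sum>x\<in>X. \<omega> x g' * cnj (\<omega> x g)))"
        unfolding sum_distrib_left by (intro sum.cong refl sum.swap)
      also have "\<dots> = (\<Sum>g\<in>G. \<Sum>g'\<in>G. if g' = g then of_real N * (a g * cnj (a g)) else 0)"
        by (intro sum.cong refl) (auto simp: orth)
      also have "\<dots> = of_real (N * (\<Sum>g\<in>G. (cmod (a g))\<^sup>2))"
        using fin by (simp add: mult_cnj_self sum_distrib_left)
      finally show "(\<Sum>x\<in>X. (cmod (ip E (b x e) (s k)))\<^sup>2)
          = N * (\<Sum>g\<in>G. (cmod (app E (op_adjoint (A g)) (s k) e))\<^sup>2)"
        unfolding of_real_eq_iff a_def .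
    qed
    also have "\<dots> = N * (\<Sum>k<ms. \<Sum>g\<in>G. norm_sq E (app E (op_adjoint (A g)) (s k)))"
    proof -
      have "(\<Sum>e\<in>E. \<Sum>k<ms. \<Sum>g\<in>G. f e k g) = (\<Sum>k<ms. \<Sum>g\<in>G. \<Sum>e\<in>E. f e k g)"
        for f :: "'e \<Rightarrow> nat \<Rightarrow> 'g \<Rightarrow> real"
        by (subst sum.swap) (intro sum.cong refl sum.swap)
      thus ?thesis unfolding sum_distrib_left .
    qed
    also have "\<dots> \<le> N * (\<Sum>k<ms. C * norm_sq E (s k))"
      using \<open>N \<ge> 0\<close> by (intro mult_left_mono sum_mono bound)
    also have "(\<Sum>k<ms. C * norm_sq E (s k)) = C * Re (op_trace E \<sigma>)"
      by (simp add: s op_trace_gram sum_distrib_left)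
    also have "c * (N * (C * Re (op_trace E \<sigma>))) \<le> c * (N * (C * 1))"
      using assms(5-7) \<sigma>(2) by (intro mult_left_mono) auto
    finally show ?thesis using \<open>c \<ge> 0\<close> by (simp add: mult_left_mono mult.assoc)
  qed
  finally show ?thesis by simp
qed

section \<open>Fourier coefficients of an attack\<close>

text \<open>This is \<open>L^* W L\<close>, the Heisenberg picture of one Kraus operator.\<close>

definition pullback :: "'f set \<Rightarrow> ('f \<Rightarrow> 'e \<Rightarrow> complex) \<Rightarrow> 'f operator \<Rightarrow> 'e operator" where
  "pullback F L W = (\<lambda>e' e. \<Sum>f1\<in>F. \<Sum>f2\<in>F. cnj (L f2 e') * W f2 f1 * L f1 e)"

lemma sum_swap_1_2: "(\<Sum>a\<in>A. \<Sum>b\<in>B. \<Sum>c\<in>C. f a b c) = (\<Sum>b\<in>B. \<Sum>c\<in>C. \<Sum>a\<in>A. f a b c)"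
  by (rule trans[OF sum.swap]) (intro sum.cong refl sum.swap)

lemma sum_swap_2_2:
  "(\<Sum>a\<in>A. \<Sum>b\<in>B. \<Sum>c\<in>C. \<Sum>d\<in>D. f a b c d) = (\<Sum>c\<in>C. \<Sum>d\<in>D. \<Sum>a\<in>A. \<Sum>b\<in>B. f a b c d)"
proof -
  have "(\<Sum>a\<in>A. \<Sum>b\<in>B. \<Sum>c\<in>C. \<Sum>d\<in>D. f a b c d) = (\<Sum>a\<in>A. \<Sum>c\<in>C. \<Sum>d\<in>D. \<Sum>b\<in>B. f a b c d)"
    by (intro sum.cong refl sum_swap_1_2)
  also have "\<dots> = (\<Sum>c\<in>C. \<Sum>d\<in>D. \<Sum>a\<in>A. \<Sum>b\<in>B. f a b c d)" by (rule sum_swap_1_2)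
  finally show ?thesis .
qed

text \<open>Cyclicity of the trace moves the dual contraction from the adversary's output to the
  side information held before the attack, where the min-entropy bound lives.\<close>

lemma trace_conj_op:
  "(\<Sum>f1\<in>F. \<Sum>f2\<in>F. W f2 f1 * conj_op E L R f1 f2)
     = (\<Sum>e\<in>E. \<Sum>e'\<in>E. R e e' * pullback F L W e' e)"
  unfolding conj_op_def pullback_def sum_distrib_left
  by (subst sum_swap_2_2) (simp add: mult_ac)

lemma ip_pullback:
  "ip E v (app E (pullback F L W) w) = ip F (app E L v) (app F W (app E L w))"
proof -
  have "ip E v (app E (pullback F L W) w)
      = (\<Sum>e\<in>E. \<Sum>e'\<in>E. \<Sum>f1\<in>F. \<Sum>f2\<in>F. cnj (L f2 e * v e) * W f2 f1 * (L f1 e' * w e'))"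
    unfolding ip_app_sum pullback_def sum_distrib_left sum_distrib_right by (simp add: mult_ac)
  also have "\<dots> = (\<Sum>f1\<in>F. \<Sum>f2\<in>F. \<Sum>e\<in>E. \<Sum>e'\<in>E. cnj (L f2 e * v e) * W f2 f1 * (L f1 e' * w e'))"
    by (rule sum_swap_2_2)
  also have "\<dots> = (\<Sum>f2\<in>F. \<Sum>f1\<in>F. \<Sum>e\<in>E. \<Sum>e'\<in>E. cnj (L f2 e * v e) * W f2 f1 * (L f1 e' * w e'))"
    by (rule sum.swap)
  also have "\<dots> = ip F (app E L v) (app F W (app E L w))"
    unfolding ip_app_sum[of F "app E L v" W]
  proof (intro sum.cong refl)
    fix f2 f1
    show "(\<Sum>e\<in>E. \<Sum>e'\<in>E. cnj (L f2 e * v e) * W f2 f1 * (L f1 e' * w e'))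
        = cnj (app E L v f2) * W f2 f1 * app E L w f1"
      unfolding app_def cnj_sum by (subst sum_distrib_right) (simp only: sum_product)
  qed
  finally show ?thesis .
qed

lemma le_of_mult_self_le:
  fixes x y :: real
  shows "x * x \<le> y * x \<Longrightarrow> 0 \<le> x \<Longrightarrow> 0 \<le> y \<Longrightarrow> x \<le> y"
  by (cases "x = 0") auto

lemma norm_sq_nonneg: "norm_sq I v \<ge> 0"
  by (simp add: sum_nonneg)

lemma ip_app_adjoint: "ip I u (app I (op_adjoint A) v) = cnj (ip I v (app I A u))"
proof -
  have "ip I u (app I (op_adjoint A) v) = (\<Sum>i\<in>I. \<Sum>j\<in>I. cnj (u i) * cnj (A j i) * v j)"
    by (simp add: ip_app_sum op_adjoint_def)
  also have "\<dots> = (\<Sum>j\<in>I. \<Sum>i\<in>I. cnj (u i) * cnj (A j i) * v j)" by (rule sum.swap)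
  also have "\<dots> = cnj (ip I v (app I A u))"
    unfolding ip_app_sum cnj_sum by (simp add: mult_ac)
  finally show ?thesis .
qed

lemma app_adjoint_sum:
  "app I (op_adjoint (\<lambda>i j. \<Sum>s\<in>S. A s i j)) v = (\<lambda>i. \<Sum>s\<in>S. app I (op_adjoint (A s)) v i)"
  unfolding app_def op_adjoint_def cnj_sum sum_distrib_right by (rule ext) (rule sum.swap)

lemma app_sum_op: "app I (\<lambda>i j. \<Sum>s\<in>S. A s i j) v = (\<lambda>i. \<Sum>s\<in>S. app I (A s) v i)"
  unfolding app_def sum_distrib_right by (rule ext) (rule sum.swap)

text \<open>The gain over the trivial bound \<open>norm_sq E v\<close> is that only the Kraus operators that
  actually occur in the sum contribute: this is Cauchy-Schwarz for the form
  \<open>\<Sum> <L v, W L w>\<close> with \<open>w\<close> chosen as the image of \<open>v\<close>.\<close>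

lemma norm_sq_adjoint_pullback_sum:
  assumes fin: "finite E" "finite F" "finite S"
    and W: "\<And>s. s \<in> S \<Longrightarrow> contraction_op F (W s)"
    and sub: "\<And>u. (\<Sum>s\<in>S. norm_sq F (app E (L s) u)) \<le> norm_sq E u"
  shows "norm_sq E (app E (op_adjoint (\<lambda>i j. \<Sum>s\<in>S. pullback F (L s) (W s) i j)) v)
    \<le> (\<Sum>s\<in>S. norm_sq F (app E (L s) v))"
proof -
  define w where "w = app E (op_adjoint (\<lambda>i j. \<Sum>s\<in>S. pullback F (L s) (W s) i j)) v"
  define a where "a s = sqrt (norm_sq F (app E (L s) v))" for s
  define b where "b s = sqrt (norm_sq F (app E (L s) w))" for s
  have a: "(a s)\<^sup>2 = norm_sq F (app E (L s) v)" and b: "(b s)\<^sup>2 = norm_sq F (app E (L s) w)" for s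
    by (simp_all add: a_def b_def norm_sq_nonneg)
  have "complex_of_real (norm_sq E w) = ip E w w" by (simp only: ip_self)
  also have "\<dots> = cnj (ip E v (app E (\<lambda>i j. \<Sum>s\<in>S. pullback F (L s) (W s) i j) w))"
    by (subst (2) w_def) (rule ip_app_adjoint)
  also have "ip E v (app E (\<lambda>i j. \<Sum>s\<in>S. pullback F (L s) (W s) i j) w)
      = (\<Sum>s\<in>S. ip F (app E (L s) v) (app F (W s) (app E (L s) w)))"
    unfolding app_sum_op ip_sum_right ip_pullback ..
  finally have "cmod (complex_of_real (norm_sq E w))
      = cmod (cnj (\<Sum>s\<in>S. ip F (app E (L s) v) (app F (W s) (app E (L s) w))))"
    by (rule arg_cong)
  hence "norm_sq E w = cmod (\<Sum>s\<in>S. ip F (app E (L s) v) (app F (W s) (app E (L s) w)))"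
    unfolding norm_of_real abs_of_nonneg[OF norm_sq_nonneg] complex_mod_cnj .
  also have "\<dots> \<le> (\<Sum>s\<in>S. a s * b s)"
  proof (rule sum_norm_le)
    fix s assume "s \<in> S"
    with W[OF this] have "(cmod (ip F (app E (L s) v) (app F (W s) (app E (L s) w))))\<^sup>2 \<le> (a s * b s)\<^sup>2"
      unfolding power_mult_distrib a b contraction_op_def by blast
    thus "cmod (ip F (app E (L s) v) (app F (W s) (app E (L s) w))) \<le> a s * b s"
      by (rule power2_le_imp_le) (simp add: a_def b_def norm_sq_nonneg)
  qed
  finally have "(norm_sq E w)\<^sup>2 \<le> (\<Sum>s\<in>S. a s * b s)\<^sup>2"
    by (rule power_mono) (rule norm_sq_nonneg)
  also have "\<dots> \<le> (\<Sum>s\<in>S. (a s)\<^sup>2) * (\<Sum>s\<in>S. (b s)\<^sup>2)"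
    using cauchy_schwarz_complex_sum[of "\<lambda>s. of_real (a s)" "\<lambda>s. of_real (b s)" S]
    by (simp only: of_real_mult[symmetric] of_real_sum[symmetric] norm_of_real power2_abs)
  \<comment> \<open>Only the \<open>w\<close> side is enlarged to the full norm, which then cancels;
    the \<open>v\<close> side keeps the restriction to \<open>S\<close>.\<close>
  also have "\<dots> \<le> (\<Sum>s\<in>S. (a s)\<^sup>2) * norm_sq E w"
    unfolding b by (intro mult_left_mono sub) (simp add: sum_nonneg)
  finally have "norm_sq E w * norm_sq E w \<le> (\<Sum>s\<in>S. (a s)\<^sup>2) * norm_sq E w"
    by (simp add: power2_eq_square)
  hence "norm_sq E w \<le> (\<Sum>s\<in>S. (a s)\<^sup>2)"
    by (rule le_of_mult_self_le) (simp_all only: norm_sq_nonneg sum_nonneg zero_le_power2)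
  thus ?thesis by (simp only: w_def a)
qed

lemma cmod_sum_sq_le:
  "(cmod (\<Sum>s\<in>S. z s))\<^sup>2 \<le> real (card S) * (\<Sum>s\<in>S. (cmod (z s))\<^sup>2)"
  using cauchy_schwarz_complex_sum[of "\<lambda>_. 1" z S] by simp

text \<open>In \<open>2 * card Y\<close>, each seed counts once by trace preservation, as every pair
  belongs to just one frequency, and the two is the number of seeds that a frequency may have. The
  contraction \<open>W\<close> may depend on the pair but not on \<open>x\<close>, as otherwise the
  sum over \<open>x\<close> would not be a character sum.\<close>

lemma attack_fourier_bound:
  fixes \<omega> :: "'x \<Rightarrow> 'g \<Rightarrow> complex" and L :: "nat \<Rightarrow> 'y \<Rightarrow> 'y \<Rightarrow> 'f \<Rightarrow> 'e \<Rightarrow> complex"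
  assumes fin: "finite X" "finite Y" "finite E" "finite F" "finite G"
    and orth: "\<And>g g'. g \<in> G \<Longrightarrow> g' \<in> G \<Longrightarrow>
      (\<Sum>x\<in>X. \<omega> x g * cnj (\<omega> x g')) = (if g = g' then complex_of_real N else 0)"
    and "N \<ge> 0" "c \<ge> 0"
    and \<rho>: "\<And>x. x \<in> X \<Longrightarrow> positive_op E (\<rho> x)" "(\<Sum>x\<in>X. op_trace E (\<rho> x)) = 1"
    and \<sigma>: "positive_op E \<sigma>" "Re (op_trace E \<sigma>) \<le> 1"
    and dom: "\<And>x v. x \<in> X \<Longrightarrow> Re (ip E v (app E (\<rho> x) v)) \<le> c * Re (ip E v (app E \<sigma> v))"
    and \<gamma>: "\<And>y y'. y \<in> Y \<Longrightarrow> y' \<in> Y \<Longrightarrow> \<gamma> y y' \<in> G"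
    and two: "\<And>g. g \<in> G \<Longrightarrow> card {y \<in> Y. \<exists>y'\<in>Y. y' \<noteq> y \<and> \<gamma> y y' = g} \<le> 2"
    and diag: "\<And>k y f e. k < m \<Longrightarrow> y \<in> Y \<Longrightarrow> f \<in> F \<Longrightarrow> e \<in> E \<Longrightarrow> L k y y f e = 0"
    and tp: "\<And>y v. y \<in> Y \<Longrightarrow> (\<Sum>y'\<in>Y. \<Sum>k<m. norm_sq F (app E (L k y y') v)) = norm_sq E v"
    and W: "\<And>y y'. y \<in> Y \<Longrightarrow> y' \<in> Y \<Longrightarrow> contraction_op F (W y y')"
  shows "(cmod (\<Sum>y\<in>Y. \<Sum>y'\<in>Y. \<Sum>x\<in>X. \<omega> x (\<gamma> y y') *
      (\<Sum>f1\<in>F. \<Sum>f2\<in>F. W y y' f2 f1 * (\<Sum>k<m. conj_op E (L k y y') (\<rho> x) f1 f2))))\<^sup>2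
    \<le> c * N * (2 * real (card Y))"
proof -
  \<comment> \<open>Answers equal to the seed are left out from the start, because
    \<open>two\<close> counts seeds with a different answer; \<open>Pdiag\<close> shows that they
    contribute nothing.\<close>
  define Q where "Q g y = {y' \<in> Y. y' \<noteq> y \<and> \<gamma> y y' = g}" for g y
  define P where "P y y' = (\<lambda>i j. \<Sum>k<m. pullback F (L k y y') (W y y') i j)" for y y'
  define Ag where "Ag g y = (\<lambda>i j. \<Sum>y'\<in>Q g y. P y y' i j)" for g y
  define D where "D g = {y \<in> Y. \<exists>y'\<in>Y. y' \<noteq> y \<and> \<gamma> y y' = g}" for g
  define A where "A g = (\<lambda>i j. \<Sum>y\<in>D g. Ag g y i j)" for g
  have finQ: "finite (Q g y)" "finite (D g)" for g y using fin by (auto simp: Q_def D_def)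
  have tr: "(\<Sum>f1\<in>F. \<Sum>f2\<in>F. W y y' f2 f1 * (\<Sum>k<m. conj_op E (L k y y') (\<rho> x) f1 f2))
      = (\<Sum>e\<in>E. \<Sum>e'\<in>E. \<rho> x e e' * P y y' e' e)" for x y y'
  proof -
    have "(\<Sum>f1\<in>F. \<Sum>f2\<in>F. W y y' f2 f1 * (\<Sum>k<m. conj_op E (L k y y') (\<rho> x) f1 f2))
        = (\<Sum>k<m. \<Sum>f1\<in>F. \<Sum>f2\<in>F. W y y' f2 f1 * conj_op E (L k y y') (\<rho> x) f1 f2)"
    proof -
      have "(\<Sum>f1\<in>F. \<Sum>f2\<in>F. \<Sum>k<m. t f1 f2 k) = (\<Sum>k<m. \<Sum>f1\<in>F. \<Sum>f2\<in>F. t f1 f2 k)"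
        for t :: "'f \<Rightarrow> 'f \<Rightarrow> nat \<Rightarrow> complex"
        by (rule trans[OF _ sum.swap]) (intro sum.cong refl sum.swap)
      thus ?thesis unfolding sum_distrib_left .
    qed
    also have "\<dots> = (\<Sum>k<m. \<Sum>e\<in>E. \<Sum>e'\<in>E. \<rho> x e e' * pullback F (L k y y') (W y y') e' e)"
      unfolding trace_conj_op ..
    also have "\<dots> = (\<Sum>e\<in>E. \<Sum>k<m. \<Sum>e'\<in>E. \<rho> x e e' * pullback F (L k y y') (W y y') e' e)"
      by (rule sum.swap)
    also have "\<dots> = (\<Sum>e\<in>E. \<Sum>e'\<in>E. \<rho> x e e' * P y y' e' e)"
      unfolding P_def sum_distrib_left by (intro sum.cong refl sum.swap)
    finally show ?thesis .
  qed
  have Pdiag: "P y y e' e = 0" if "y \<in> Y" "e \<in> E" "e' \<in> E" for y e e'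
    unfolding P_def pullback_def using that by (intro sum.neutral ballI) (simp add: diag)
  have regroup: "(\<Sum>y\<in>Y. \<Sum>y'\<in>Y. h (\<gamma> y y') * P y y' e' e) = (\<Sum>g\<in>G. h g * A g e' e)"
    if "e \<in> E" "e' \<in> E" for h e e'
  proof -
    have "(\<Sum>g\<in>G. h g * A g e' e) = (\<Sum>g\<in>G. \<Sum>y\<in>Y. \<Sum>y'\<in>Q g y. h g * P y y' e' e)"
    proof (intro sum.cong refl)
      fix g
      have "A g e' e = (\<Sum>y\<in>Y. Ag g y e' e)"
        unfolding A_def
      proof (intro sum.mono_neutral_left ballI)
        fix y assume "y \<in> Y - D g"
        hence "Q g y = {}" by (auto simp: D_def Q_def)
        thus "Ag g y e' e = 0" by (simp add: Ag_def)
      qed (use fin in \<open>auto simp: D_def\<close>)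
      thus "h g * A g e' e = (\<Sum>y\<in>Y. \<Sum>y'\<in>Q g y. h g * P y y' e' e)"
        by (simp add: Ag_def sum_distrib_left)
    qed
    also have "\<dots> = (\<Sum>y\<in>Y. \<Sum>g\<in>G. \<Sum>y'\<in>Q g y. h g * P y y' e' e)" by (rule sum.swap)
    also have "\<dots> = (\<Sum>y\<in>Y. \<Sum>g\<in>G. \<Sum>y'\<in>{y' \<in> Y - {y}. \<gamma> y y' = g}. h (\<gamma> y y') * P y y' e' e)"
      by (intro sum.cong refl) (auto simp: Q_def)
    also have "\<dots> = (\<Sum>y\<in>Y. \<Sum>y'\<in>Y - {y}. h (\<gamma> y y') * P y y' e' e)"
      using fin \<gamma> by (intro sum.cong refl sum.group) auto
    also have "\<dots> = (\<Sum>y\<in>Y. \<Sum>y'\<in>Y. h (\<gamma> y y') * P y y' e' e)"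
      using fin by (intro sum.cong refl sum.mono_neutral_left) (auto simp: Pdiag that)
    finally show ?thesis ..
  qed
  have "(\<Sum>y\<in>Y. \<Sum>y'\<in>Y. \<Sum>x\<in>X. \<omega> x (\<gamma> y y') *
      (\<Sum>f1\<in>F. \<Sum>f2\<in>F. W y y' f2 f1 * (\<Sum>k<m. conj_op E (L k y y') (\<rho> x) f1 f2)))
    = (\<Sum>x\<in>X. \<Sum>g\<in>G. \<omega> x g * (\<Sum>e\<in>E. \<Sum>e'\<in>E. \<rho> x e e' * A g e' e))"
  proof -
    have "(\<Sum>y\<in>Y. \<Sum>y'\<in>Y. \<Sum>x\<in>X. \<omega> x (\<gamma> y y') * (\<Sum>e\<in>E. \<Sum>e'\<in>E. \<rho> x e e' * P y y' e' e))
      = (\<Sum>x\<in>X. \<Sum>y\<in>Y. \<Sum>y'\<in>Y. \<Sum>e\<in>E. \<Sum>e'\<in>E. \<rho> x e e' * (\<omega> x (\<gamma> y y') * P y y' e' e))"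
      unfolding sum_distrib_left by (subst (2) sum_swap_1_2) (simp only: mult_ac)
    also have "\<dots> = (\<Sum>x\<in>X. \<Sum>e\<in>E. \<Sum>e'\<in>E. \<Sum>y\<in>Y. \<Sum>y'\<in>Y. \<rho> x e e' * (\<omega> x (\<gamma> y y') * P y y' e' e))"
      by (intro sum.cong refl sum_swap_2_2)
    also have "\<dots> = (\<Sum>x\<in>X. \<Sum>e\<in>E. \<Sum>e'\<in>E. \<rho> x e e' * (\<Sum>g\<in>G. \<omega> x g * A g e' e))"
      unfolding sum_distrib_left[symmetric] by (intro sum.cong refl) (simp only: regroup)
    also have "\<dots> = (\<Sum>x\<in>X. \<Sum>e\<in>E. \<Sum>e'\<in>E. \<Sum>g\<in>G. \<omega> x g * (\<rho> x e e' * A g e' e))"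
      by (simp add: sum_distrib_left mult_ac)
    also have "\<dots> = (\<Sum>x\<in>X. \<Sum>g\<in>G. \<omega> x g * (\<Sum>e\<in>E. \<Sum>e'\<in>E. \<rho> x e e' * A g e' e))"
      unfolding sum_distrib_left by (intro sum.cong refl) (rule sum_swap_1_2[symmetric])
    finally show ?thesis unfolding tr .
  qed
  also have "(cmod \<dots>)\<^sup>2 \<le> c * N * (2 * real (card Y))"
  proof (rule weighted_character_sum_bound[OF fin(1,3,5) orth \<open>N \<ge> 0\<close> _ \<open>c \<ge> 0\<close> \<rho> \<sigma> dom])
    show "0 \<le> 2 * real (card Y)" by simp
  next
    fix v
    define n where "n y y' = (\<Sum>k<m. norm_sq F (app E (L k y y') v))" for y y'
    have n_nonneg: "n y y' \<ge> 0" for y y' by (simp add: n_def sum_nonneg)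
    have "norm_sq E (app E (op_adjoint (A g)) v) \<le> (\<Sum>y\<in>Y. 2 * (\<Sum>y'\<in>Q g y. n y y'))"
      if g: "g \<in> G" for g
    proof -
      \<comment> \<open>The operators of different seeds are unrelated, so their sum is bounded by
        convexity with the number of terms: the source of the factor two.\<close>
      have "norm_sq E (app E (op_adjoint (A g)) v)
          \<le> (\<Sum>e\<in>E. 2 * (\<Sum>y\<in>D g. (cmod (app E (op_adjoint (Ag g y)) v e))\<^sup>2))"
        unfolding A_def app_adjoint_sum
      proof (rule sum_mono)
        fix e
        have "real (card (D g)) \<le> 2" using two[OF g] unfolding D_def by linarith
        thus "(cmod (\<Sum>y\<in>D g. app E (op_adjoint (Ag g y)) v e))\<^sup>2
            \<le> 2 * (\<Sum>y\<in>D g. (cmod (app E (op_adjoint (Ag g y)) v e))\<^sup>2)"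
          by (intro order_trans[OF cmod_sum_sq_le] mult_right_mono norm_sq_nonneg)
      qed
      also have "\<dots> = (\<Sum>y\<in>D g. 2 * norm_sq E (app E (op_adjoint (Ag g y)) v))"
        unfolding sum_distrib_left by (rule sum.swap)
      also have "\<dots> \<le> (\<Sum>y\<in>Y. 2 * norm_sq E (app E (op_adjoint (Ag g y)) v))"
        using fin by (intro sum_mono2) (auto simp: D_def norm_sq_nonneg)
      also have "\<dots> \<le> (\<Sum>y\<in>Y. 2 * (\<Sum>y'\<in>Q g y. n y y'))"
      proof (intro sum_mono mult_left_mono)
        fix y assume y: "y \<in> Y"
        have pair: "(\<Sum>s\<in>Q g y \<times> {..<m}. t (fst s) (snd s)) = (\<Sum>y'\<in>Q g y. \<Sum>k<m. t y' k)"
          for t :: "'y \<Rightarrow> nat \<Rightarrow> 'b::comm_monoid_add"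
          by (simp add: sum.cartesian_product case_prod_beta)
        have "norm_sq E (app E (op_adjoint (\<lambda>i j. \<Sum>s\<in>Q g y \<times> {..<m}.
              pullback F (L (snd s) y (fst s)) (W y (fst s)) i j)) v)
            \<le> (\<Sum>s\<in>Q g y \<times> {..<m}. norm_sq F (app E (L (snd s) y (fst s)) v))"
        proof (rule norm_sq_adjoint_pullback_sum)
          fix u
          have "(\<Sum>s\<in>Q g y \<times> {..<m}. norm_sq F (app E (L (snd s) y (fst s)) u))
              = (\<Sum>y'\<in>Q g y. \<Sum>k<m. norm_sq F (app E (L k y y') u))"
            by (rule pair)
          also have "\<dots> \<le> (\<Sum>y'\<in>Y. \<Sum>k<m. norm_sq F (app E (L k y y') u))"
            using fin by (intro sum_mono2) (auto simp: Q_def intro!: sum_nonneg)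
          finally show "(\<Sum>s\<in>Q g y \<times> {..<m}. norm_sq F (app E (L (snd s) y (fst s)) u)) \<le> norm_sq E u"
            by (simp only: tp[OF y])
        qed (use fin finQ W y in \<open>auto simp: Q_def\<close>)
        thus "norm_sq E (app E (op_adjoint (Ag g y)) v) \<le> (\<Sum>y'\<in>Q g y. n y y')"
          unfolding Ag_def P_def n_def
            pair[of "\<lambda>y' k. norm_sq F (app E (L k y y') v)"]
            pair[of "\<lambda>y' k. pullback F (L k y y') (W y y') i j" for i j] .
      qed simp
      finally show ?thesis .
    qed
    hence "(\<Sum>g\<in>G. norm_sq E (app E (op_adjoint (A g)) v))
        \<le> (\<Sum>g\<in>G. \<Sum>y\<in>Y. 2 * (\<Sum>y'\<in>Q g y. n y y'))"
      by (rule sum_mono)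
    also have "\<dots> = (\<Sum>y\<in>Y. \<Sum>g\<in>G. 2 * (\<Sum>y'\<in>Q g y. n y y'))" by (rule sum.swap)
    also have "\<dots> = (\<Sum>y\<in>Y. 2 * (\<Sum>g\<in>G. \<Sum>y'\<in>{y' \<in> Y - {y}. \<gamma> y y' = g}. n y y'))"
      unfolding sum_distrib_left by (intro sum.cong refl) (auto simp: Q_def)
    also have "\<dots> = (\<Sum>y\<in>Y. 2 * (\<Sum>y'\<in>Y - {y}. n y y'))"
      using fin \<gamma> by (intro sum.cong refl arg_cong2[of _ _ _ _ "(*)"] sum.group) auto
    also have "\<dots> \<le> (\<Sum>y\<in>Y. 2 * (\<Sum>y'\<in>Y. n y y'))"
      using fin by (intro sum_mono mult_left_mono sum_mono2) (auto simp: n_nonneg)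
    also have "\<dots> = 2 * real (card Y) * norm_sq E v"
      by (simp add: n_def tp)
    finally show "(\<Sum>g\<in>G. norm_sq E (app E (op_adjoint (A g)) v)) \<le> 2 * real (card Y) * norm_sq E v" .
  qed
  finally show ?thesis .
qed

section \<open>Characters and the frequency map\<close>

text \<open>The character \<open>exp (2 pi i a / p)\<close>, written as a power of a root of unity
  so that additivity is arithmetic of exponents modulo \<open>p\<close>.\<close>

definition fchar :: "'p::prime_card mod_ring \<Rightarrow> complex" where
  "fchar a = cis (2 * pi / CARD('p)) ^ nat (to_int_mod_ring a)"

lemma to_int_mod_ring_range:
  "0 \<le> to_int_mod_ring a" "to_int_mod_ring (a :: 'p::finite mod_ring) < int CARD('p)"
  using range_to_int_mod_ring[where 'a = 'p] by auto

lemma fchar_add: "fchar (a + b) = fchar a * fchar (b :: 'p::prime_card mod_ring)"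
proof -
  define \<zeta> where "\<zeta> = cis (2 * pi / CARD('p))"
  have one: "\<zeta> ^ CARD('p) = 1" by (simp add: \<zeta>_def DeMoivre)
  have mod: "\<zeta> ^ (m mod CARD('p)) = \<zeta> ^ m" for m
  proof -
    have "\<zeta> ^ m = \<zeta> ^ (CARD('p) * (m div CARD('p)) + m mod CARD('p))" by simp
    thus ?thesis by (simp only: power_add power_mult one power_one mult_1)
  qed
  have "nat (to_int_mod_ring (a + b)) = (nat (to_int_mod_ring a) + nat (to_int_mod_ring b)) mod CARD('p)"
    using to_int_mod_ring_range[of a] to_int_mod_ring_range[of b]
    by (simp add: to_int_mod_ring_add nat_mod_distrib nat_add_distrib)
  thus ?thesis by (simp add: fchar_def mod power_add flip: \<zeta>_def)
qed

lemma fchar_0: "fchar 0 = 1"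
  by (simp add: fchar_def)

lemma cmod_fchar: "cmod (fchar a) = 1"
  by (simp add: fchar_def norm_power)

lemma cnj_fchar: "cnj (fchar a) = fchar (- a)"
proof -
  have "fchar a * cnj (fchar a) = 1" by (simp add: mult_cnj_self cmod_fchar)
  moreover have "fchar a * fchar (- a) = 1" by (simp add: fchar_0 flip: fchar_add)
  moreover have "fchar a \<noteq> 0" using cmod_fchar[of a] by auto
  ultimately show ?thesis by (metis mult_left_cancel)
qed

lemma to_int_mod_ring_1: "to_int_mod_ring (1 :: 'p::prime_card mod_ring) = 1"
  by transfer simp

lemma fchar_1_neq_1: "fchar (1 :: 'p::prime_card mod_ring) \<noteq> 1"
proof
  have p: "CARD('p) \<ge> 2" using prime_card[where 'a = 'p] by (rule prime_ge_2_nat)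
  assume "fchar (1 :: 'p mod_ring) = 1"
  hence "cis (2 * pi / CARD('p)) = 1" by (simp add: fchar_def to_int_mod_ring_1)
  hence "cos (2 * pi / CARD('p)) = 1" by (simp add: complex_eq_iff)
  then obtain k :: int where "2 * pi / CARD('p) = real_of_int k * 2 * pi" unfolding cos_one_2pi_int by blast
  hence "1 = real_of_int k * real CARD('p)" using p by (simp add: field_simps)
  hence "1 = k * int CARD('p)" by (metis of_int_1 of_int_eq_iff of_int_mult of_int_of_nat_eq)
  hence "int CARD('p) dvd 1" by (metis dvd_triv_right)
  thus False using p by simp
qed

text \<open>Both orthogonality relations below are instances: a translation multiplies every summand
  by the root of unity \<open>fchar 1\<close>.\<close>

lemma sum_eq_0_of_shift:
  fixes f :: "'a \<Rightarrow> complex"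
  assumes "bij_betw s X X" "\<And>x. x \<in> X \<Longrightarrow> f (s x) = z * f x" "z \<noteq> 1"
  shows "sum f X = 0"
proof -
  have "sum f X = (\<Sum>x\<in>X. f (s x))" by (rule sum.reindex_bij_betw[OF assms(1), symmetric])
  also have "\<dots> = z * sum f X" by (simp add: assms(2) sum_distrib_left)
  finally show ?thesis using assms(3) by simp
qed

lemma sum_fchar:
  fixes t :: "'p::prime_card mod_ring"
  shows "(\<Sum>a\<in>UNIV. fchar (a * t)) = (if t = 0 then of_nat CARD('p) else 0)"
proof (cases "t = 0")
  case False
  have "(\<Sum>a\<in>UNIV. fchar (a * t)) = 0"
  proof (rule sum_eq_0_of_shift[where z = "fchar (1 :: 'p mod_ring)"])
    show "bij (\<lambda>a. a + inverse t)" by (rule bij_plus_right)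
    have "(a + inverse t) * t = 1 + a * t" for a using False by (simp add: distrib_right)
    thus "fchar ((a + inverse t) * t) = fchar (1 :: 'p mod_ring) * fchar (a * t)" for a by (simp add: fchar_add)
  qed (rule fchar_1_neq_1)
  thus ?thesis using False by simp
qed (simp add: fchar_0)

text \<open>The product is the character at \<open>d = g - g'\<close>, and translation along a
  vector \<open>u\<close> with \<open>u \<bullet> d = 1\<close> kills its sum; \<open>u\<close> is a
  scaled unit vector at a coordinate where \<open>g\<close> and \<open>g'\<close> differ.\<close>

lemma fchar_orthogonality:
  fixes g g' :: "'p::prime_card mod_ring vec"
  assumes g: "g \<in> carrier_vec n" "g' \<in> carrier_vec n"
  shows "(\<Sum>x\<in>carrier_vec n. fchar (x \<bullet> g) * cnj (fchar (x \<bullet> g')))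
    = (if g = g' then complex_of_real (real (CARD('p) ^ n)) else 0)"
proof (cases "g = g'")
  case True
  thus ?thesis by (simp add: mult_cnj_self cmod_fchar card_carrier_vec)
next
  case False
  define d where "d = g - g'"
  have d: "d \<in> carrier_vec n" using g by (simp add: d_def)
  obtain i where i: "i < n" "g $ i \<noteq> g' $ i" using False g by (metis carrier_vecD eq_vecI)
  have di: "d $ i \<noteq> 0" using i g by (simp add: d_def)
  define u where "u = inverse (d $ i) \<cdot>\<^sub>v unit_vec n i"
  have u: "u \<in> carrier_vec n" "u \<bullet> d = 1" using i d di by (simp_all add: u_def)
  have "(\<Sum>x\<in>carrier_vec n. fchar (x \<bullet> d)) = 0"
  proof (rule sum_eq_0_of_shift[where z = "fchar (1 :: 'p mod_ring)"])
    show "bij_betw (\<lambda>x. x + u) (carrier_vec n) (carrier_vec n)"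
      by (rule bij_betw_byWitness[where f' = "\<lambda>x. x - u"]) (use u in auto)
    fix x :: "'p mod_ring vec" assume "x \<in> carrier_vec n"
    thus "fchar ((x + u) \<bullet> d) = fchar (1 :: 'p mod_ring) * fchar (x \<bullet> d)"
      using u d by (simp add: add_scalar_prod_distrib fchar_add)
  qed (rule fchar_1_neq_1)
  moreover have "fchar (x \<bullet> g) * cnj (fchar (x \<bullet> g')) = fchar (x \<bullet> d)" if "x \<in> carrier_vec n" for x
    using that g by (simp add: d_def cnj_fchar scalar_prod_minus_distrib flip: fchar_add)
  ultimately show ?thesis using False by simp
qed

section \<open>Counting the seeds that share a frequency\<close>

lemma card_quadratic_roots:
  fixes a :: "'q::field"
  assumes "a \<noteq> 0"
  shows "finite {y. a * y\<^sup>2 + b * y + c = 0}" "card {y. a * y\<^sup>2 + b * y + c = 0} \<le> 2"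
proof -
  have eq: "{y. a * y\<^sup>2 + b * y + c = 0} = {y. poly [:c, b, a:] y = 0}"
    by (auto simp: power2_eq_square algebra_simps)
  show "finite {y. a * y\<^sup>2 + b * y + c = 0}" unfolding eq using assms by (intro poly_roots_finite) simp
  show "card {y. a * y\<^sup>2 + b * y + c = 0} \<le> 2"
    unfolding eq using card_poly_roots_bound[of "[:c, b, a:]"] assms by simp
qed

text \<open>Eliminating \<open>y'\<close> from the two equations leaves a quadratic equation for \<open>y\<close>, which
  degenerates for \<open>\<alpha> + \<beta> = 0\<close>; then \<open>y + y'\<close> and \<open>y - y'\<close> are both determined.\<close>

lemma card_pair_solutions:
  fixes \<alpha> \<beta> c d :: "'q::{field,finite}"
  assumes "\<alpha> \<noteq> 0" "(2 :: 'q) \<noteq> 0"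
  shows "card {y. \<exists>y'. y' \<noteq> y \<and> \<alpha> * y + \<beta> * y' = c \<and> \<alpha> * y\<^sup>2 + \<beta> * y'\<^sup>2 = d} \<le> 2"
    (is "card ?S \<le> 2")
proof -
  have single: "card ?S \<le> 2" if "?S \<subseteq> {z}" for z
    using card_mono[OF _ that] by simp
  consider "\<beta> = 0" | "\<beta> \<noteq> 0" "\<alpha> + \<beta> \<noteq> 0" | "\<alpha> + \<beta> = 0" by blast
  thus ?thesis
  proof cases
    case 1
    hence "?S \<subseteq> {c / \<alpha>}" using assms by (auto simp: field_simps)
    thus ?thesis by (rule single)
  next
    case 2
    \<comment> \<open>Coefficients obtained by multiplying the second equation by
      \<open>\<beta>\<close> and substituting
      \<open>\<beta> * y' = c - \<alpha> * y\<close>.\<close>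
    define A where "A = \<alpha> * (\<alpha> + \<beta>)"
    define B where "B = - (2 * \<alpha> * c)"
    define C where "C = c\<^sup>2 - \<beta> * d"
    have "?S \<subseteq> {y. A * y\<^sup>2 + B * y + C = 0}"
    proof
      fix y assume "y \<in> ?S"
      then obtain y' where "\<alpha> * y + \<beta> * y' = c" "\<alpha> * y\<^sup>2 + \<beta> * y'\<^sup>2 = d" by blast
      hence "A * y\<^sup>2 + B * y + C = 0" unfolding A_def B_def C_def
        by (auto simp: power2_eq_square algebra_simps)
      thus "y \<in> {y. A * y\<^sup>2 + B * y + C = 0}" by simp
    qed
    moreover have "A \<noteq> 0" using assms 2 by (simp add: A_def)
    ultimately show ?thesis using card_quadratic_roots[of A B C] card_mono order_trans by blast
  next
    case 3
    hence \<beta>: "\<beta> = - \<alpha>" by (simp add: eq_neg_iff_add_eq_0 add.commute)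
    have "?S \<subseteq> {(d / c + c / \<alpha>) / 2}"
    proof
      fix y assume "y \<in> ?S"
      then obtain y' where y: "y' \<noteq> y" "\<alpha> * y + \<beta> * y' = c" "\<alpha> * y\<^sup>2 + \<beta> * y'\<^sup>2 = d" by blast
      have c: "c = \<alpha> * (y - y')" using y(2) by (simp add: \<beta> algebra_simps)
      have d: "d = c * (y + y')" unfolding c using y(3) by (simp add: \<beta> algebra_simps power2_eq_square)
      \<comment> \<open>Here \<open>y' \<noteq> y\<close> is essential: with
        \<open>\<beta> = - \<alpha>\<close> and \<open>c = d = 0\<close>, every \<open>y\<close>
        solves the equations together with \<open>y' = y\<close>. An adversary repeating the seed
        could thus cancel the frequency.\<close>
      have "c \<noteq> 0" using y(1) assms(1) by (simp add: c)
      hence "d / c = y + y'" by (simp add: d)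
      moreover have "c / \<alpha> = y - y'" using assms(1) by (simp add: c)
      ultimately have "d / c + c / \<alpha> = 2 * y" by simp
      thus "y \<in> {(d / c + c / \<alpha>) / 2}" using assms(2) by simp
    qed
    thus ?thesis by (rule single)
  qed
qed

lemma vec_square_carrier:
  assumes "bij_betw \<phi> (carrier_vec m) UNIV"
  shows "vec_square m \<phi> y \<in> carrier_vec m" "\<phi> (vec_square m \<phi> y) = (\<phi> y)\<^sup>2"
  using assms unfolding vec_square_def bij_betw_def
  by (metis UNIV_I inv_into_into, metis UNIV_I f_inv_into_f)

text \<open>Under \<open>\<phi>\<close> the first half of \<open>g\<close> yields the linear
  equation of \<open>card_pair_solutions\<close> and the second half the one in squares. That
  \<open>a\<close> stays nonzero and that \<open>2\<close> is nonzero in the field is read off from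
  linearity and injectivity of \<open>\<phi>\<close> on a unit vector, the latter with
  \<open>p\<close> odd.\<close>

lemma card_frequency_fibre:
  fixes \<phi> :: "'p::prime_card mod_ring vec \<Rightarrow> 'q::{field,finite}"
  assumes p: "CARD('p) \<noteq> 2" and m: "m > 0"
    and bij: "bij_betw \<phi> (carrier_vec m) UNIV" and lin: "prime_field_linear m \<phi>"
    and a: "a \<noteq> 0" and g: "g \<in> carrier_vec (m + m)"
  shows "card {y \<in> carrier_vec m. \<exists>y'\<in>carrier_vec m. y' \<noteq> y \<and>
    a \<cdot>\<^sub>v (y @\<^sub>v vec_square m \<phi> y) + b \<cdot>\<^sub>v (y' @\<^sub>v vec_square m \<phi> y') = g} \<le> 2"
    (is "card ?D \<le> 2")
proof -
  define emb where "emb = (\<lambda>c::'p mod_ring. of_int (to_int_mod_ring c) :: 'q)"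
  have add: "\<phi> (u + v) = \<phi> u + \<phi> v" if "u \<in> carrier_vec m" "v \<in> carrier_vec m" for u v
    using lin that by (simp add: prime_field_linear_def)
  have smult: "\<phi> (c \<cdot>\<^sub>v v) = emb c * \<phi> v" if "v \<in> carrier_vec m" for c v
    using lin that by (simp add: prime_field_linear_def emb_def)
  have inj: "u = v" if "\<phi> u = \<phi> v" "u \<in> carrier_vec m" "v \<in> carrier_vec m" for u v
    using bij that by (auto simp: bij_betw_def inj_on_def)
  have \<phi>0: "\<phi> (0\<^sub>v m) = 0" using add[of "0\<^sub>v m" "0\<^sub>v m"]
    by (metis add_cancel_left_left left_zero_vec zero_carrier_vec)
  define e where "e = (unit_vec m 0 :: 'p mod_ring vec)"
  have e: "e \<in> carrier_vec m" "e $ 0 = 1" using m by (auto simp: e_def)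
  have emb_a: "emb a \<noteq> 0"
  proof
    assume "emb a = 0"
    hence "\<phi> (a \<cdot>\<^sub>v e) = \<phi> (0\<^sub>v m)" using smult[OF e(1), of a] by (simp add: \<phi>0)
    hence "a \<cdot>\<^sub>v e = 0\<^sub>v m" using e by (intro inj) auto
    hence "(a \<cdot>\<^sub>v e) $ 0 = (0\<^sub>v m :: 'p mod_ring vec) $ 0" by simp
    thus False using a e m by simp
  qed
  have two: "(2 :: 'q) \<noteq> 0"
  proof
    assume "(2 :: 'q) = 0"
    hence "\<phi> (e + e) = \<phi> (0\<^sub>v m)" using add[OF e(1) e(1)] by (metis \<phi>0 mult_2 mult_zero_left)
    hence "e + e = 0\<^sub>v m" using e by (intro inj) auto
    hence "(e + e) $ 0 = (0\<^sub>v m :: 'p mod_ring vec) $ 0" by simp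
    hence "1 + 1 = (0 :: 'p mod_ring)" using e m by simp
    hence "(1 + 1) mod int CARD('p) = 0"
      using to_int_mod_ring_add[of "1 :: 'p mod_ring" 1]
      by (simp only: to_int_mod_ring_1 to_int_mod_ring_hom.hom_zero)
    hence "int CARD('p) dvd int 2" by (simp add: mod_eq_0_iff_dvd)
    hence "CARD('p) dvd 2" by (simp only: int_dvd_int_iff)
    thus False using p prime_card[where 'a = 'p] by (metis primes_dvd_imp_eq two_is_prime_nat)
  qed
  define g1 where "g1 = vec_first g m"
  define g2 where "g2 = vec_last g m"
  have split: "g = g1 @\<^sub>v g2" using g by (simp add: g1_def g2_def)
  have g12: "g1 \<in> carrier_vec m" "g2 \<in> carrier_vec m" by (auto simp: g1_def g2_def)
  define S where "S = {y. \<exists>y'. y' \<noteq> y \<and> emb a * y + emb b * y' = \<phi> g1 \<and> emb a * y\<^sup>2 + emb b * y'\<^sup>2 = \<phi> g2}"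
  have "\<phi> ` ?D \<subseteq> S"
  proof (rule image_subsetI)
    fix y assume "y \<in> ?D"
    then obtain y' where y: "y \<in> carrier_vec m" "y' \<in> carrier_vec m" "y' \<noteq> y"
      and eq: "a \<cdot>\<^sub>v (y @\<^sub>v vec_square m \<phi> y) + b \<cdot>\<^sub>v (y' @\<^sub>v vec_square m \<phi> y') = g" by blast
    note sq = vec_square_carrier[OF bij]
    have "g1 @\<^sub>v g2 = (a \<cdot>\<^sub>v y + b \<cdot>\<^sub>v y') @\<^sub>v (a \<cdot>\<^sub>v vec_square m \<phi> y + b \<cdot>\<^sub>v vec_square m \<phi> y')"
      unfolding split[symmetric] eq[symmetric]
      using y carrier_vecD[OF sq(1)] by (intro eq_vecI) auto
    hence "g1 = a \<cdot>\<^sub>v y + b \<cdot>\<^sub>v y'" "g2 = a \<cdot>\<^sub>v vec_square m \<phi> y + b \<cdot>\<^sub>v vec_square m \<phi> y'"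
      using append_vec_eq[OF g12(1), of "a \<cdot>\<^sub>v y + b \<cdot>\<^sub>v y'"] y by auto
    hence "emb a * \<phi> y + emb b * \<phi> y' = \<phi> g1" "emb a * (\<phi> y)\<^sup>2 + emb b * (\<phi> y')\<^sup>2 = \<phi> g2"
      using y by (simp_all add: add smult sq)
    moreover have "\<phi> y' \<noteq> \<phi> y" using inj y by blast
    ultimately show "\<phi> y \<in> S" unfolding S_def by blast
  qed
  hence "card (\<phi> ` ?D) \<le> card S" by (intro card_mono) auto
  also have "\<dots> \<le> 2" unfolding S_def by (rule card_pair_solutions[OF emb_a two])
  finally have "card (\<phi> ` ?D) \<le> 2" .
  moreover have "card (\<phi> ` ?D) = card ?D" by (intro card_image inj_onI) (auto intro: inj)
  ultimately show ?thesis by simp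
qed

section \<open>Min-entropy and the attacked state\<close>

text \<open>The operator in the definition of min-entropy is block diagonal in the classical
  register; in this form positivity is read off block by block.\<close>

definition block_op :: "'a set \<Rightarrow> ('a \<Rightarrow> 'e operator) \<Rightarrow> ('a \<times> 'e) operator" where
  "block_op X R = (\<lambda>(x, e) (x', e'). if x = x' \<and> x \<in> X then R x e e' else 0)"

lemma ip_block_op:
  assumes "finite X"
  shows "ip (X \<times> E) v (app (X \<times> E) (block_op X R) v)
    = (\<Sum>x\<in>X. ip E (\<lambda>e. v (x, e)) (app E (R x) (\<lambda>e. v (x, e))))"
proof -
  have "ip (X \<times> E) v (app (X \<times> E) (block_op X R) v)
      = (\<Sum>x\<in>X. \<Sum>e\<in>E. cnj (v (x, e)) * app (X \<times> E) (block_op X R) v (x, e))"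
    by (simp add: ip_def sum.cartesian_product)
  also have "app (X \<times> E) (block_op X R) v (x, e) = app E (R x) (\<lambda>e. v (x, e)) e"
    if "x \<in> X" for x e
  proof -
    have "app (X \<times> E) (block_op X R) v (x, e)
        = (\<Sum>x'\<in>X. \<Sum>e'\<in>E. block_op X R (x, e) (x', e') * v (x', e'))"
      by (simp add: app_def sum.cartesian_product case_prod_beta)
    also have "\<dots> = (\<Sum>x'\<in>X. if x' = x then \<Sum>e'\<in>E. R x e e' * v (x, e') else 0)"
      using that by (intro sum.cong) (auto simp: block_op_def)
    also have "\<dots> = app E (R x) (\<lambda>e. v (x, e)) e" using that assms by (simp add: app_def)
    finally show ?thesis .
  qed
  hence "(\<Sum>x\<in>X. \<Sum>e\<in>E. cnj (v (x, e)) * app (X \<times> E) (block_op X R) v (x, e))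
      = (\<Sum>x\<in>X. ip E (\<lambda>e. v (x, e)) (app E (R x) (\<lambda>e. v (x, e))))"
    unfolding ip_def by (intro sum.cong refl) simp
  finally show ?thesis .
qed

lemma nonneg_Reals_sum: "(\<And>x. x \<in> X \<Longrightarrow> f x \<in> \<real>\<^sub>\<ge>\<^sub>0) \<Longrightarrow> sum f X \<in> (\<real>\<^sub>\<ge>\<^sub>0 :: complex set)"
  by (induction X rule: infinite_finite_induct) (auto intro: nonneg_Reals_add_I)

lemma positive_block_op:
  assumes "finite X" "\<And>x. x \<in> X \<Longrightarrow> positive_op E (R x)"
  shows "positive_op (X \<times> E) (block_op X R)"
  unfolding positive_op_ip
proof (intro conjI allI)
  show "block_op X R \<in> operators (X \<times> E)"
    using assms(2) by (auto simp: operators_def block_op_def positive_op_def)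
  show "ip (X \<times> E) v (app (X \<times> E) (block_op X R) v) \<in> \<real>\<^sub>\<ge>\<^sub>0" for v
    unfolding ip_block_op[OF assms(1)] using assms(2) unfolding positive_op_ip
    by (intro nonneg_Reals_sum) blast
qed

lemma positive_block_opD:
  assumes "finite X" "positive_op (X \<times> E) (block_op X R)" "x \<in> X"
  shows "ip E v (app E (R x) v) \<in> \<real>\<^sub>\<ge>\<^sub>0"
proof -
  define w where "w = (\<lambda>(x', e). if x' = x then v e else 0)"
  have "ip (X \<times> E) w (app (X \<times> E) (block_op X R) w) \<in> \<real>\<^sub>\<ge>\<^sub>0"
    using assms(2) unfolding positive_op_ip by blast
  also have "ip (X \<times> E) w (app (X \<times> E) (block_op X R) w)
      = (\<Sum>x'\<in>X. if x' = x then ip E v (app E (R x) v) else 0)"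
    unfolding ip_block_op[OF assms(1)]
  proof (intro sum.cong refl)
    fix x'
    show "ip E (\<lambda>e. w (x', e)) (app E (R x') (\<lambda>e. w (x', e)))
        = (if x' = x then ip E v (app E (R x) v) else 0)"
      by (cases "x' = x") (simp_all add: w_def ip_def)
  qed
  also have "\<dots> = ip E v (app E (R x) v)" using assms by simp
  finally show ?thesis .
qed

lemma cq_op_apply:
  assumes "finite X"
  shows "cq_op X \<rho> (x, e) (x', e') = (if x = x' \<and> x \<in> X then \<rho> x e e' else 0)"
proof -
  have "cq_op X \<rho> (x, e) (x', e') = (\<Sum>t\<in>X. if t = x then (if x = x' then \<rho> x e e' else 0) else 0)"
    unfolding cq_op_def op_tensor_def basis_proj_def by (intro sum.cong) auto
  thus ?thesis using assms by auto
qed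

text \<open>With this the operator inequality on the joint space becomes one inequality
  \<open>\<rho> x \<le> c \<sigma>\<close> for each \<open>x\<close>.\<close>

lemma min_entropy_operator:
  assumes "finite X"
  shows "op_minus (op_scale c (op_tensor (op_id X) \<sigma>)) (cq_op X \<rho>)
    = block_op X (\<lambda>x e e'. c * \<sigma> e e' - \<rho> x e e')"
  unfolding op_minus_def op_scale_def op_tensor_def op_id_def block_op_def
  using assms by (intro ext) (auto simp: cq_op_apply split: prod.splits)

lemma positive_op_sum:
  assumes "finite S" "\<And>s. s \<in> S \<Longrightarrow> positive_op E (\<rho> s)"
  shows "positive_op E (\<lambda>e e'. \<Sum>s\<in>S. \<rho> s e e')"
  unfolding positive_op_ip
proof (intro conjI allI)
  show "(\<lambda>e e'. \<Sum>s\<in>S. \<rho> s e e') \<in> operators E"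
    using assms(2) by (auto simp: operators_def positive_op_def intro!: sum.neutral)
  show "ip E v (app E (\<lambda>e e'. \<Sum>s\<in>S. \<rho> s e e') v) \<in> \<real>\<^sub>\<ge>\<^sub>0" for v
    unfolding app_sum_op ip_sum_right using assms(2) unfolding positive_op_ip
    by (intro nonneg_Reals_sum) blast
qed

text \<open>The witness \<open>\<lambda> = 0\<close> with the marginal state as \<open>\<sigma>\<close> shows that the supremum
  defining the min-entropy is not the junk value of an empty supremum.\<close>

lemma min_entropy_dominating_state:
  assumes fin: "finite X" and cq: "cq_state X E \<rho>" and k: "k < min_entropy X E \<rho>"
  obtains l \<sigma> where "k < l" "positive_op E \<sigma>" "Re (op_trace E \<sigma>) \<le> 1"
    "\<forall>x\<in>X. \<forall>v. Re (ip E v (app E (\<rho> x) v)) \<le> 2 powr (- l) * Re (ip E v (app E \<sigma> v))"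
proof -
  let ?S = "{l. 0 \<le> l \<and> (\<exists>\<sigma>. positive_op E \<sigma> \<and> Re (op_trace E \<sigma>) \<le> 1 \<and>
     positive_op (X \<times> E)
       (op_minus (op_scale (of_real (2 powr (- l))) (op_tensor (op_id X) \<sigma>)) (cq_op X \<rho>)))}"
  have pos: "positive_op E (\<rho> x)" if "x \<in> X" for x using cq that by (simp add: cq_state_def)
  have "0 \<in> ?S"
  proof -
    define \<sigma> where "\<sigma> = (\<lambda>e e'. \<Sum>x\<in>X. \<rho> x e e')"
    have "positive_op E \<sigma>" unfolding \<sigma>_def by (rule positive_op_sum[OF fin pos])
    moreover have "op_trace E \<sigma> = (\<Sum>x\<in>X. op_trace E (\<rho> x))"
      unfolding op_trace_def \<sigma>_def by (rule sum.swap)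
    hence "Re (op_trace E \<sigma>) \<le> 1" using cq by (simp add: cq_state_def)
    moreover have "positive_op (X \<times> E) (block_op X (\<lambda>x e e'. 1 * \<sigma> e e' - \<rho> x e e'))"
    proof (rule positive_block_op[OF fin])
      fix x assume x: "x \<in> X"
      have "(\<lambda>e e'. 1 * \<sigma> e e' - \<rho> x e e') = (\<lambda>e e'. \<Sum>x\<in>X - {x}. \<rho> x e e')"
        unfolding \<sigma>_def using fin x by (simp add: sum_diff1)
      thus "positive_op E (\<lambda>e e'. 1 * \<sigma> e e' - \<rho> x e e')"
        using positive_op_sum[of "X - {x}" E \<rho>] fin pos by simp
    qed
    ultimately show ?thesis unfolding min_entropy_operator[OF fin] by auto
  qed
  hence "?S \<noteq> {}" by blast
  moreover have "k < Sup ?S" using k unfolding min_entropy_def .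
  \<comment> \<open>An element strictly above \<open>k\<close> replaces the maximum, so no
    attainment argument is required; the main proof pays one bit of entropy for it.\<close>
  ultimately obtain l where "l \<in> ?S" "k < l" using less_cSupE by blast
  then obtain \<sigma> where \<sigma>: "positive_op E \<sigma>" "Re (op_trace E \<sigma>) \<le> 1"
    "positive_op (X \<times> E) (block_op X (\<lambda>x e e'. of_real (2 powr (- l)) * \<sigma> e e' - \<rho> x e e'))"
    unfolding min_entropy_operator[OF fin] by blast
  have "Re (ip E v (app E (\<rho> x) v)) \<le> 2 powr (- l) * Re (ip E v (app E \<sigma> v))" if "x \<in> X" for x v
  proof -
    have "app E (\<lambda>e e'. of_real (2 powr (- l)) * \<sigma> e e' - \<rho> x e e') v
        = (\<lambda>e. of_real (2 powr (- l)) * app E \<sigma> v e + (- 1) * app E (\<rho> x) v e)"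
      by (simp add: app_def sum_subtractf sum_negf sum_distrib_left algebra_simps)
    hence "of_real (2 powr (- l)) * ip E v (app E \<sigma> v) + (- 1) * ip E v (app E (\<rho> x) v) \<in> \<real>\<^sub>\<ge>\<^sub>0"
      using positive_block_opD[OF fin \<sigma>(3) that, of v] by (simp only: ip_add_right ip_scale_right)
    thus ?thesis by (elim nonneg_Reals_cases) (auto dest: arg_cong[of _ _ Re])
  qed
  with \<open>k < l\<close> \<sigma>(1,2) show ?thesis by (intro that) auto
qed

section \<open>Restriction to fixed values of the classical registers\<close>

lemma sum_inj_support:
  fixes h :: "'i \<Rightarrow> 'c::comm_monoid_add"
  assumes "finite I" "inj_on j F" "j ` F \<subseteq> I" "\<And>i. i \<in> I \<Longrightarrow> i \<notin> j ` F \<Longrightarrow> h i = 0"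
  shows "(\<Sum>i\<in>I. h i) = (\<Sum>f\<in>F. h (j f))"
proof -
  have "(\<Sum>i\<in>I. h i) = (\<Sum>i\<in>j ` F. h i)"
    using assms by (intro sum.mono_neutral_right) auto
  also have "\<dots> = (\<Sum>f\<in>F. h (j f))" using assms(2) by (simp add: sum.reindex)
  finally show ?thesis .
qed

text \<open>Vectors on the block are extended by zero. A contraction on the joint space thus yields
  one on the quantum register for each value of the classical registers.\<close>

lemma contraction_op_inj:
  assumes W: "contraction_op I W" and j: "finite I" "inj_on j F" "j ` F \<subseteq> I"
  shows "contraction_op F (\<lambda>f f'. W (j f) (j f'))"
  unfolding contraction_op_def
proof (intro allI)
  fix a b :: "'b \<Rightarrow> complex"
  define ext where "ext = (\<lambda>(v :: 'b \<Rightarrow> complex) i. if i \<in> j ` F then v (the_inv_into F j i) else 0)"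
  have ext: "ext v (j f) = v f" if "f \<in> F" for v f
    using that j by (simp add: ext_def the_inv_into_f_f)
  have ext0: "ext v i = 0" if "i \<notin> j ` F" for v i using that by (simp add: ext_def)
  have "norm_sq I (ext v) = norm_sq F v" for v
    by (subst sum_inj_support[OF j]) (simp_all add: ext ext0)
  moreover have "ip I (ext a) (app I W (ext b)) = ip F a (app F (\<lambda>f f'. W (j f) (j f')) b)"
  proof -
    have "app I W (ext b) u = (\<Sum>f\<in>F. W u (j f) * b f)" for u
      unfolding app_def by (subst sum_inj_support[OF j]) (simp_all add: ext ext0)
    thus ?thesis
      unfolding ip_def by (subst sum_inj_support[OF j]) (simp_all add: ext ext0 app_def)
  qed
  ultimately show "(cmod (ip F a (app F (\<lambda>f f'. W (j f) (j f')) b)))\<^sup>2 \<le> norm_sq F a * norm_sq F b"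
    using W unfolding contraction_op_def by metis
qed

text \<open>Each Gram vector \<open>r j\<close> contributes the form of \<open>W\<close> at
  \<open>L r j\<close>, at most its squared norm. The right-hand side is the trace of the
  unnormalised output state, which is what the trivial bound on the distance adds up.\<close>

lemma cmod_trace_conj_op_le:
  assumes W: "contraction_op F W"
  shows "cmod (\<Sum>f1\<in>F. \<Sum>f2\<in>F. W f2 f1 * conj_op E L (outer_sum m (\<lambda>k. 1) r) f1 f2)
    \<le> (\<Sum>j<m. norm_sq F (app E L (r j)))"
proof -
  have "(\<Sum>f1\<in>F. \<Sum>f2\<in>F. W f2 f1 * conj_op E L (outer_sum m (\<lambda>k. 1) r) f1 f2)
      = (\<Sum>e\<in>E. \<Sum>e'\<in>E. \<Sum>j<m. cnj (r j e') * pullback F L W e' e * r j e)"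
    unfolding trace_conj_op outer_sum_def sum_distrib_right by (simp add: mult_ac)
  also have "\<dots> = (\<Sum>j<m. \<Sum>e\<in>E. \<Sum>e'\<in>E. cnj (r j e') * pullback F L W e' e * r j e)"
    by (rule sum_swap_1_2[symmetric])
  also have "\<dots> = (\<Sum>j<m. ip E (r j) (app E (pullback F L W) (r j)))"
    unfolding ip_app_sum by (intro sum.cong refl sum.swap)
  also have "\<dots> = (\<Sum>j<m. ip F (app E L (r j)) (app F W (app E L (r j))))"
    unfolding ip_pullback ..
  also have "cmod \<dots> \<le> (\<Sum>j<m. norm_sq F (app E L (r j)))"
  proof (rule sum_norm_le)
    fix j
    show "cmod (ip F (app E L (r j)) (app F W (app E L (r j)))) \<le> norm_sq F (app E L (r j))"
    proof (rule power2_le_imp_le[OF _ norm_sq_nonneg])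
      show "(cmod (ip F (app E L (r j)) (app F W (app E L (r j)))))\<^sup>2 \<le> (norm_sq F (app E L (r j)))\<^sup>2"
        using W unfolding contraction_op_def power2_eq_square[of "norm_sq F _"] by blast
    qed
  qed
  finally show ?thesis .
qed

lemma conj_op_hermitian:
  assumes "hermitian_op R"
  shows "conj_op E L R f1 f2 = cnj (conj_op E L R f2 f1)"
proof -
  have "cnj (R e' e) = R e e'" for e e' using assms unfolding hermitian_op_def by metis
  hence "cnj (conj_op E L R f2 f1) = (\<Sum>e\<in>E. \<Sum>e'\<in>E. cnj (L f2 e) * R e' e * L f1 e')"
    unfolding conj_op_def cnj_sum by simp
  also have "\<dots> = (\<Sum>e'\<in>E. \<Sum>e\<in>E. cnj (L f2 e) * R e' e * L f1 e')" by (rule sum.swap)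
  also have "\<dots> = conj_op E L R f1 f2" unfolding conj_op_def by (simp add: mult_ac)
  finally show ?thesis ..
qed

text \<open>As \<open>Y\<close> is classical and \<open>Y'\<close> is dephased, equal seeds and
  answers force equal extractor values for the same \<open>x\<close>, so the state is block diagonal
  in all four classical registers.\<close>

lemma ext_attack_state:
  assumes fin: "finite X" "finite Y"
  shows "ext_state X ext (attack_state Y Adv (cq_op X \<rho>))
      (z1, z1', y1, y1', f1) (z2, z2', y2, y2', f2)
    = (if (z1, z1', y1, y1') = (z2, z2', y2, y2') \<and> y1 \<in> Y
       then 1 / of_nat (card Y) * (\<Sum>x\<in>X. of_bool (z1 = ext x y1) * of_bool (z1' = ext x y1')
          * Adv (op_tensor (basis_proj y1) (\<rho> x)) (y1', f1) (y1', f2)) else 0)"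
proof -
  have att: "attack_state Y Adv (cq_op X \<rho>) (y1, y1', x, f1) (y2, y2', x, f2)
      = (if y1 = y2 \<and> y1' = y2' \<and> y1 \<in> Y then 1 / of_nat (card Y) *
          Adv (op_tensor (basis_proj y1) (\<rho> x)) (y1', f1) (y1', f2) else 0)"
    if x: "x \<in> X" for x
  proof -
    have id: "id_tensor Adv (\<lambda>(x, w, e) (x', w', e'). basis_proj y w w' * cq_op X \<rho> (x, e) (x', e'))
        (x, y1', f1) (x, y2', f2)
      = Adv (op_tensor (basis_proj y) (\<rho> x)) (y1', f1) (y2', f2)" for y
    proof -
      have "(\<lambda>i i'. (\<lambda>(x, w, e) (x', w', e'). basis_proj y w w' * cq_op X \<rho> (x, e) (x', e')) (x, i) (x, i'))
          = op_tensor (basis_proj y) (\<rho> x)"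
        unfolding op_tensor_def using x fin by (auto simp: cq_op_apply intro!: ext)
      thus ?thesis by (simp add: id_tensor_def)
    qed
    have "attack_state Y Adv (cq_op X \<rho>) (y1, y1', x, f1) (y2, y2', x, f2)
        = 1 / of_nat (card Y) * (\<Sum>y\<in>Y. if y = y1 then (if y1 = y2 \<and> y1' = y2' then
            Adv (op_tensor (basis_proj y1) (\<rho> x)) (y1', f1) (y1', f2) else 0) else 0)"
      unfolding attack_state_def prod.case id
      by (intro arg_cong2[of _ _ _ _ "(*)"] sum.cong refl) (auto simp: basis_proj_def)
    thus ?thesis using fin by auto
  qed
  have "ext_state X ext (attack_state Y Adv (cq_op X \<rho>))
      (z1, z1', y1, y1', f1) (z2, z2', y2, y2', f2)
    = (\<Sum>x\<in>X. if z1 = ext x y1 \<and> z1' = ext x y1' \<and> z2 = ext x y2 \<and> z2' = ext x y2'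
       then (if y1 = y2 \<and> y1' = y2' \<and> y1 \<in> Y then 1 / of_nat (card Y) *
          Adv (op_tensor (basis_proj y1) (\<rho> x)) (y1', f1) (y1', f2) else 0) else 0)"
    unfolding ext_state_def prod.case by (intro sum.cong refl) (simp add: att)
  also have "\<dots> = (\<Sum>x\<in>X. if (z1, z1', y1, y1') = (z2, z2', y2, y2') \<and> y1 \<in> Y
       then 1 / of_nat (card Y) * (of_bool (z1 = ext x y1) * of_bool (z1' = ext x y1')
          * Adv (op_tensor (basis_proj y1) (\<rho> x)) (y1', f1) (y1', f2)) else 0)"
    by (intro sum.cong refl) auto
  also have "\<dots> = (if (z1, z1', y1, y1') = (z2, z2', y2, y2') \<and> y1 \<in> Y
       then 1 / of_nat (card Y) * (\<Sum>x\<in>X. of_bool (z1 = ext x y1) * of_bool (z1' = ext x y1')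
          * Adv (op_tensor (basis_proj y1) (\<rho> x)) (y1', f1) (y1', f2)) else 0)"
    by (cases "(z1, z1', y1, y1') = (z2, z2', y2, y2') \<and> y1 \<in> Y")
      (simp_all only: if_True if_False simp_thms sum_distrib_left sum.neutral_const)
  finally show ?thesis .
qed

lemma sum_Times: "(\<Sum>i\<in>A \<times> B. h i) = (\<Sum>a\<in>A. \<Sum>b\<in>B. h (a, b))"
  by (simp add: sum.cartesian_product)

abbreviation distance_from_uniform ::
  "('z::finite \<times> 'z \<times> 'y \<times> 'y \<times> 'f) operator \<Rightarrow> ('z \<times> 'z \<times> 'y \<times> 'y \<times> 'f) operator" where
  "distance_from_uniform \<sigma> \<equiv> op_minus \<sigma> (op_tensor (max_mixed UNIV) (ptrace_fst UNIV \<sigma>))"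

text \<open>The signed weight of one \<open>x\<close> in the difference between the real and the
  ideal state. For \<open>y\<close> and \<open>y'\<close> fixed it sums to zero over
  \<open>z\<close>, which is why only frequencies with \<open>a \<noteq> 0\<close> appear
  later.\<close>

definition bias :: "('x \<Rightarrow> 'y \<Rightarrow> 'z::finite) \<Rightarrow> 'z \<Rightarrow> 'z \<Rightarrow> 'x \<Rightarrow> 'y \<Rightarrow> 'y \<Rightarrow> real" where
  "bias ext z z' x y y' = (of_bool (z = ext x y) - 1 / CARD('z)) * of_bool (z' = ext x y')"

text \<open>Tracing out the first register sums the indicator of its value to one, so the ideal
  state has the same block structure and the difference is taken under the sum over
  \<open>x\<close>.\<close>

lemma distance_from_uniform_apply:
  fixes ext :: "'x \<Rightarrow> 'y \<Rightarrow> 'z::finite"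
  assumes fin: "finite X" "finite Y"
  shows "distance_from_uniform (ext_state X ext (attack_state Y Adv (cq_op X \<rho>)))
      (z1, z1', y1, y1', f1) (z2, z2', y2, y2', f2)
    = (if (z1, z1', y1, y1') = (z2, z2', y2, y2') \<and> y1 \<in> Y
       then 1 / of_nat (card Y) * (\<Sum>x\<in>X. of_real (bias ext z1 z1' x y1 y1')
          * Adv (op_tensor (basis_proj y1) (\<rho> x)) (y1', f1) (y1', f2)) else 0)"
proof -
  define \<sigma> where "\<sigma> = ext_state X ext (attack_state Y Adv (cq_op X \<rho>))"
  define S where "S x = Adv (op_tensor (basis_proj y1) (\<rho> x)) (y1', f1) (y1', f2)" for x
  have pt: "ptrace_fst UNIV \<sigma> (z1', y1, y1', f1) (z2', y2, y2', f2)
      = (if (z1', y1, y1') = (z2', y2, y2') \<and> y1 \<in> Y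
         then 1 / of_nat (card Y) * (\<Sum>x\<in>X. of_bool (z1' = ext x y1') * S x) else 0)"
  proof (cases "(z1', y1, y1') = (z2', y2, y2') \<and> y1 \<in> Y")
    case True
    have "(\<Sum>z\<in>UNIV. \<Sum>x\<in>X. of_bool (z = ext x y1) * of_bool (z1' = ext x y1') * S x)
        = (\<Sum>x\<in>X. \<Sum>z\<in>UNIV. if z = ext x y1 then of_bool (z1' = ext x y1') * S x else 0)"
      by (subst sum.swap) (intro sum.cong refl, auto)
    also have "\<dots> = (\<Sum>x\<in>X. of_bool (z1' = ext x y1') * S x)" by simp
    finally have "(\<Sum>z\<in>UNIV. 1 / of_nat (card Y) *
          (\<Sum>x\<in>X. of_bool (z = ext x y1) * of_bool (z1' = ext x y1') * S x))
        = 1 / of_nat (card Y) * (\<Sum>x\<in>X. of_bool (z1' = ext x y1') * S x)"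
      by (simp only: sum_distrib_left[symmetric])
    thus ?thesis using True
      unfolding ptrace_fst_def \<sigma>_def ext_attack_state[OF fin] S_def by simp
  next
    case False
    have "\<sigma> (z, z1', y1, y1', f1) (z, z2', y2, y2', f2) = 0" for z
      unfolding \<sigma>_def ext_attack_state[OF fin] using False by (intro if_not_P) auto
    thus ?thesis unfolding ptrace_fst_def if_not_P[OF False] by simp
  qed
  have "distance_from_uniform \<sigma> (z1, z1', y1, y1', f1) (z2, z2', y2, y2', f2)
      = \<sigma> (z1, z1', y1, y1', f1) (z2, z2', y2, y2', f2)
        - (if z1 = z2 then 1 / of_nat CARD('z) else 0)
          * ptrace_fst UNIV \<sigma> (z1', y1, y1', f1) (z2', y2, y2', f2)"
    by (simp add: op_minus_def op_tensor_def max_mixed_def op_scale_def op_id_def)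
  also have "\<dots> = (if (z1, z1', y1, y1') = (z2, z2', y2, y2') \<and> y1 \<in> Y
      then 1 / of_nat (card Y) * ((\<Sum>x\<in>X. of_bool (z1 = ext x y1) * of_bool (z1' = ext x y1') * S x)
        - 1 / of_nat CARD('z) * (\<Sum>x\<in>X. of_bool (z1' = ext x y1') * S x)) else 0)"
    unfolding pt unfolding \<sigma>_def ext_attack_state[OF fin] S_def
    by (auto simp: right_diff_distrib)
  also have "(\<Sum>x\<in>X. of_bool (z1 = ext x y1) * of_bool (z1' = ext x y1') * S x)
        - 1 / of_nat CARD('z) * (\<Sum>x\<in>X. of_bool (z1' = ext x y1') * S x)
      = (\<Sum>x\<in>X. of_real (bias ext z1 z1' x y1 y1') * S x)"
    unfolding sum_distrib_left sum_subtractf[symmetric]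
    by (intro sum.cong refl) (simp add: bias_def algebra_simps)
  finally show ?thesis unfolding \<sigma>_def S_def .
qed

section \<open>Blocks of the adversary's Kraus operators\<close>

lemma conj_op_basis_tensor:
  assumes "finite Y" "finite E" "y \<in> Y"
  shows "conj_op (Y \<times> E) K (op_tensor (basis_proj y) R) j j'
    = conj_op E (\<lambda>f e. K f (y, e)) R j j'"
proof -
  have fin: "finite (Y \<times> E)" and inj: "inj_on (Pair y) E" and sub: "Pair y ` E \<subseteq> Y \<times> E"
    using assms by (auto simp: inj_on_def)
  have z: "op_tensor (basis_proj y) R i i' = 0" if "i \<notin> Pair y ` E \<or> i' \<notin> Pair y ` E"
    "i \<in> Y \<times> E" "i' \<in> Y \<times> E" for i i'
    using that by (auto simp: op_tensor_def basis_proj_def split: prod.splits)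
  have "conj_op (Y \<times> E) K (op_tensor (basis_proj y) R) j j'
      = (\<Sum>i\<in>Y \<times> E. \<Sum>e'\<in>E. K j i * op_tensor (basis_proj y) R i (y, e') * cnj (K j' (y, e')))"
    unfolding conj_op_def
    by (intro sum.cong refl sum_inj_support[OF fin inj sub]) (simp add: z)
  also have "\<dots> = (\<Sum>e\<in>E. \<Sum>e'\<in>E. K j (y, e) * op_tensor (basis_proj y) R (y, e) (y, e') * cnj (K j' (y, e')))"
    by (intro sum_inj_support[OF fin inj sub] sum.neutral ballI) (use sub in \<open>auto simp: z\<close>)
  also have "\<dots> = conj_op E (\<lambda>f e. K f (y, e)) R j j'"
    by (simp add: conj_op_def op_tensor_def basis_proj_def)
  finally show ?thesis .
qed

lemma density_basis_proj:
  assumes "finite E" "e \<in> E"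
  shows "density_op E (basis_proj e)"
proof -
  have "ip E v (app E (basis_proj e) v) = of_real ((cmod (v e))\<^sup>2)" for v
  proof -
    have "app E (basis_proj e) v i = (\<Sum>j\<in>E. if j = e then (if i = e then v e else 0) else 0)" for i
      unfolding app_def basis_proj_def by (intro sum.cong) auto
    hence "app E (basis_proj e) v = (\<lambda>i. if i = e then v e else 0)" using assms by auto
    hence "ip E v (app E (basis_proj e) v) = (\<Sum>i\<in>E. if i = e then v e * cnj (v e) else 0)"
      unfolding ip_def by (intro sum.cong) auto
    thus ?thesis using assms by (simp add: mult_cnj_self)
  qed
  hence "ip E v (app E (basis_proj e) v) \<in> \<real>\<^sub>\<ge>\<^sub>0" for v
    by (metis nonneg_Reals_of_real_iff zero_le_power2)
  moreover have "basis_proj e \<in> operators E" using assms by (auto simp: operators_def basis_proj_def)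
  moreover have "op_trace E (basis_proj e) = (\<Sum>i\<in>E. if i = e then 1 else 0)"
    unfolding op_trace_def basis_proj_def by (intro sum.cong) auto
  ultimately show ?thesis using assms by (simp add: density_op_def positive_op_ip)
qed

text \<open>\<open>L k y y'\<close> is the block of the \<open>k\<close>-th Kraus operator that maps seed \<open>y\<close> to seed \<open>y'\<close>.\<close>

definition kraus_form ::
  "'y set \<Rightarrow> 'e set \<Rightarrow> 'f set \<Rightarrow> (('y \<times> 'e) operator \<Rightarrow> ('y \<times> 'f) operator) \<Rightarrow> nat
     \<Rightarrow> (nat \<Rightarrow> 'y \<Rightarrow> 'y \<Rightarrow> 'f \<Rightarrow> 'e \<Rightarrow> complex) \<Rightarrow> bool" where
  "kraus_form Y E F Adv m L \<longleftrightarrow>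
     (\<forall>y\<in>Y. \<forall>R\<in>operators E. \<forall>y' f1 f2.
        Adv (op_tensor (basis_proj y) R) (y', f1) (y', f2) = (\<Sum>k<m. conj_op E (L k y y') R f1 f2)) \<and>
     (\<forall>y\<in>Y. \<forall>v. (\<Sum>y'\<in>Y. \<Sum>k<m. norm_sq F (app E (L k y y') v)) = norm_sq E v)"

text \<open>On the input \<open>basis_proj e\<close>, the probability of repeating the seed
  \<open>y\<close> is the sum over \<open>f\<close> and \<open>k\<close> of the squares of
  \<open>cmod (L k y y f e)\<close>. Without fixed points it is zero, so the diagonal blocks vanish
  entry by entry. The norm identity comes from inputs supported on a single seed.\<close>

lemma attack_kraus_form:
  fixes Adv :: "('y \<times> 'e) operator \<Rightarrow> ('y \<times> 'f) operator"
  assumes fin: "finite Y" "finite E" "finite F" and Adv: "cptp (Y \<times> E) (Y \<times> F) Adv"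
    and nfp: "no_fixed_points Y E F Adv"
  obtains m L where "kraus_form Y E F Adv m L"
    "\<forall>k<m. \<forall>y\<in>Y. \<forall>f\<in>F. \<forall>e\<in>E. L k y y f e = 0"
proof -
  have finI: "finite (Y \<times> E)" "finite (Y \<times> F)" using fin by auto
  have "\<exists>(m :: nat) K. (\<forall>M \<in> operators (Y \<times> E). \<forall>j j'.
        Adv M j j' = (\<Sum>k<m. conj_op (Y \<times> E) (K k) M j j')) \<and>
      (\<forall>v. (\<Sum>k<m. norm_sq (Y \<times> F) (app (Y \<times> E) (K k) v)) = norm_sq (Y \<times> E) v)"
    by (rule kraus_decomposition[OF finI Adv]) blast
  then obtain m :: nat and K where K:
    "\<forall>M \<in> operators (Y \<times> E). \<forall>j j'. Adv M j j' = (\<Sum>k<m. conj_op (Y \<times> E) (K k) M j j')"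
    "\<And>v. (\<Sum>k<m. norm_sq (Y \<times> F) (app (Y \<times> E) (K k) v)) = norm_sq (Y \<times> E) v"
    by blast
  define L where "L = (\<lambda>k y y' f e. K k (y', f) (y, e))"
  have 1: "Adv (op_tensor (basis_proj y) R) (y', f1) (y', f2) = (\<Sum>k<m. conj_op E (L k y y') R f1 f2)"
    if "y \<in> Y" "R \<in> operators E" for y R y' f1 f2
  proof -
    have "op_tensor (basis_proj y) R \<in> operators (Y \<times> E)"
      using that by (auto simp: operators_def op_tensor_def basis_proj_def)
    hence "Adv (op_tensor (basis_proj y) R) (y', f1) (y', f2)
        = (\<Sum>k<m. conj_op (Y \<times> E) (K k) (op_tensor (basis_proj y) R) (y', f1) (y', f2))"
      using K(1) by blast
    thus ?thesis unfolding conj_op_basis_tensor[OF fin(1,2) that(1)] by (simp add: L_def conj_op_def)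
  qed
  have 2: "(\<Sum>y'\<in>Y. \<Sum>k<m. norm_sq F (app E (L k y y') v)) = norm_sq E v" if y: "y \<in> Y" for y v
  proof -
    have j: "inj_on (Pair y) E" "Pair y ` E \<subseteq> Y \<times> E" using y by (auto simp: inj_on_def)
    define w where "w = (\<lambda>(y', e). if y' = y then v e else 0)"
    have w0: "w i = 0" if "i \<in> Y \<times> E" "i \<notin> Pair y ` E" for i
      using that by (auto simp: w_def split: prod.splits)
    have appw: "app (Y \<times> E) (K k) w (y', f) = app E (L k y y') v f" for k y' f
      unfolding app_def by (subst sum_inj_support[OF finI(1) j]) (simp_all add: w0, simp add: w_def L_def)
    have "norm_sq E v = norm_sq (Y \<times> E) w"
      by (subst sum_inj_support[OF finI(1) j]) (simp_all add: w0, simp add: w_def)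
    also have "\<dots> = (\<Sum>k<m. norm_sq (Y \<times> F) (app (Y \<times> E) (K k) w))" by (simp only: K(2))
    also have "\<dots> = (\<Sum>k<m. \<Sum>y'\<in>Y. norm_sq F (app E (L k y y') v))"
      by (simp add: sum_Times appw)
    also have "\<dots> = (\<Sum>y'\<in>Y. \<Sum>k<m. norm_sq F (app E (L k y y') v))" by (rule sum.swap)
    finally show ?thesis ..
  qed
  have 3: "L k y y f e = 0" if "k < m" "y \<in> Y" "f \<in> F" "e \<in> E" for k y f e
  proof -
    have dens: "density_op E (basis_proj e)" using fin(2) that(4) by (rule density_basis_proj)
    hence op: "basis_proj e \<in> operators E" by (simp add: density_op_def positive_op_def)
    have conj: "conj_op E (L k y y) (basis_proj e) f f = of_real ((cmod (L k y y f e))\<^sup>2)" for k f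
    proof -
      have "conj_op E (L k y y) (basis_proj e) f f
          = (\<Sum>i\<in>E. if i = e then \<Sum>i'\<in>E. if i' = e then L k y y f e * cnj (L k y y f e) else 0 else 0)"
        unfolding conj_op_def basis_proj_def by (intro sum.cong) (auto intro!: sum.cong sum.neutral)
      thus ?thesis using fin(2) that(4) by (simp add: mult_cnj_self)
    qed
    have "ptrace_snd F (Adv (op_tensor (basis_proj y) (basis_proj e))) y y = 0"
      using nfp dens that(2) unfolding no_fixed_points_def by blast
    hence "0 = (\<Sum>f\<in>F. \<Sum>k<m. conj_op E (L k y y) (basis_proj e) f f)"
      by (simp add: ptrace_snd_def 1[OF that(2) op])
    also have "\<dots> = of_real (\<Sum>f\<in>F. \<Sum>k<m. (cmod (L k y y f e))\<^sup>2)"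
      unfolding conj of_real_sum ..
    finally have "complex_of_real (\<Sum>f\<in>F. \<Sum>k<m. (cmod (L k y y f e))\<^sup>2) = 0" ..
    hence "(\<Sum>f\<in>F. \<Sum>k<m. (cmod (L k y y f e))\<^sup>2) = 0" by (simp only: of_real_eq_0_iff)
    hence "(\<Sum>k<m. (cmod (L k y y f e))\<^sup>2) = 0"
      using fin(3) that(3) by (simp add: sum_nonneg_eq_0_iff sum_nonneg)
    thus ?thesis using that(1) by (simp add: sum_nonneg_eq_0_iff)
  qed
  have "kraus_form Y E F Adv m L" unfolding kraus_form_def using 1 2 by blast
  moreover have "\<forall>k<m. \<forall>y\<in>Y. \<forall>f\<in>F. \<forall>e\<in>E. L k y y f e = 0" using 3 by blast
  ultimately show ?thesis by (rule that)
qed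

text \<open>The distance operator is Hermitian and block diagonal in the classical registers, so
  only the diagonal blocks of the dual contraction enter. They depend on \<open>z\<close>,
  \<open>z'\<close>, \<open>y\<close>, \<open>y'\<close> but not on \<open>x\<close>, which keeps
  the sum over \<open>x\<close> free for the characters.\<close>

lemma attack_trace_norm:
  fixes ext :: "'x \<Rightarrow> 'y \<Rightarrow> 'z::finite"
    and Adv :: "('y \<times> 'e) operator \<Rightarrow> ('y \<times> 'f) operator"
  assumes fin: "finite X" "finite Y" "finite E" "finite F"
    and Adv: "cptp (Y \<times> E) (Y \<times> F) Adv" and cq: "cq_state X E \<rho>"
    and kraus: "kraus_form Y E F Adv m L"
  obtains W where "\<forall>z z'. \<forall>y\<in>Y. \<forall>y'\<in>Y. contraction_op F (W z z' y y')"
    "complex_of_real (trace_norm (UNIV \<times> UNIV \<times> Y \<times> Y \<times> F)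
        (distance_from_uniform (ext_state X ext (attack_state Y Adv (cq_op X \<rho>)))))
      = 1 / of_nat (card Y) * (\<Sum>z\<in>UNIV. \<Sum>z'\<in>UNIV. \<Sum>y\<in>Y. \<Sum>y'\<in>Y. \<Sum>x\<in>X.
          of_real (bias ext z z' x y y') *
          (\<Sum>f1\<in>F. \<Sum>f2\<in>F. W z z' y y' f2 f1 * (\<Sum>k<m. conj_op E (L k y y') (\<rho> x) f1 f2)))"
proof -
  have \<rho>: "positive_op E (\<rho> x)" if "x \<in> X" for x using cq that by (simp add: cq_state_def)
  have L: "Adv (op_tensor (basis_proj y) R) (y', f1) (y', f2) = (\<Sum>k<m. conj_op E (L k y y') R f1 f2)"
    if "y \<in> Y" "R \<in> operators E" for y R y' f1 f2 using kraus that by (simp add: kraus_form_def)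
  define I where "I = (UNIV :: 'z set) \<times> (UNIV :: 'z set) \<times> Y \<times> Y \<times> F"
  define D where "D = distance_from_uniform (ext_state X ext (attack_state Y Adv (cq_op X \<rho>)))"
  define S where "S x y y' f1 f2 = (\<Sum>k<m. conj_op E (L k y y') (\<rho> x) f1 f2)" for x y y' f1 f2
  have \<rho>op: "\<rho> x \<in> operators E" if "x \<in> X" for x using \<rho>[OF that] by (simp add: positive_op_def)
  have D_eq: "D (z1, z1', y1, y1', f1) (z2, z2', y2, y2', f2)
    = (if (z1, z1', y1, y1') = (z2, z2', y2, y2') \<and> y1 \<in> Y
       then 1 / of_nat (card Y) * (\<Sum>x\<in>X. of_real (bias ext z1 z1' x y1 y1') * S x y1 y1' f1 f2)
       else 0)" for z1 z1' y1 y1' f1 z2 z2' y2 y2' f2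
    unfolding D_def distance_from_uniform_apply[OF fin(1,2)]
    by (intro if_cong refl arg_cong2[of _ _ _ _ "(*)"] sum.cong) (clarsimp simp: L \<rho>op S_def)
  have S_herm: "S x y y' f1 f2 = cnj (S x y y' f2 f1)" if "x \<in> X" for x y y' f1 f2
    unfolding S_def cnj_sum
    by (intro sum.cong refl conj_op_hermitian positive_op_hermitian[OF fin(3)] \<rho> that)
  \<comment> \<open>The block formula confines only the seed to \<open>Y\<close>. That the answer
    and the output indices stay in range comes from \<open>Adv\<close> mapping into
    \<open>operators (Y \<times> F)\<close>.\<close>
  have S_zero: "S x y y' f1 f2 = 0" if "x \<in> X" "y \<in> Y" "y' \<notin> Y \<or> f1 \<notin> F \<or> f2 \<notin> F" for x y y' f1 f2
  proof -
    have "op_tensor (basis_proj y) (\<rho> x) \<in> operators (Y \<times> E)"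
      using that(2) \<rho>op[OF that(1)] by (auto simp: operators_def op_tensor_def basis_proj_def)
    hence "Adv (op_tensor (basis_proj y) (\<rho> x)) \<in> operators (Y \<times> F)"
      using Adv by (auto simp: cptp_def)
    hence "Adv (op_tensor (basis_proj y) (\<rho> x)) (y', f1) (y', f2) = 0"
      using that(3) by (auto simp: operators_def)
    thus ?thesis by (simp add: L \<rho>op that S_def)
  qed
  have "finite I" using fin by (simp add: I_def)
  moreover have "D \<in> operators I"
    by (auto simp: operators_def I_def D_eq S_zero intro!: sum.neutral)
  moreover have "hermitian_op D"
    unfolding hermitian_op_def
  proof (intro allI)
    fix i j :: "'z \<times> 'z \<times> 'y \<times> 'y \<times> 'f"
    obtain z1 z1' y1 y1' f1 z2 z2' y2 y2' f2
      where ij: "i = (z1, z1', y1, y1', f1)" "j = (z2, z2', y2, y2', f2)" by (metis prod_cases5)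
    define B where "B f f' = (\<Sum>x\<in>X. of_real (bias ext z1 z1' x y1 y1') * S x y1 y1' f f')" for f f'
    have B: "B f1 f2 = cnj (B f2 f1)"
      unfolding B_def cnj_sum complex_cnj_mult complex_cnj_complex_of_real
      by (intro sum.cong refl arg_cong2[of _ _ _ _ "(*)"] S_herm)
    show "D i j = cnj (D j i)"
    proof (cases "(z1, z1', y1, y1') = (z2, z2', y2, y2') \<and> y1 \<in> Y")
      case True
      hence "D i j = 1 / of_nat (card Y) * B f1 f2" "D j i = 1 / of_nat (card Y) * B f2 f1"
        unfolding ij by (auto simp: D_eq B_def)
      thus ?thesis by (subst (asm) B) simp
    next
      case False
      hence "D i j = 0" "D j i = 0" unfolding ij by (auto simp: D_eq)
      thus ?thesis by simp
    qed
  qed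
  ultimately obtain W where W: "contraction_op I W"
    "complex_of_real (trace_norm I D) = (\<Sum>i\<in>I. \<Sum>j\<in>I. W j i * D i j)"
    by (rule trace_norm_dual)
  define V where "V z z' y y' = (\<lambda>f f'. W (z, z', y, y', f) (z, z', y, y', f'))" for z z' y y'
  have inj: "inj_on (\<lambda>f. (z, z', y, y', f)) F" for z z' y y' by (auto simp: inj_on_def)
  have sub: "(\<lambda>f. (z, z', y, y', f)) ` F \<subseteq> I" if "y \<in> Y" "y' \<in> Y" for z z' y y'
    using that by (auto simp: I_def)
  have "\<forall>z z'. \<forall>y\<in>Y. \<forall>y'\<in>Y. contraction_op F (V z z' y y')"
    unfolding V_def using contraction_op_inj[OF W(1) \<open>finite I\<close> inj sub] by blast
  moreover have "complex_of_real (trace_norm I D) = 1 / of_nat (card Y) *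
      (\<Sum>z\<in>UNIV. \<Sum>z'\<in>UNIV. \<Sum>y\<in>Y. \<Sum>y'\<in>Y. \<Sum>x\<in>X. of_real (bias ext z z' x y y') *
          (\<Sum>f1\<in>F. \<Sum>f2\<in>F. V z z' y y' f2 f1 * S x y y' f1 f2))"
  proof -
    have row: "(\<Sum>j\<in>I. W j (z, z', y, y', f1) * D (z, z', y, y', f1) j)
        = (\<Sum>f2\<in>F. 1 / of_nat (card Y) * (\<Sum>x\<in>X. of_real (bias ext z z' x y y') *
            (V z z' y y' f2 f1 * S x y y' f1 f2)))"
      if "y \<in> Y" "y' \<in> Y" for z z' y y' f1
    proof -
      have "(\<Sum>j\<in>I. W j (z, z', y, y', f1) * D (z, z', y, y', f1) j)
          = (\<Sum>f2\<in>F. W (z, z', y, y', f2) (z, z', y, y', f1) * D (z, z', y, y', f1) (z, z', y, y', f2))"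
        by (rule sum_inj_support[OF \<open>finite I\<close> inj sub[OF that]]) (auto simp: I_def D_eq image_iff split: if_splits)
      thus ?thesis using that by (simp add: D_eq V_def sum_distrib_left mult_ac)
    qed
    have "complex_of_real (trace_norm I D)
        = (\<Sum>z\<in>UNIV. \<Sum>z'\<in>UNIV. \<Sum>y\<in>Y. \<Sum>y'\<in>Y. \<Sum>f1\<in>F.
            (\<Sum>j\<in>I. W j (z, z', y, y', f1) * D (z, z', y, y', f1) j))"
      unfolding W(2) by (subst (1) I_def) (simp only: sum_Times)
    also have "\<dots> = (\<Sum>z\<in>UNIV. \<Sum>z'\<in>UNIV. \<Sum>y\<in>Y. \<Sum>y'\<in>Y. 1 / of_nat (card Y) * (\<Sum>x\<in>X.
          of_real (bias ext z z' x y y') * (\<Sum>f1\<in>F. \<Sum>f2\<in>F. V z z' y y' f2 f1 * S x y y' f1 f2)))"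
    proof (intro sum.cong refl)
      fix z z' y y' assume y: "y \<in> Y" "y' \<in> Y"
      have "(\<Sum>f1\<in>F. \<Sum>j\<in>I. W j (z, z', y, y', f1) * D (z, z', y, y', f1) j)
          = (\<Sum>f1\<in>F. \<Sum>f2\<in>F. 1 / of_nat (card Y) * (\<Sum>x\<in>X. of_real (bias ext z z' x y y') *
            (V z z' y y' f2 f1 * S x y y' f1 f2)))"
        by (simp only: row[OF y])
      also have "\<dots> = 1 / of_nat (card Y) * (\<Sum>f1\<in>F. \<Sum>f2\<in>F. \<Sum>x\<in>X. of_real (bias ext z z' x y y') *
            (V z z' y y' f2 f1 * S x y y' f1 f2))"
        unfolding sum_distrib_left ..
      also have "(\<Sum>f1\<in>F. \<Sum>f2\<in>F. \<Sum>x\<in>X. of_real (bias ext z z' x y y') *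
            (V z z' y y' f2 f1 * S x y y' f1 f2))
          = (\<Sum>x\<in>X. of_real (bias ext z z' x y y') * (\<Sum>f1\<in>F. \<Sum>f2\<in>F. V z z' y y' f2 f1 * S x y y' f1 f2))"
        unfolding sum_distrib_left by (rule sum_swap_1_2[symmetric])
      finally show "(\<Sum>f1\<in>F. \<Sum>j\<in>I. W j (z, z', y, y', f1) * D (z, z', y, y', f1) j)
          = 1 / of_nat (card Y) * (\<Sum>x\<in>X.
          of_real (bias ext z z' x y y') * (\<Sum>f1\<in>F. \<Sum>f2\<in>F. V z z' y y' f2 f1 * S x y y' f1 f2))" .
    qed
    finally show ?thesis unfolding sum_distrib_left .
  qed
  ultimately show ?thesis unfolding I_def D_def S_def by (rule that)
qed

section \<open>The trace distance\<close>

text \<open>The sum over \<open>z\<close> is the l1 distance between a point mass and the uniform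
  distribution; the register \<open>z'\<close> contributes the factor one.\<close>

lemma sum_abs_bias_le:
  fixes ext :: "'x \<Rightarrow> 'y \<Rightarrow> 'z::finite"
  shows "(\<Sum>z\<in>UNIV. \<Sum>z'\<in>UNIV. \<bar>bias ext z z' x y y'\<bar>) \<le> 2"
proof -
  have "(\<Sum>z\<in>UNIV. \<Sum>z'\<in>UNIV. \<bar>bias ext z z' x y y'\<bar>)
      = (\<Sum>z\<in>UNIV. \<bar>of_bool (z = ext x y) - 1 / CARD('z)\<bar>) * (\<Sum>z'\<in>UNIV. of_bool (z' = ext x y'))"
    unfolding sum_product bias_def abs_mult by simp
  also have "\<dots> = (\<Sum>z\<in>UNIV. \<bar>of_bool (z = ext x y) - 1 / CARD('z)\<bar>)"
    by (simp add: of_bool_def)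
  also have "\<dots> \<le> (\<Sum>z\<in>(UNIV :: 'z set). of_bool (z = ext x y) + 1 / CARD('z))"
    by (intro sum_mono) auto
  also have "\<dots> = 2" unfolding sum.distrib by (simp add: of_bool_def)
  finally show ?thesis .
qed

text \<open>The Fourier estimate ends in the square of \<open>\<epsilon>\<close>, which is at most
  \<open>\<epsilon>\<close> only up to \<open>\<epsilon> = 1\<close>; beyond that this bound takes
  over. It is the triangle inequality over blocks, as contractions cannot increase the weight of a
  block.\<close>

lemma attack_trace_norm_le_2:
  fixes ext :: "'x \<Rightarrow> 'y \<Rightarrow> 'z::finite"
    and Adv :: "('y \<times> 'e) operator \<Rightarrow> ('y \<times> 'f) operator"
  assumes fin: "finite X" "finite Y" "finite E" "finite F"
    and Adv: "cptp (Y \<times> E) (Y \<times> F) Adv" and cq: "cq_state X E \<rho>"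
    and kraus: "kraus_form Y E F Adv m L"
  shows "trace_norm (UNIV \<times> UNIV \<times> Y \<times> Y \<times> F)
    (distance_from_uniform (ext_state X ext (attack_state Y Adv (cq_op X \<rho>)))) \<le> 2"
    (is "?tn \<le> 2")
proof -
  have \<rho>: "\<And>x. x \<in> X \<Longrightarrow> positive_op E (\<rho> x)" "(\<Sum>x\<in>X. op_trace E (\<rho> x)) = 1"
    using cq by (auto simp: cq_state_def)
  have tp: "(\<Sum>y'\<in>Y. \<Sum>k<m. norm_sq F (app E (L k y y') v)) = norm_sq E v" if "y \<in> Y" for y v
    using kraus that unfolding kraus_form_def by blast
  obtain W where W: "\<forall>z z'. \<forall>y\<in>Y. \<forall>y'\<in>Y. contraction_op F (W z z' y y')"
    "complex_of_real ?tn
      = 1 / of_nat (card Y) * (\<Sum>z\<in>UNIV. \<Sum>z'\<in>UNIV. \<Sum>y\<in>Y. \<Sum>y'\<in>Y. \<Sum>x\<in>X.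
          of_real (bias ext z z' x y y') *
          (\<Sum>f1\<in>F. \<Sum>f2\<in>F. W z z' y y' f2 f1 * (\<Sum>k<m. conj_op E (L k y y') (\<rho> x) f1 f2)))"
    by (rule attack_trace_norm[OF fin Adv cq kraus, where ext = ext])
  have "\<forall>x\<in>X. \<exists>mr u. \<rho> x = outer_sum mr (\<lambda>k. 1) u"
    using positive_op_gram[OF fin(3) \<rho>(1)] by metis
  then obtain mr r where r: "\<And>x. x \<in> X \<Longrightarrow> \<rho> x = outer_sum (mr x) (\<lambda>k. 1) (r x)" by metis
  \<comment> \<open>The probability of \<open>x\<close> together with the answer \<open>y'\<close>
    when the seed is \<open>y\<close>; by trace preservation these sum to one in
    \<open>tsum\<close>.\<close>
  define t where "t x y y' = (\<Sum>k<m. \<Sum>j<mr x. norm_sq F (app E (L k y y') (r x j)))" for x y y'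
  have t: "cmod (\<Sum>f1\<in>F. \<Sum>f2\<in>F. W z z' y y' f2 f1 * (\<Sum>k<m. conj_op E (L k y y') (\<rho> x) f1 f2))
      \<le> t x y y'" if "x \<in> X" "y \<in> Y" "y' \<in> Y" for z z' x y y'
  proof -
    have "(\<Sum>f1\<in>F. \<Sum>f2\<in>F. W z z' y y' f2 f1 * (\<Sum>k<m. conj_op E (L k y y') (\<rho> x) f1 f2))
        = (\<Sum>k<m. \<Sum>f1\<in>F. \<Sum>f2\<in>F. W z z' y y' f2 f1 * conj_op E (L k y y') (\<rho> x) f1 f2)"
      unfolding sum_distrib_left by (rule sum_swap_1_2[symmetric])
    also have "cmod \<dots> \<le> t x y y'"
      unfolding t_def r[OF that(1)]
      using W(1) that by (intro sum_norm_le cmod_trace_conj_op_le) blast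
    finally show ?thesis .
  qed
  have t_nonneg: "t x y y' \<ge> 0" for x y y' unfolding t_def by (intro sum_nonneg) simp
  have "(\<Sum>x\<in>X. \<Sum>j<mr x. norm_sq E (r x j)) = 1"
  proof -
    have "complex_of_real (\<Sum>x\<in>X. \<Sum>j<mr x. norm_sq E (r x j)) = (\<Sum>x\<in>X. op_trace E (\<rho> x))"
      unfolding of_real_sum[of _ X] by (intro sum.cong refl) (simp only: r op_trace_gram)
    thus ?thesis unfolding \<rho>(2) of_real_eq_1_iff .
  qed
  moreover have "(\<Sum>y'\<in>Y. \<Sum>x\<in>X. t x y y') = (\<Sum>x\<in>X. \<Sum>j<mr x. norm_sq E (r x j))"
    if "y \<in> Y" for y
  proof -
    have "(\<Sum>y'\<in>Y. \<Sum>x\<in>X. t x y y') = (\<Sum>x\<in>X. \<Sum>y'\<in>Y. t x y y')" by (rule sum.swap)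
    also have "\<dots> = (\<Sum>x\<in>X. \<Sum>j<mr x. \<Sum>y'\<in>Y. \<Sum>k<m. norm_sq F (app E (L k y y') (r x j)))"
      unfolding t_def by (intro sum.cong refl sum_swap_1_2[symmetric])
    finally show ?thesis by (simp only: tp[OF that])
  qed
  ultimately have tsum: "(\<Sum>y'\<in>Y. \<Sum>x\<in>X. t x y y') = 1" if "y \<in> Y" for y using that by metis
  have "?tn \<le> cmod (complex_of_real ?tn)" by simp
  also have "\<dots> \<le> 1 / card Y * (\<Sum>z\<in>UNIV. \<Sum>z'\<in>UNIV. \<Sum>y\<in>Y. \<Sum>y'\<in>Y. \<Sum>x\<in>X. \<bar>bias ext z z' x y y'\<bar> * t x y y')"
    unfolding W(2) norm_mult norm_divide norm_of_nat norm_one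
    by (intro mult_left_mono sum_norm_le) (auto simp: norm_mult intro!: mult_left_mono t)
  also have "(\<Sum>z\<in>UNIV. \<Sum>z'\<in>UNIV. \<Sum>y\<in>Y. \<Sum>y'\<in>Y. \<Sum>x\<in>X. \<bar>bias ext z z' x y y'\<bar> * t x y y')
      = (\<Sum>y\<in>Y. \<Sum>y'\<in>Y. \<Sum>z\<in>UNIV. \<Sum>z'\<in>UNIV. \<Sum>x\<in>X. \<bar>bias ext z z' x y y'\<bar> * t x y y')"
    by (rule sum_swap_2_2)
  also have "\<dots> = (\<Sum>y\<in>Y. \<Sum>y'\<in>Y. \<Sum>x\<in>X. (\<Sum>z\<in>UNIV. \<Sum>z'\<in>UNIV. \<bar>bias ext z z' x y y'\<bar>) * t x y y')"
    unfolding sum_distrib_right by (intro sum.cong refl sum_swap_1_2[symmetric])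
  also have "1 / card Y * \<dots> \<le> 1 / card Y * (\<Sum>y\<in>Y. \<Sum>y'\<in>Y. \<Sum>x\<in>X. 2 * t x y y')"
    by (intro mult_left_mono sum_mono mult_right_mono sum_abs_bias_le t_nonneg) simp
  also have "(\<Sum>y\<in>Y. \<Sum>y'\<in>Y. \<Sum>x\<in>X. 2 * t x y y') = 2 * card Y"
    unfolding sum_distrib_left[symmetric] by (simp add: tsum)
  also have "1 / card Y * (2 * card Y) \<le> 2" by simp
  finally show ?thesis by simp
qed

section \<open>Fourier expansion of the bias and the final estimate\<close>

text \<open>The term \<open>a = 0\<close> in the expansion of the first indicator is exactly the
  subtracted \<open>1 / p\<close>. The second indicator keeps all \<open>b\<close>, including
  zero.\<close>

lemma bias_fourier:
  fixes ext :: "'x \<Rightarrow> 'y \<Rightarrow> 'p::prime_card mod_ring"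
  shows "complex_of_real (bias ext z z' x y y') = 1 / of_nat (CARD('p)\<^sup>2) *
    (\<Sum>a\<in>UNIV - {0}. \<Sum>b\<in>UNIV. fchar (- (a * z) - b * z') * fchar (a * ext x y + b * ext x y'))"
proof -
  define p where "p = (of_nat CARD('p) :: complex)"
  have p: "p \<noteq> 0" by (simp add: p_def)
  have ind: "p * of_bool (s = t) = (\<Sum>a\<in>UNIV. fchar (a * (t - s)))" for s t :: "'p mod_ring"
    by (simp add: sum_fchar p_def)
  have "(\<Sum>a\<in>UNIV - {0}. fchar (a * (ext x y - z))) = p * of_bool (z = ext x y) - 1"
    unfolding ind by (subst sum_diff1) (simp_all add: fchar_0)
  moreover have "(\<Sum>a\<in>UNIV - {0}. \<Sum>b\<in>UNIV. fchar (- (a * z) - b * z') * fchar (a * ext x y + b * ext x y'))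
      = (\<Sum>a\<in>UNIV - {0}. fchar (a * (ext x y - z))) * (\<Sum>b\<in>UNIV. fchar (b * (ext x y' - z')))"
    unfolding sum_product
    by (intro sum.cong refl) (simp add: algebra_simps flip: fchar_add)
  ultimately have "(\<Sum>a\<in>UNIV - {0}. \<Sum>b\<in>UNIV. fchar (- (a * z) - b * z') * fchar (a * ext x y + b * ext x y'))
      = (p * of_bool (z = ext x y) - 1) * (p * of_bool (z' = ext x y'))"
    by (simp only: ind)
  moreover have "complex_of_real (bias ext z z' x y y') = (of_bool (z = ext x y) - 1 / p) * of_bool (z' = ext x y')"
    by (simp add: bias_def p_def)
  moreover have "(A - 1 / p) * B = 1 / p\<^sup>2 * ((p * A - 1) * (p * B))" for A B
    using p by (simp add: power2_eq_square field_simps)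
  ultimately show ?thesis by (simp only: p_def of_nat_power)
qed

text \<open>The dual contraction depends on \<open>z\<close> and \<open>z'\<close>, so these are
  summed by the triangle inequality. The \<open>p^2\<close> values of \<open>(z, z')\<close> cancel
  the normalisation of the expansion, and the \<open>p (p - 1)\<close> frequencies, rounded up to
  \<open>p^2\<close>, give the prefactor.\<close>

lemma nmExt_trace_norm_le:
  fixes \<phi> :: "'p::prime_card mod_ring vec \<Rightarrow> 'q::{field,finite}"
    and Adv :: "('p mod_ring vec \<times> 'e) operator \<Rightarrow> ('p mod_ring vec \<times> 'f) operator"
    and n :: nat and c :: real
  defines "Y \<equiv> carrier_vec (n div 2)"
  assumes p2: "CARD('p) \<noteq> 2" and n: "n > 0" "even n"
    and bij: "bij_betw \<phi> Y UNIV" and lin: "prime_field_linear (n div 2) \<phi>"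
    and fin: "finite E" "finite F"
    and Adv: "cptp (Y \<times> E) (Y \<times> F) Adv" and cq: "cq_state (carrier_vec n) E \<rho>"
    and kraus: "kraus_form Y E F Adv m L"
    and diag: "\<forall>k<m. \<forall>y\<in>Y. \<forall>f\<in>F. \<forall>e\<in>E. L k y y f e = 0"
    and \<sigma>: "positive_op E \<sigma>" "Re (op_trace E \<sigma>) \<le> 1" and "c \<ge> 0"
    and dom: "\<And>x v. x \<in> carrier_vec n \<Longrightarrow>
      Re (ip E v (app E (\<rho> x) v)) \<le> c * Re (ip E v (app E \<sigma> v))"
  shows "trace_norm (UNIV \<times> UNIV \<times> Y \<times> Y \<times> F)
      (distance_from_uniform (ext_state (carrier_vec n) (nmExt n \<phi>)
        (attack_state Y Adv (cq_op (carrier_vec n) \<rho>))))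
    \<le> CARD('p)\<^sup>2 / card Y * sqrt (c * CARD('p) ^ n * (2 * card Y))"
    (is "?tn \<le> _ / _ * ?B")
proof -
  define X where "X = (carrier_vec n :: 'p mod_ring vec set)"
  have finXY: "finite X" "finite Y" by (simp_all add: X_def Y_def)
  have nn: "n div 2 + n div 2 = n" "n div 2 > 0" using n by auto
  have \<rho>: "\<And>x. x \<in> X \<Longrightarrow> positive_op E (\<rho> x)" "(\<Sum>x\<in>X. op_trace E (\<rho> x)) = 1"
    using cq by (auto simp: cq_state_def X_def)
  define h where "h y = y @\<^sub>v vec_square (n div 2) \<phi> y" for y
  define \<gamma> where "\<gamma> a b y y' = a \<cdot>\<^sub>v h y + b \<cdot>\<^sub>v h y'" for a b y y'
  have h: "h y \<in> carrier_vec n" if "y \<in> Y" for y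
    using append_carrier_vec[OF that[unfolded Y_def] vec_square_carrier(1)[OF bij[unfolded Y_def]]]
    by (simp add: h_def nn)
  \<comment> \<open>The extractor is linear in the source, so the two outputs merge into a single
    character of \<open>x\<close>.\<close>
  have nm: "a * nmExt n \<phi> x y + b * nmExt n \<phi> x y' = x \<bullet> \<gamma> a b y y'"
    if "x \<in> X" "y \<in> Y" "y' \<in> Y" for a b x y y'
    using that(1) h[OF that(2)] h[OF that(3)]
    by (simp add: nmExt_def \<gamma>_def X_def scalar_prod_add_distrib flip: h_def)
  have tp: "(\<Sum>y'\<in>Y. \<Sum>k<m. norm_sq F (app E (L k y y') v)) = norm_sq E v" if "y \<in> Y" for y v
    using kraus that unfolding kraus_form_def by blast
  obtain W where W: "\<forall>z z'. \<forall>y\<in>Y. \<forall>y'\<in>Y. contraction_op F (W z z' y y')"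
    "complex_of_real ?tn
      = 1 / of_nat (card Y) * (\<Sum>z\<in>UNIV. \<Sum>z'\<in>UNIV. \<Sum>y\<in>Y. \<Sum>y'\<in>Y. \<Sum>x\<in>X.
          of_real (bias (nmExt n \<phi>) z z' x y y') *
          (\<Sum>f1\<in>F. \<Sum>f2\<in>F. W z z' y y' f2 f1 * (\<Sum>k<m. conj_op E (L k y y') (\<rho> x) f1 f2)))"
    unfolding X_def
    by (rule attack_trace_norm[OF finXY(1)[unfolded X_def] finXY(2) fin Adv cq kraus, where ext = "nmExt n \<phi>"])
  define \<tau> where "\<tau> z z' y y' x
    = (\<Sum>f1\<in>F. \<Sum>f2\<in>F. W z z' y y' f2 f1 * (\<Sum>k<m. conj_op E (L k y y') (\<rho> x) f1 f2))" for z z' y y' x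
  define T where "T z z' a b = (\<Sum>y\<in>Y. \<Sum>y'\<in>Y. \<Sum>x\<in>X. fchar (x \<bullet> \<gamma> a b y y') * \<tau> z z' y y' x)" for z z' a b
  have T: "cmod (T z z' a b) \<le> ?B" if "a \<noteq> 0" for z z' a b
  proof -
    have "(cmod (T z z' a b))\<^sup>2 \<le> c * real (CARD('p) ^ n) * (2 * real (card Y))"
      unfolding T_def \<tau>_def
    proof (rule attack_fourier_bound[OF finXY fin _ _ _ \<open>c \<ge> 0\<close> \<rho> \<sigma>])
      show "finite (carrier_vec n :: 'p mod_ring vec set)" by simp
      show "(\<Sum>x\<in>X. fchar (x \<bullet> g) * cnj (fchar (x \<bullet> g')))
          = (if g = g' then complex_of_real (real (CARD('p) ^ n)) else 0)"
        if "g \<in> carrier_vec n" "g' \<in> carrier_vec n" for g g'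
        unfolding X_def by (rule fchar_orthogonality[OF that])
      show "\<gamma> a b y y' \<in> carrier_vec n" if "y \<in> Y" "y' \<in> Y" for y y'
        using h that by (simp add: \<gamma>_def)
      show "card {y \<in> Y. \<exists>y'\<in>Y. y' \<noteq> y \<and> \<gamma> a b y y' = g} \<le> 2" if "g \<in> carrier_vec n" for g
        unfolding Y_def \<gamma>_def h_def
        using card_frequency_fibre[OF p2 nn(2) bij[unfolded Y_def] lin \<open>a \<noteq> 0\<close>] that nn(1) by simp
    qed (use tp diag dom W(1) in \<open>simp_all add: X_def\<close>)
    thus ?thesis by (intro real_le_rsqrt) simp
  qed
  have expand: "(\<Sum>y\<in>Y. \<Sum>y'\<in>Y. \<Sum>x\<in>X. of_real (bias (nmExt n \<phi>) z z' x y y') * \<tau> z z' y y' x)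
      = 1 / of_nat (CARD('p)\<^sup>2) *
        (\<Sum>a\<in>UNIV - {0}. \<Sum>b\<in>UNIV. fchar (- (a * z) - b * z') * T z z' a b)" for z z'
  proof -
    have "(\<Sum>y\<in>Y. \<Sum>y'\<in>Y. \<Sum>x\<in>X. of_real (bias (nmExt n \<phi>) z z' x y y') * \<tau> z z' y y' x)
        = (\<Sum>y\<in>Y. \<Sum>y'\<in>Y. \<Sum>x\<in>X. \<Sum>a\<in>UNIV - {0}. \<Sum>b\<in>UNIV. 1 / of_nat (CARD('p)\<^sup>2) *
            (fchar (- (a * z) - b * z') * (fchar (x \<bullet> \<gamma> a b y y') * \<tau> z z' y y' x)))"
      by (intro sum.cong refl)
        (simp add: bias_fourier nm sum_distrib_left sum_distrib_right mult.assoc)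
    also have "\<dots> = (\<Sum>y\<in>Y. \<Sum>y'\<in>Y. \<Sum>a\<in>UNIV - {0}. \<Sum>b\<in>UNIV. \<Sum>x\<in>X. 1 / of_nat (CARD('p)\<^sup>2) *
            (fchar (- (a * z) - b * z') * (fchar (x \<bullet> \<gamma> a b y y') * \<tau> z z' y y' x)))"
      by (intro sum.cong refl sum_swap_1_2)
    also have "\<dots> = (\<Sum>a\<in>UNIV - {0}. \<Sum>b\<in>UNIV. \<Sum>y\<in>Y. \<Sum>y'\<in>Y. \<Sum>x\<in>X. 1 / of_nat (CARD('p)\<^sup>2) *
            (fchar (- (a * z) - b * z') * (fchar (x \<bullet> \<gamma> a b y y') * \<tau> z z' y y' x)))"
      by (rule sum_swap_2_2)
    finally show ?thesis unfolding T_def sum_distrib_left .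
  qed
  have "?tn \<le> cmod (complex_of_real ?tn)" by simp
  also have "\<dots> \<le> 1 / card Y * (\<Sum>z\<in>(UNIV :: 'p mod_ring set). \<Sum>z'\<in>(UNIV :: 'p mod_ring set).
      1 / (CARD('p)\<^sup>2) * (\<Sum>a\<in>UNIV - {0 :: 'p mod_ring}. \<Sum>b\<in>(UNIV :: 'p mod_ring set). ?B))"
    unfolding W(2) \<tau>_def[symmetric] expand norm_mult norm_divide norm_of_nat norm_one
  proof (intro mult_left_mono sum_norm_le)
    fix z z' :: "'p mod_ring"
    have "cmod (\<Sum>a\<in>UNIV - {0}. \<Sum>b\<in>UNIV. fchar (- (a * z) - b * z') * T z z' a b)
        \<le> (\<Sum>a\<in>UNIV - {0 :: 'p mod_ring}. \<Sum>b\<in>(UNIV :: 'p mod_ring set). ?B)"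
      by (intro sum_norm_le) (use T in \<open>simp add: norm_mult cmod_fchar\<close>)
    thus "cmod (1 / of_nat (CARD('p)\<^sup>2) * (\<Sum>a\<in>UNIV - {0}. \<Sum>b\<in>UNIV. fchar (- (a * z) - b * z') * T z z' a b))
        \<le> 1 / (CARD('p)\<^sup>2) * (\<Sum>a\<in>UNIV - {0 :: 'p mod_ring}. \<Sum>b\<in>(UNIV :: 'p mod_ring set). ?B)"
      unfolding norm_mult norm_divide norm_of_nat norm_one by (rule mult_left_mono) simp
  qed simp
  also have "\<dots> = real (CARD('p) * (CARD('p) - 1)) / card Y * ?B"
    by (simp add: power2_eq_square field_simps card_Diff_singleton)
  also have "\<dots> \<le> CARD('p)\<^sup>2 / card Y * ?B"
    by (intro mult_right_mono divide_right_mono) (auto simp: power2_eq_square \<open>c \<ge> 0\<close>)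
  finally show ?thesis .
qed

theorem theorem1:
  fixes \<phi> :: "'p::prime_card mod_ring vec \<Rightarrow> 'q::{field,finite}"
    and n :: nat and \<epsilon> :: real
  assumes "CARD('p) \<noteq> 2"
    and "n > 0" and "even n"
    and "CARD('q) = CARD('p) ^ (n div 2)"
    and "bij_betw \<phi> (carrier_vec (n div 2)) UNIV"
    and "prime_field_linear (n div 2) \<phi>"
    and "\<epsilon> > 0"
  shows "quantum_proof_nm_extractor
           (carrier_vec n) (carrier_vec (n div 2)) (UNIV :: 'p mod_ring set)
           (nmExt n \<phi>)
           ((real n / 2 + 6) * log 2 (real CARD('p)) - 1 + 4 * log 2 (1 / \<epsilon>)) \<epsilon>"
proof -
  define p where "p = CARD('p)"
  define q where "q = p ^ (n div 2)"
  define k where "k = (real n / 2 + 6) * log 2 (real CARD('p)) - 1 + 4 * log 2 (1 / \<epsilon>)"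
  define X where "X = (carrier_vec n :: 'p mod_ring vec set)"
  define Y where "Y = (carrier_vec (n div 2) :: 'p mod_ring vec set)"
  have p: "p \<ge> 2" unfolding p_def using prime_card[where 'a = 'p] by (rule prime_ge_2_nat)
  hence q: "q > 0" by (simp add: q_def)
  have cardY: "card Y = q" by (simp add: Y_def q_def p_def card_carrier_vec)
  have fin: "finite X" "finite Y" by (simp_all add: X_def Y_def)
  have half: "real (n div 2) = real n / 2" using \<open>even n\<close> by auto
  have main: "1 / 2 * trace_norm (UNIV \<times> UNIV \<times> Y \<times> Y \<times> {..<d'})
      (distance_from_uniform (ext_state X (nmExt n \<phi>) (attack_state Y Adv (cq_op X \<rho>)))) \<le> \<epsilon>"
    if cq: "cq_state X {..<d} \<rho>" and ent: "min_entropy X {..<d} \<rho> \<ge> k"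
      and Adv: "cptp (Y \<times> {..<d}) (Y \<times> {..<d'}) Adv"
      and nfp: "no_fixed_points Y {..<d} {..<d'} Adv"
    for d d' :: nat and \<rho> Adv
  proof -
    let ?tn = "trace_norm (UNIV \<times> UNIV \<times> Y \<times> Y \<times> {..<d'})
      (distance_from_uniform (ext_state X (nmExt n \<phi>) (attack_state Y Adv (cq_op X \<rho>))))"
    obtain m L where kraus: "kraus_form Y {..<d} {..<d'} Adv m L"
      and diag: "\<forall>k<m. \<forall>y\<in>Y. \<forall>f\<in>{..<d'}. \<forall>e\<in>{..<d}. L k y y f e = 0"
      by (rule attack_kraus_form[OF fin(2) finite_lessThan finite_lessThan Adv nfp])
    show ?thesis
    proof (cases "\<epsilon> \<ge> 1")
      case True
      have "?tn \<le> 2"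
        by (rule attack_trace_norm_le_2[OF fin finite_lessThan finite_lessThan Adv cq kraus])
      thus ?thesis using True by simp
    next
      case False
      \<comment> \<open>One bit is given away for a strict inequality, which yields a dominating
        state without the maximum.\<close>
      have "k - 1 < min_entropy X {..<d} \<rho>" using ent by simp
      then obtain l \<sigma> where l: "k - 1 < l" and \<sigma>: "positive_op {..<d} \<sigma>" "Re (op_trace {..<d} \<sigma>) \<le> 1"
        and dom: "\<forall>x\<in>X. \<forall>v. Re (ip {..<d} v (app {..<d} (\<rho> x) v))
          \<le> 2 powr (- l) * Re (ip {..<d} v (app {..<d} \<sigma> v))"
        by (rule min_entropy_dominating_state[OF fin(1) cq])
      define c where "c = 2 powr (- l)"
      have "?tn \<le> p\<^sup>2 / card Y * sqrt (c * p ^ n * (2 * card Y))"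
        using nmExt_trace_norm_le[of n \<phi> "{..<d}" "{..<d'}" Adv \<rho> m L \<sigma> c]
          assms cq kraus diag \<sigma> dom Adv by (simp add: c_def p_def X_def Y_def)
      \<comment> \<open>The target is chosen so that the prefactor \<open>p^2 / q\<close> turns it
        into \<open>2 \<epsilon>^2\<close>.\<close>
      also have "sqrt (c * p ^ n * (2 * card Y)) \<le> 2 * q * \<epsilon>\<^sup>2 / p\<^sup>2"
      proof (rule real_le_lsqrt)
        have "c \<le> 2 powr (1 - k)" using l by (simp add: c_def)
        \<comment> \<open>The \<open>- 1\<close> in \<open>k\<close> and the bit given away combine
          to the summand \<open>2\<close>, hence to the factor \<open>4\<close> in the bound on
          \<open>c\<close>.\<close>
        also have "1 - k = 2 + 4 * log 2 \<epsilon> - (real (n div 2) + 6) * log 2 p"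
          using \<open>\<epsilon> > 0\<close> by (simp add: k_def p_def half log_divide)
        also have "2 powr \<dots> = 2 powr 2 * (2 powr (log 2 \<epsilon> * 4)) / 2 powr (log 2 p * (real (n div 2) + 6))"
          by (simp add: powr_diff powr_add mult.commute)
        also have "\<dots> = 4 * \<epsilon> ^ 4 / (q * p ^ 6)"
        proof -
          have "2 powr (log 2 \<epsilon> * 4) = \<epsilon> ^ 4"
            using \<open>\<epsilon> > 0\<close> powr_realpow[of \<epsilon> 4] by (simp flip: powr_powr)
          moreover have "2 powr (log 2 p * (real (n div 2) + 6)) = real q * real p ^ 6"
            using p powr_realpow[of "real p" "n div 2 + 6"]
            by (simp add: q_def power_add flip: powr_powr)
          ultimately show ?thesis by simp
        qed
        finally have c: "c \<le> 4 * \<epsilon> ^ 4 / (q * p ^ 6)" .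
        have "p ^ n = q\<^sup>2" using \<open>even n\<close> by (simp add: q_def flip: power_mult)
        hence "c * p ^ n * (2 * card Y) = c * (2 * real q ^ 3)"
          by (simp add: cardY power2_eq_square power3_eq_cube)
        also have "\<dots> \<le> 4 * \<epsilon> ^ 4 / (q * p ^ 6) * (2 * real q ^ 3)"
          by (intro mult_right_mono c) simp
        also have "\<dots> = 2 / real p ^ 2 * (4 * \<epsilon> ^ 4 * real q ^ 2 / real p ^ 4)"
          using p q by (simp add: divide_simps) (simp add: eval_nat_numeral)
        \<comment> \<open>The power \<open>p^6\<close> exceeds the \<open>p^4\<close> of the squared
          target by \<open>p^2\<close>, which absorbs the factor two for seeds sharing a
          frequency.\<close>
        also have "\<dots> \<le> 1 * (4 * \<epsilon> ^ 4 * real q ^ 2 / real p ^ 4)"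
        proof (rule mult_right_mono)
          have "2 ^ 2 \<le> real p ^ 2" using p by (intro power_mono) auto
          thus "2 / real p ^ 2 \<le> 1" using p by (simp add: divide_le_eq_1)
        qed simp
        also have "\<dots> = (2 * q * \<epsilon>\<^sup>2 / p\<^sup>2)\<^sup>2"
          by (simp add: power_divide power_mult_distrib flip: power_mult)
        finally show "c * p ^ n * (2 * card Y) \<le> (2 * q * \<epsilon>\<^sup>2 / p\<^sup>2)\<^sup>2" .
      qed simp
      finally have "?tn \<le> p\<^sup>2 / q * (2 * q * \<epsilon>\<^sup>2 / p\<^sup>2)"
        by (simp add: cardY mult_left_mono divide_right_mono)
      also have "\<dots> = 2 * \<epsilon>\<^sup>2" using p q by simp
      also have "\<epsilon>\<^sup>2 \<le> \<epsilon>" using False \<open>\<epsilon> > 0\<close> by (simp add: power2_eq_square mult_left_le)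
      finally show ?thesis by simp
    qed
  qed
  show ?thesis
    unfolding quantum_proof_nm_extractor_def Let_def k_def[symmetric]
    using fin main by (auto simp: X_def Y_def)
qed

end
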